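(* Let $d\ge 3$ be a fixed integer and let $\omega(n)$ be any function with $\omega(n)\to\infty$ as $n\to\infty$. Let $G\in\mathcal{G}_{n,d}$ be a uniformly random $d$-regular graph on $n$ vertices, and choose vertices $u$ and $v$ of $G$ independently, each with uniform probability. Then asymptotically almost surely the following hold: (i) $|d_G(u,v)-\log_{d-1}n|<\omega(n)$; (ii) there are $d$ paths connecting $u$ and $v$ in $G$ such that the subgraph induced by each pair of these paths is an almost geodesic cycle, that is, a cycle $C$ such that for every two vertices $x,y$ of $C$, $d_G(x,y)\ge d_C(x,y)-e(n)$, where $e(n)=\log_{d-1}\log_{d-1}n+\omega(n)$.
   Context: $\mathcal{G}_{n,d}$ denotes the probability space of (simple, labelled) $d$-regular graphs on $n$ vertices with the uniform distribution. Asymptotics are for $n\to\infty$ with $d\ge3$ fixed, and $n$ restricted to even values if $d$ is odd. "Asymptotically almost surely" (a.a.s.) means with probability tending to $1$ as $n\to\infty$. $d_G$ denotes graph distance in $G$ and $d_C$ denotes distance along the cycle $C$. *)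

theory Defs
  imports
    "HOL-Probability.Probability"
    "Graph_Theory.Pair_Digraph"
    "Graph_Theory.Digraph_Component"
    "Graph_Theory.Shortest_Path"
begin

text \<open>A simple undirected graph is a \<^locale>\<open>pair_graph\<close>: a finite symmetric loop-free
  digraph without parallel arcs, each edge being represented by its two arcs. Out-degree is therefore
  the ordinary degree.\<close>

definition regular_graphs :: "nat \<Rightarrow> nat \<Rightarrow> nat pair_pre_digraph set" where
  "regular_graphs n d =
     {G. pair_graph G \<and> pverts G = {..<n} \<and> (\<forall>v\<in>pverts G. out_degree (with_proj G) v = d)}"

text \<open>For odd \<^term>\<open>d\<close> and odd \<^term>\<open>n\<close>, or for small \<^term>\<open>n\<close>, \<^term>\<open>regular_graphs n d\<close>
  is empty and \<^const>\<open>pmf_of_set\<close> is unspecified; the filter \<open>n_to_infinity\<close> below ignores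
  these values of \<^term>\<open>n\<close>.\<close>

definition random_regular_graph :: "nat \<Rightarrow> nat \<Rightarrow> nat pair_pre_digraph pmf" where
  "random_regular_graph n d = pmf_of_set (regular_graphs n d)"

definition random_graph_and_vertices ::
    "nat \<Rightarrow> nat \<Rightarrow> (nat pair_pre_digraph \<times> nat \<times> nat) pmf" where
  "random_graph_and_vertices n d =
     pair_pmf (random_regular_graph n d) (pair_pmf (pmf_of_set {..<n}) (pmf_of_set {..<n}))"

definition n_to_infinity :: "nat \<Rightarrow> nat filter" where
  "n_to_infinity d = inf sequentially (principal {n. odd d \<longrightarrow> even n})"

text \<open>Infinite for vertices in different components.\<close>

definition graph_dist :: "('a, 'b) pre_digraph \<Rightarrow> 'a \<Rightarrow> 'a \<Rightarrow> ereal" where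
  "graph_dist G u v = wf_digraph.\<mu> G (\<lambda>_. 1) u v"

text \<open>\<^const>\<open>pre_digraph.cycle\<close> is about directed closed walks, so it also holds of the two arcs of
  a single edge traversed back and forth; hence the lower bound on the length.\<close>

definition is_cycle_graph :: "('a, 'b) pre_digraph \<Rightarrow> bool" where
  "is_cycle_graph C \<longleftrightarrow> graph C \<and>
     (\<exists>c. pre_digraph.cycle C c \<and> 3 \<le> length c \<and>
          verts C = tail C ` set c \<and>
          arcs_ends C = (\<Union>a\<in>set c. {(tail C a, head C a), (head C a, tail C a)}))"

definition almost_geodesic_cycle ::
    "('a, 'b) pre_digraph \<Rightarrow> real \<Rightarrow> ('a, 'b) pre_digraph \<Rightarrow> bool" where
  "almost_geodesic_cycle G e C \<longleftrightarrow> subgraph C G \<and> is_cycle_graph C \<and>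
     (\<forall>x\<in>verts C. \<forall>y\<in>verts C. graph_dist G x y \<ge> graph_dist C x y - ereal e)"

definition path_verts :: "('a, 'b) pre_digraph \<Rightarrow> 'a \<Rightarrow> 'b awalk \<Rightarrow> 'a set" where
  "path_verts G u p = set (pre_digraph.awalk_verts G u p)"

text \<open>The paths form a set of cardinality \<^term>\<open>d\<close>, i.e. they are distinct, and pairs are
  pairs of distinct paths. The subgraph induced by two paths is the one induced in \<^term>\<open>G\<close>
  by their vertices; as it is required to be a cycle and the paths are distinct with the same ends,
  it is also the union of the two paths.\<close>

definition joined_by_almost_geodesic_cycles ::
    "('a, 'b) pre_digraph \<Rightarrow> nat \<Rightarrow> real \<Rightarrow> 'a \<Rightarrow> 'a \<Rightarrow> bool" where
  "joined_by_almost_geodesic_cycles G d e u v \<longleftrightarrow>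
     (\<exists>P. finite P \<and> card P = d \<and> (\<forall>p\<in>P. pre_digraph.apath G u p v) \<and>
          (\<forall>p\<in>P. \<forall>q\<in>P. p \<noteq> q \<longrightarrow>
             almost_geodesic_cycle G e (G \<restriction> (path_verts G u p \<union> path_verts G u q))))"

end

theory Submission
  imports Defs "HOL-Library.Sublist" "HOL-Real_Asymp.Real_Asymp"
begin

text \<open>Write \<open>b = d - 1\<close>. All estimates come from switchings on \<open>d\<close>-regular graphs; no pairing model is
  needed. A first switching shows that, given any moderate set of edges, a further prescribed edge is
  present with probability \<open>O(1/n)\<close>. Together with the bound \<open>O(b^k)\<close> for the number of paths of length
  \<open>k\<close> from a vertex, it yields two first moment bounds for fixed \<open>u \<noteq> v\<close>.

  The breadth first search trees of depth \<open>r\<close> at \<open>u\<close> and \<open>v\<close>, where \<open>b^(2r)\<close> is slightly larger than \<open>n\<close>,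
  meet or close cycles so rarely that in each of the \<open>d\<close> branches at least half of the \<open>b^(r-1)\<close>
  possible leaves survive. A second switching then shows that every branch at \<open>u\<close> is linked by an edge
  to every branch at \<open>v\<close>: a graph without such an edge has about \<open>b^(2r)\<close> switchings that create one,
  each result arising from only \<open>O(n)\<close> graphs. This gives \<open>d\<close> internally disjoint paths of length
  \<open>L = 2r + 1\<close>.

  On the other hand there are \<open>O((b^L/n)^2)\<close> cycles formed by two such paths on average, hardly more than
  a constant. A cycle has \<open>O(L)\<close> pairs of vertices at each distance, hence expects \<open>O(L b^(L-e)/n)\<close> paths
  that are shorter by \<open>e\<close> than the way around the cycle, and this vanishes if \<open>b^e\<close> is much larger
  than \<open>L\<close>. The lower bound on the distance of \<open>u\<close> and \<open>v\<close> just counts vertices of a ball.\<close>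

section \<open>Switchings of regular graphs\<close>

text \<open>The obstacle is that \<open>2 * r\<close> exceeds the logarithm of \<open>n\<close>:
  trees of this depth cannot be expected to avoid cycles and each other altogether. Goodness is
  therefore asked of single paths from the root, and the losses are only bounded on average.
  Switchings offer no independence, so every first moment is assembled from steps with one edge: all
  edges of a structure but the last are counted through the degrees, and only the closing edge earns
  a factor of order 1/n. A cycle with a shortcut takes three such steps, one for each of its two
  paths and one for the shortcut; hence the factor \<open>n ^ 3\<close>. The paths produced by
  linking depend on the graph in an intricate way. As they all have the same length
  \<open>L\<close>, it is enough to exclude shortcuts for all pairs of paths of length
  \<open>L\<close> from \<open>u\<close> to \<open>v\<close> that meet only in their ends. The
  linking switching has to be undone with few choices. It therefore leaves both search trees intact,
  so that the leaves among which the new link is sought can be read off from the switched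
  graph.\<close>

definition reg_rels :: "nat \<Rightarrow> nat \<Rightarrow> (nat \<times> nat) set set" where
  "reg_rels n d = {E. E \<subseteq> {..<n} \<times> {..<n} \<and> sym E \<and> irrefl E \<and> (\<forall>v<n. card (E `` {v}) = d)}"

definition switch :: "('a \<times> 'a) set \<Rightarrow> 'a \<Rightarrow> 'a \<Rightarrow> 'a \<Rightarrow> 'a \<Rightarrow> ('a \<times> 'a) set" where
  "switch E p q r s = (E - {(p,q),(q,p),(r,s),(s,r)}) \<union> {(p,r),(r,p),(q,s),(s,q)}"

lemma finite_reg_rels [simp]: "finite (reg_rels n d)"
  by (rule finite_subset[of _ "Pow ({..<n} \<times> {..<n})"]) (auto simp: reg_rels_def)

context
  fixes n d :: nat and E :: "(nat \<times> nat) set"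
  assumes E: "E \<in> reg_rels n d"
begin

lemma reg_rels_sym: "(x, y) \<in> E \<Longrightarrow> (y, x) \<in> E"
  using E by (auto simp: reg_rels_def dest: symD)

lemma reg_rels_irrefl: "(x, y) \<in> E \<Longrightarrow> x \<noteq> y"
  using E by (auto simp: reg_rels_def irrefl_def)

lemma reg_rels_verts: "(x, y) \<in> E \<Longrightarrow> x < n \<and> y < n"
  using E by (auto simp: reg_rels_def)

lemma finite_reg_rel: "finite E"
  using E by (auto simp: reg_rels_def intro: finite_subset)

lemma finite_nbrs: "finite (E `` {x})"
  using finite_reg_rel by (rule finite_Image)

lemma card_nbrs: "x < n \<Longrightarrow> card (E `` {x}) = d"
  using E by (auto simp: reg_rels_def)

lemma card_nbrs_le: "card (E `` {x}) \<le> d"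
proof (cases "x < n")
  case False
  then have "E `` {x} = {}" using reg_rels_verts by blast
  then show ?thesis by (metis card.empty le0)
qed (simp add: card_nbrs)

lemma card_arcs_from:
  assumes "finite S" shows "card {(x, y) \<in> E. x \<in> S} \<le> card S * d"
proof -
  have "{(x, y) \<in> E. x \<in> S} = Sigma S (\<lambda>x. E `` {x})" by auto
  then show ?thesis
    using sum_bounded_above[of S "\<lambda>x. card (E `` {x})" d] card_nbrs_le assms
    by (simp add: card_SigmaI finite_nbrs)
qed

lemma card_arcs_to:
  assumes "finite S" shows "card {(x, y) \<in> E. y \<in> S} \<le> card S * d"
proof -
  have "card {(x, y) \<in> E. y \<in> S} = card (prod.swap ` {(x, y) \<in> E. y \<in> S})"
    by (simp add: card_image)
  also have "prod.swap ` {(x, y) \<in> E. y \<in> S} = {(x, y) \<in> E. x \<in> S}"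
    using reg_rels_sym by (auto simp: image_iff)
  finally show ?thesis using card_arcs_from[OF assms] by simp
qed

lemma card_reg_rel: "card E = n * d"
proof -
  have "E = Sigma {..<n} (\<lambda>x. E `` {x})" using reg_rels_verts by auto
  then have "card E = card (Sigma {..<n} (\<lambda>x. E `` {x}))" by simp
  also have "\<dots> = n * d"
    by (subst card_SigmaI) (auto simp: finite_nbrs card_nbrs)
  finally show ?thesis .
qed

context
  fixes p q r s
  assumes sw: "(p, q) \<in> E" "(r, s) \<in> E" "(p, r) \<notin> E" "(q, s) \<notin> E" "p \<noteq> r" "q \<noteq> s"
begin

lemma switch_distinct: "distinct [p, q, r, s]"
  using sw reg_rels_irrefl reg_rels_sym by auto

lemma switch_in_reg_rels: "switch E p q r s \<in> reg_rels n d"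
proof -
  let ?E = "switch E p q r s"
  have dist: "p \<noteq> q" "p \<noteq> r" "p \<noteq> s" "q \<noteq> r" "q \<noteq> s" "r \<noteq> s" using switch_distinct by auto
  have sy: "(q, p) \<in> E" "(s, r) \<in> E" "(r, p) \<notin> E" "(s, q) \<notin> E" using sw reg_rels_sym by auto
  have 1: "?E `` {p} = insert r (E `` {p} - {q})"
    "?E `` {q} = insert s (E `` {q} - {p})"
    "?E `` {r} = insert p (E `` {r} - {s})"
    "?E `` {s} = insert q (E `` {s} - {r})"
    using dist by (auto simp: switch_def)
  have 2: "?E `` {v} = E `` {v}" if "v \<notin> {p, q, r, s}" for v
    using that by (auto simp: switch_def)
  \<comment> \<open>Each of the four vertices trades one neighbour for a new one.\<close>
  have 3: "card (insert y (S - {x})) = card S" if "finite S" "x \<in> S" "y \<notin> S" for x y :: nat and S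
    using that by (metis DiffD1 card_Suc_Diff1 card_insert_disjoint finite_Diff)
  have "card (?E `` {v}) = d" if "v < n" for v
  proof (cases "v \<in> {p, q, r, s}")
    case True
    then consider "v = p" | "v = q" | "v = r" | "v = s" by blast
    then have "card (?E `` {v}) = card (E `` {v})"
      by cases (simp only: 1, rule 3, use sw sy finite_nbrs in auto)+
    then show ?thesis using that card_nbrs by simp
  next
    case False
    then show ?thesis using that card_nbrs 2 by simp
  qed
  moreover have "?E \<subseteq> {..<n} \<times> {..<n}"
    using sw reg_rels_verts by (auto simp: switch_def)
  moreover have "sym ?E" by (rule symI) (auto simp: switch_def intro: reg_rels_sym)
  moreover have "irrefl ?E"
    using dist reg_rels_irrefl by (auto simp: switch_def irrefl_def)
  ultimately show ?thesis by (simp add: reg_rels_def)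
qed

text \<open>Exchanging the two middle arguments inverts a switching. A switched graph together with
  the four labels thus determines the original graph, which gives the injectivity in the double
  counts.\<close>

lemma switch_switch: "switch (switch E p q r s) p r q s = E"
proof -
  have "(q, p) \<in> E" "(s, r) \<in> E" "(r, p) \<notin> E" "(s, q) \<notin> E" using sw reg_rels_sym by auto
  then show ?thesis using sw switch_distinct by (auto simp: switch_def)
qed

end

end

section \<open>Double counting by switchings\<close>

text \<open>\<open>Q x\<close> stands for the switchings applicable to \<open>x\<close>, and
  \<open>P y\<close> for the data from which a switching leading to \<open>y\<close> is recovered.
  Many of the former and few of the latter make \<open>X\<close> small against
  \<open>Y\<close>.\<close>

lemma double_count:
  assumes "finite X" "finite Y"
    and "\<And>x. x \<in> X \<Longrightarrow> finite (Q x) \<and> M \<le> card (Q x)"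
    and "\<And>y. y \<in> Y \<Longrightarrow> finite (P y) \<and> card (P y) \<le> N"
    and "inj_on \<phi> (Sigma X Q)"
    and "\<And>x z. x \<in> X \<Longrightarrow> z \<in> Q x \<Longrightarrow> \<phi> (x, z) \<in> Sigma Y P"
  shows "card X * M \<le> card Y * (N::nat)"
proof -
  have "card X * M \<le> (\<Sum>x\<in>X. card (Q x))"
    using assms(3) sum_bounded_below[of X M "\<lambda>x. card (Q x)"] by simp
  also have "\<dots> = card (Sigma X Q)"
    using assms by (subst card_SigmaI) auto
  also have "\<dots> = card (\<phi> ` Sigma X Q)"
    using assms(5) by (simp add: card_image)
  also have "\<dots> \<le> card (Sigma Y P)"
  proof (rule card_mono)
    show "\<phi> ` Sigma X Q \<subseteq> Sigma Y P" using assms(6) by (blast elim: SigmaE)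
  qed (use assms in auto)
  also have "\<dots> = (\<Sum>y\<in>Y. card (P y))"
    using assms by (subst card_SigmaI) auto
  also have "\<dots> \<le> card Y * N"
    using assms(4) sum_bounded_above[of Y "\<lambda>y. card (P y)" N] by simp
  finally show ?thesis .
qed

text \<open>The edge \<open>ab\<close> is switched away against a second arc \<open>xy\<close>,
  taken from the \<open>n * d\<close> arcs without those in \<open>F\<close> and those with
  \<open>x\<close> in the closed neighbourhood of \<open>a\<close> or \<open>y\<close> in that of
  \<open>b\<close>. Afterwards \<open>x\<close> is a neighbour of \<open>a\<close> and
  \<open>y\<close> one of \<open>b\<close>, so at most \<open>d\<^sup>2\<close> switchings lead to
  the same graph. The subtraction truncates; the inequality has content only for large
  \<open>n\<close>.\<close>

lemma forced_arc_count:
  assumes F: "sym F" "finite F" "(a, b) \<notin> F"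
  shows "card {E \<in> reg_rels n d. F \<subseteq> E \<and> (a, b) \<in> E} * (n * d - card F - 2 * ((d + 1) * d))
    \<le> card {E \<in> reg_rels n d. F \<subseteq> E} * d\<^sup>2"
proof (rule double_count[where \<phi> = "\<lambda>(E, x, y). (switch E a b x y, x, y)"
      and Q = "\<lambda>E. {(x, y) \<in> E - F. x \<notin> insert a (E `` {a}) \<and> y \<notin> insert b (E `` {b})}"
      and P = "\<lambda>E. (E `` {a}) \<times> (E `` {b})"])
  fix E assume "E \<in> {E \<in> reg_rels n d. F \<subseteq> E \<and> (a, b) \<in> E}"
  then have E: "E \<in> reg_rels n d" and FE: "F \<subseteq> E" and "(a, b) \<in> E" by auto
  let ?A = "insert a (E `` {a})" and ?B = "insert b (E `` {b})"
  let ?Q = "{(x, y) \<in> E - F. x \<notin> ?A \<and> y \<notin> ?B}"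
  let ?X = "{(x, y) \<in> E. x \<in> ?A}" and ?Y = "{(x, y) \<in> E. y \<in> ?B}"
  note fin = finite_nbrs[OF E] finite_reg_rel[OF E]
  have cA: "card (insert a (E `` {a})) \<le> d + 1" for a :: nat
    using card_nbrs_le[OF E, of a] fin by (metis add.commute card_insert_le_m1 add_diff_cancel_left' zero_less_Suc plus_1_eq_Suc)
  have "card ?X \<le> (d + 1) * d"
    by (rule order_trans[OF card_arcs_from[OF E] mult_le_mono1[OF cA]]) (use fin in auto)
  moreover have "card ?Y \<le> (d + 1) * d"
    by (rule order_trans[OF card_arcs_to[OF E] mult_le_mono1[OF cA]]) (use fin in auto)
  moreover have "card E \<le> card (F \<union> ?X \<union> ?Y \<union> ?Q)"
    using fin F by (intro card_mono) (auto intro: finite_subset[of _ E])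
  moreover have "card (F \<union> ?X \<union> ?Y \<union> ?Q) \<le> card F + card ?X + card ?Y + card ?Q"
    by (meson card_Un_le add_le_mono le_refl order_trans)
  ultimately show "finite ?Q \<and> n * d - card F - 2 * ((d + 1) * d) \<le> card ?Q"
    using card_reg_rel[OF E] fin by (auto intro: finite_subset[of _ E])
next
  fix E assume "E \<in> {E \<in> reg_rels n d. F \<subseteq> E}"
  then have E: "E \<in> reg_rels n d" by auto
  show "finite (E `` {a} \<times> E `` {b}) \<and> card (E `` {a} \<times> E `` {b}) \<le> d\<^sup>2"
    using finite_nbrs[OF E] card_nbrs_le[OF E]
    by (auto simp: card_cartesian_product power2_eq_square intro!: mult_le_mono)
next
  show "inj_on (\<lambda>(E, x, y). (switch E a b x y, x, y)) (SIGMA E:{E \<in> reg_rels n d. F \<subseteq> E \<and> (a, b) \<in> E}.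
      {(x, y) \<in> E - F. x \<notin> insert a (E `` {a}) \<and> y \<notin> insert b (E `` {b})})"
    by (rule inj_on_inverseI[where g = "\<lambda>(E, x, y). (switch E a x b y, x, y)"]) (auto simp: switch_switch)
next
  fix E z assume "E \<in> {E \<in> reg_rels n d. F \<subseteq> E \<and> (a, b) \<in> E}"
    "z \<in> {(x, y) \<in> E - F. x \<notin> insert a (E `` {a}) \<and> y \<notin> insert b (E `` {b})}"
  then obtain x y where z: "z = (x, y)" and *: "E \<in> reg_rels n d" "(a, b) \<in> E" "(x, y) \<in> E" "(a, x) \<notin> E"
    "(b, y) \<notin> E" "a \<noteq> x" "b \<noteq> y" and FE: "F \<subseteq> E" "(x, y) \<notin> F" by auto
  \<comment> \<open>None of the four arcs deleted by the switching lies in \<open>F\<close>, because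
    \<open>F\<close> is symmetric.\<close>
  have "(b, a) \<notin> F" "(y, x) \<notin> F" using F FE symD by metis+
  then have "F \<subseteq> switch E a b x y" using FE F(3) by (auto simp: switch_def)
  then show "(case (E, z) of (E, x, y) \<Rightarrow> (switch E a b x y, x, y)) \<in>
      (SIGMA E:{E \<in> reg_rels n d. F \<subseteq> E}. E `` {a} \<times> E `` {b})"
    using switch_in_reg_rels[OF *] z by (auto simp: switch_def)
qed auto

lemma sum_card_swap:
  assumes "finite S" "finite T"
  shows "(\<Sum>x\<in>S. card {t \<in> T. R x t}) = (\<Sum>t\<in>T. card {x \<in> S. R x t})"
  using sum.swap_restrict[OF assms, of "\<lambda>_ _. 1 :: nat" R] by simp

text \<open>The structures \<open>t\<close> consist of arcs \<open>F t\<close> and one closing arc \<open>(a t, b t)\<close>. Bounded degrees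
  bound the number of copies of the open structures in every single graph; closing them costs a
  factor of order \<open>1/n\<close> on average.\<close>

lemma closing_arc_count:
  assumes T: "finite T"
    and F: "\<And>t. t \<in> T \<Longrightarrow> sym (F t) \<and> finite (F t) \<and> card (F t) \<le> m \<and> (a t, b t) \<notin> F t"
    and n: "2 * (m + 2 * ((d + 1) * d)) \<le> n * d"
  shows "n * (\<Sum>E\<in>reg_rels n d. card {t \<in> T. F t \<subseteq> E \<and> (a t, b t) \<in> E})
    \<le> 2 * d * (\<Sum>E\<in>reg_rels n d. card {t \<in> T. F t \<subseteq> E})"
proof (cases "d = 0")
  case True
  have "(a t, b t) \<notin> E" if "E \<in> reg_rels n d" for t E
    using True card_reg_rel[OF that] finite_reg_rel[OF that] by auto
  then have "(\<Sum>E\<in>reg_rels n d. card {t \<in> T. F t \<subseteq> E \<and> (a t, b t) \<in> E}) = 0"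
    by (intro sum.neutral) simp
  then show ?thesis by simp
next
  case False
  have *: "n * card {E \<in> reg_rels n d. F t \<subseteq> E \<and> (a t, b t) \<in> E}
      \<le> 2 * d * card {E \<in> reg_rels n d. F t \<subseteq> E}" (is "n * ?N1 \<le> 2 * d * ?N0") if "t \<in> T" for t
  proof -
    \<comment> \<open>By the assumption on \<open>n\<close> at least half of the
      \<open>n * d\<close> arcs remain available for the switching; hence the factor 2.\<close>
    have "d * (n * ?N1) \<le> ?N1 * (2 * (n * d - card (F t) - 2 * ((d + 1) * d)))"
      using F[OF that] n by (auto simp: mult_ac intro!: mult_le_mono2)
    also have "\<dots> \<le> 2 * (?N0 * d\<^sup>2)"
      using forced_arc_count[of "F t" "a t" "b t" n d] F[OF that] by simp
    finally have "d * (n * ?N1) \<le> d * (2 * d * ?N0)" by (simp add: power2_eq_square mult_ac)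
    then show ?thesis using False by simp
  qed
  have "n * (\<Sum>E\<in>reg_rels n d. card {t \<in> T. F t \<subseteq> E \<and> (a t, b t) \<in> E})
      = (\<Sum>t\<in>T. n * card {E \<in> reg_rels n d. F t \<subseteq> E \<and> (a t, b t) \<in> E})"
    by (subst sum_card_swap) (auto simp: T sum_distrib_left)
  also have "\<dots> \<le> (\<Sum>t\<in>T. 2 * d * card {E \<in> reg_rels n d. F t \<subseteq> E})"
    by (intro sum_mono *)
  also have "\<dots> = 2 * d * (\<Sum>E\<in>reg_rels n d. card {t \<in> T. F t \<subseteq> E})"
    by (subst sum_card_swap) (auto simp: T sum_distrib_left)
  finally show ?thesis .
qed

section \<open>Paths\<close>

definition arcs_of :: "'a list \<Rightarrow> ('a \<times> 'a) set" where
  "arcs_of xs = set (zip xs (tl xs)) \<union> set (zip (tl xs) xs)"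

definition paths :: "('a \<times> 'a) set \<Rightarrow> 'a \<Rightarrow> nat \<Rightarrow> 'a list set" where
  "paths E u k = {xs. length xs = Suc k \<and> hd xs = u \<and> distinct xs \<and> arcs_of xs \<subseteq> E}"

lemma arcs_of_simps [simp]: "arcs_of [] = {}" "arcs_of [x] = {}"
  "arcs_of (x # y # xs) = {(x, y), (y, x)} \<union> arcs_of (y # xs)"
  by (auto simp: arcs_of_def)

lemma finite_arcs_of [simp]: "finite (arcs_of xs)"
  by (simp add: arcs_of_def)

lemma arcs_of_append:
  "xs \<noteq> [] \<Longrightarrow> ys \<noteq> [] \<Longrightarrow>
    arcs_of (xs @ ys) = arcs_of xs \<union> arcs_of ys \<union> {(last xs, hd ys), (hd ys, last xs)}"
proof (induction xs)
  case (Cons x xs)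
  then show ?case by (cases xs; cases ys) auto
qed simp

lemma arcs_of_snoc:
  "xs \<noteq> [] \<Longrightarrow> arcs_of (xs @ [z]) = arcs_of xs \<union> {(last xs, z), (z, last xs)}"
  by (simp add: arcs_of_append)

lemma arcs_of_rev [simp]: "arcs_of (rev xs) = arcs_of xs"
proof (induction xs)
  case (Cons x xs)
  show ?case
  proof (cases xs)
    case (Cons a l)
    then have "arcs_of (rev xs @ [x]) = arcs_of (rev xs) \<union> {(a, x), (x, a)}"
      by (subst arcs_of_append) auto
    with Cons.IH have "arcs_of (rev xs @ [x]) = arcs_of xs \<union> {(a, x), (x, a)}" by simp
    with Cons show ?thesis by auto
  qed simp
qed simp

lemma arcs_of_in_set: "(x, y) \<in> arcs_of xs \<Longrightarrow> x \<in> set xs \<and> y \<in> set xs"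
proof (induction xs)
  case (Cons a xs)
  then show ?case by (cases xs) auto
qed simp

lemma sym_arcs_of: "sym (arcs_of xs)"
  by (auto simp: arcs_of_def sym_def in_set_zip)

lemma arcs_of_commute: "(x, y) \<in> arcs_of xs \<Longrightarrow> (y, x) \<in> arcs_of xs"
  using sym_arcs_of by (rule symD)

lemma card_arcs_of: "card (arcs_of xs) \<le> 2 * length xs"
proof -
  have "card (arcs_of xs) \<le> card (set (zip xs (tl xs))) + card (set (zip (tl xs) xs))"
    unfolding arcs_of_def by (rule card_Un_le)
  then show ?thesis
    using card_length[of "zip xs (tl xs)"] card_length[of "zip (tl xs) xs"] by simp
qed

text \<open>Without repetitions the last vertex has only one neighbour along the list, the vertex
  before it. Apart from this one, every arc of the graph at the end of a path leads off the
  path.\<close>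

lemma arc_from_last:
  assumes "distinct w" "(last w, z) \<in> arcs_of w"
  shows "w = butlast (butlast w) @ [z, last w]"
proof -
  have "w \<noteq> []" using assms by auto
  then obtain w0 y where w: "w = w0 @ [y]" by (metis append_butlast_last_id)
  with assms have "w0 \<noteq> []" by auto
  then obtain w1 x where w0: "w0 = w1 @ [x]" by (metis append_butlast_last_id)
  have "(y, z) \<notin> arcs_of w0" using assms w arcs_of_in_set[of y z w0] by auto
  then have "z = x" using assms w w0 arcs_of_snoc[OF \<open>w0 \<noteq> []\<close>, of y] by auto
  then show ?thesis by (simp add: w w0 butlast_append)
qed

lemma arcs_of_prefix: "prefix xs ys \<Longrightarrow> arcs_of xs \<subseteq> arcs_of ys"
  by (cases "xs = []"; elim prefixE, rename_tac zs, case_tac "zs = []") (auto simp: arcs_of_append)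

lemma paths_0: "paths E u 0 = {[u]}"
  by (auto simp: paths_def length_Suc_conv)

lemma paths_ne: "w \<in> paths E u k \<Longrightarrow> w \<noteq> []"
  by (auto simp: paths_def)

lemma paths_prefix:
  assumes "w \<in> paths E u k" "prefix p w" "p \<noteq> []"
  shows "p \<in> paths E u (length p - 1)" "length p - 1 \<le> k"
proof -
  obtain zs where w: "w = p @ zs" using assms by (auto elim: prefixE)
  show "p \<in> paths E u (length p - 1)"
    using assms arcs_of_prefix[OF assms(2)] by (auto simp: paths_def w)
  show "length p - 1 \<le> k" using assms by (auto simp: paths_def w)
qed

lemma snoc_in_paths:
  assumes "sym E"
  shows "w @ [z] \<in> paths E u (Suc k) \<longleftrightarrow> w \<in> paths E u k \<and> z \<notin> set w \<and> (last w, z) \<in> E"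
proof -
  have "(z, x) \<in> E \<longleftrightarrow> (x, z) \<in> E" for x using assms by (auto dest: symD)
  then show ?thesis
    by (cases "w = []") (auto simp: paths_def arcs_of_snoc)
qed

lemma paths_Suc_cases:
  assumes "w \<in> paths E u (Suc k)" "sym E"
  obtains w' z where "w = w' @ [z]" "w' \<in> paths E u k" "z \<notin> set w'" "(last w', z) \<in> E"
proof -
  have "w = butlast w @ [last w]" using paths_ne[OF assms(1)] by simp
  then show ?thesis using assms snoc_in_paths that by metis
qed

lemma paths_set:
  assumes "w \<in> paths E u k" "E \<subseteq> V \<times> V" "u \<in> V"
  shows "set w \<subseteq> V"
proof -
  have "arcs_of w \<subseteq> E \<Longrightarrow> w \<noteq> [] \<Longrightarrow> hd w \<in> V \<Longrightarrow> set w \<subseteq> V"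
  proof (induction w)
    case (Cons x w)
    then show ?case using assms(2) by (cases w) auto
  qed simp
  moreover have "arcs_of w \<subseteq> E" "w \<noteq> []" "hd w \<in> V" using assms by (auto simp: paths_def)
  ultimately show ?thesis by blast
qed

section \<open>Numbers of paths in a regular graph\<close>

text \<open>Candidates for \<open>paths\<close> that do not mention the graph:
  \<open>closing_arc_count\<close> needs one finite set of structures that serves all graphs at
  once.\<close>

definition vlists :: "nat \<Rightarrow> nat \<Rightarrow> nat \<Rightarrow> nat list set" where
  "vlists n u k = {xs. set xs \<subseteq> {..<n} \<and> length xs = Suc k \<and> hd xs = u \<and> distinct xs}"

lemma finite_vlists [simp]: "finite (vlists n u k)"
proof -
  have "vlists n u k \<subseteq> {xs. set xs \<subseteq> {..<n} \<and> length xs = Suc k}" by (auto simp: vlists_def)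
  then show ?thesis by (rule finite_subset) (simp add: finite_lists_length_eq)
qed

lemma paths_vlists:
  assumes "E \<in> reg_rels n d" "u < n"
  shows "w \<in> paths E u k \<longleftrightarrow> w \<in> vlists n u k \<and> arcs_of w \<subseteq> E"
  using paths_set[of w E u k "{..<n}"] assms
  by (auto simp: paths_def vlists_def reg_rels_def)

lemma finite_paths: "E \<in> reg_rels n d \<Longrightarrow> u < n \<Longrightarrow> finite (paths E u k)"
  by (rule finite_subset[of _ "vlists n u k"]) (auto simp: paths_vlists)

lemma reg_rels_sym_rel: "E \<in> reg_rels n d \<Longrightarrow> sym E"
  by (auto simp: reg_rels_def)

lemma card_paths_Suc:
  assumes E: "E \<in> reg_rels n d" and u: "u < n"
  shows "card (paths E u (Suc (Suc k))) \<le> card (paths E u (Suc k)) * (d - 1)"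
proof -
  let ?Q = "\<lambda>w. E `` {last w} - {last (butlast w)}"
  have "(butlast w, last w) \<in> Sigma (paths E u (Suc k)) ?Q" if w: "w \<in> paths E u (Suc (Suc k))" for w
  proof -
    obtain w' z where 1: "w = w' @ [z]" "w' \<in> paths E u (Suc k)" "z \<notin> set w'" "(last w', z) \<in> E"
      using paths_Suc_cases[OF w reg_rels_sym_rel[OF E]] .
    moreover obtain w'' y where "w' = w'' @ [y]" "w'' \<in> paths E u k"
      using paths_Suc_cases[OF 1(2) reg_rels_sym_rel[OF E]] .
    moreover from this have "last w'' \<in> set w''" using paths_ne by (metis last_in_set)
    ultimately have "w = (w'' @ [y]) @ [z]" "w'' @ [y] \<in> paths E u (Suc k)" "z \<noteq> last w''"
      "(y, z) \<in> E" by auto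
    then show ?thesis by (simp add: butlast_append)
  qed
  moreover have "inj_on (\<lambda>w. (butlast w, last w)) (paths E u (Suc (Suc k)))"
    by (rule inj_onI) (metis Pair_inject append_butlast_last_id paths_ne)
  ultimately have "card (paths E u (Suc (Suc k))) \<le> card (Sigma (paths E u (Suc k)) ?Q)"
    by (intro card_inj_on_le) (auto intro!: finite_SigmaI simp: finite_paths[OF E u] finite_nbrs[OF E])
  also have "\<dots> = (\<Sum>w\<in>paths E u (Suc k). card (?Q w))"
    by (subst card_SigmaI) (auto simp: finite_paths[OF E u] finite_nbrs[OF E])
  also have "\<dots> \<le> (\<Sum>w\<in>paths E u (Suc k). d - 1)"
  proof (rule sum_mono)
    fix w assume "w \<in> paths E u (Suc k)"
    then obtain w' z where "w = w' @ [z]" "w' \<in> paths E u k" "(last w', z) \<in> E"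
      using paths_Suc_cases reg_rels_sym_rel[OF E] by metis
    then have "last (butlast w) \<in> E `` {last w}"
      using reg_rels_sym[OF E] by simp
    then show "card (?Q w) \<le> d - 1"
      using card_nbrs_le[OF E, of "last w"] finite_nbrs[OF E] by (simp add: card_Diff_singleton)
  qed
  finally show ?thesis by simp
qed

text \<open>The factor 2 absorbs the first step, which has \<open>d\<close> choices, at most
  \<open>2 * (d - 1)\<close>. Every later step must avoid the preceding vertex and has at most
  \<open>d - 1\<close>.\<close>

lemma card_paths:
  assumes E: "E \<in> reg_rels n d" and u: "u < n" and d: "2 \<le> d"
  shows "card (paths E u k) \<le> 2 * (d - 1) ^ k"
proof (induction k)
  case (Suc k)
  show ?case
  proof (cases k)
    case 0
    have "paths E u (Suc 0) \<subseteq> (\<lambda>z. [u, z]) ` (E `` {u})"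
    proof
      fix w assume "w \<in> paths E u (Suc 0)"
      then obtain w' z where "w = w' @ [z]" "w' \<in> paths E u 0" "(last w', z) \<in> E"
        using paths_Suc_cases reg_rels_sym_rel[OF E] by metis
      then show "w \<in> (\<lambda>z. [u, z]) ` (E `` {u})" by (simp add: paths_0)
    qed
    then have "card (paths E u (Suc 0)) \<le> card (E `` {u})"
      using finite_nbrs[OF E] by (meson surj_card_le)
    then show ?thesis using card_nbrs_le[OF E, of u] d 0 by simp
  next
    case (Suc k')
    then show ?thesis using card_paths_Suc[OF E u, of k'] Suc.IH
      by (smt (verit) mult.assoc mult.commute mult_le_mono1 order_trans power_Suc)
  qed
qed (simp add: paths_0)

lemma geometric_le: "2 \<le> b \<Longrightarrow> (\<Sum>l<r. b ^ l) \<le> (b :: nat) ^ r"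
proof (induction r)
  case (Suc r)
  have "2 * b ^ r \<le> b * b ^ r" using Suc.prems by (rule mult_le_mono1)
  moreover have "(\<Sum>l<r. b ^ l) \<le> b ^ r" using Suc by simp
  ultimately show ?case unfolding sum.lessThan_Suc power_Suc by linarith
qed simp

lemma card_short_paths:
  assumes "E \<in> reg_rels n d" "u < n" "3 \<le> d"
  shows "card (\<Union>l<r. paths E u l) \<le> 2 * (d - 1) ^ r"
proof -
  have "card (\<Union>l<r. paths E u l) \<le> (\<Sum>l<r. card (paths E u l))"
    by (rule card_UN_le) simp
  also have "\<dots> \<le> (\<Sum>l<r. 2 * (d - 1) ^ l)"
    using assms by (intro sum_mono card_paths) auto
  also have "\<dots> \<le> 2 * (d - 1) ^ r"
    using geometric_le[of "d - 1" r] assms by (simp flip: sum_distrib_left)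
  finally show ?thesis .
qed

section \<open>Growth of the search trees\<close>

definition short_paths :: "('a \<times> 'a) set \<Rightarrow> 'a \<Rightarrow> 'a \<Rightarrow> nat \<Rightarrow> 'a list set" where
  "short_paths E u v r = (\<Union>k\<le>r. paths E u k \<union> paths E v k)"

text \<open>No vertex of a good path is reached by a second path of length at most \<open>r\<close> from \<open>u\<close> or \<open>v\<close>:
  along good paths the two search trees are undisturbed by cycles and by each other.\<close>

definition good_path :: "('a \<times> 'a) set \<Rightarrow> 'a \<Rightarrow> 'a \<Rightarrow> nat \<Rightarrow> 'a list \<Rightarrow> bool" where
  "good_path E u v r w \<longleftrightarrow> w \<in> short_paths E u v r \<and>
     (\<forall>p\<in>short_paths E u v r. last p \<in> set w \<longrightarrow> prefix p w)"

text \<open>One of the two ways in which extending a path can fail: the new arc returns to the path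
  or runs into \<open>v\<close>. The vertex \<open>v\<close> is listed here because it is reached by
  a trivial path, which has no last arc that \<open>cross_hits\<close> could see.\<close>

definition self_hits :: "('a \<times> 'a) set \<Rightarrow> 'a \<Rightarrow> 'a \<Rightarrow> nat \<Rightarrow> ('a list \<times> 'a) set" where
  "self_hits E u v k =
     {(w, z). w \<in> paths E u k \<and> z \<in> insert v (set w) \<and> (last w, z) \<in> E - arcs_of w}"

text \<open>The other way to fail: a second path, \<open>p\<close> with one more arc, arrives at the
  end of \<open>w\<close>. The joining arc is kept off both paths so that it can be the closing arc
  in \<open>closing_arc_count\<close>.\<close>

definition cross_hits ::
    "('a \<times> 'a) set \<Rightarrow> 'a \<Rightarrow> 'a \<Rightarrow> nat \<Rightarrow> nat \<Rightarrow> ('a list \<times> 'a list) set" where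
  "cross_hits E u v r k =
     {(w, p). w \<in> paths E u k \<and> p \<in> (\<Union>l<r. paths E u l \<union> paths E v l) \<and>
        (last p, last w) \<in> E - (arcs_of w \<union> arcs_of p)}"

lemma short_paths_commute: "short_paths E u v r = short_paths E v u r"
  by (auto simp: short_paths_def)

lemma good_path_commute: "good_path E u v r = good_path E v u r"
  by (simp add: good_path_def fun_eq_iff short_paths_commute)

lemma good_path_last_unique:
  assumes "good_path E u v r w" "p \<in> short_paths E u v r" "last p = last w"
  shows "p = w"
proof -
  have "w \<noteq> []" "distinct w" "p \<noteq> []"
    using assms by (auto simp: good_path_def short_paths_def paths_def)
  then have "prefix p w" using assms by (auto simp: good_path_def)
  then obtain zs where w: "w = p @ zs" by (auto elim: prefixE)
  have "zs = []"
  proof (rule ccontr)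
    assume "zs \<noteq> []"
    then have "last w \<in> set zs" "last p \<in> set p" using w \<open>p \<noteq> []\<close> by auto
    then show False using w \<open>distinct w\<close> assms(3) by auto
  qed
  then show ?thesis using w by simp
qed

lemma short_pathsE:
  assumes "p \<in> short_paths E u v r"
  obtains x k where "x \<in> {u, v}" "k \<le> r" "p \<in> paths E x k"
  using assms by (auto simp: short_paths_def)

lemma short_pathsI: "p \<in> paths E x k \<Longrightarrow> x \<in> {u, v} \<Longrightarrow> k \<le> r \<Longrightarrow> p \<in> short_paths E u v r"
  by (auto simp: short_paths_def)

text \<open>If the extension is bad, some short path \<open>p\<close> ends on it without being a
  prefix. As \<open>w\<close> is good, \<open>p\<close> must end in the new vertex \<open>z\<close>;
  without its last vertex it is a path \<open>p'\<close> followed by an arc into \<open>z\<close>.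
  That arc is not on the extension: otherwise \<open>p'\<close> would end where \<open>w\<close>
  does, and uniqueness for good paths would give \<open>p' = w\<close>.\<close>

lemma good_path_extension:
  assumes E: "sym E" and uv: "u \<noteq> v"
    and w: "good_path E u v r w" "w \<in> paths E u k" "k < r"
    and z: "(last w, z) \<in> E - arcs_of w"
  shows "good_path E u v r (w @ [z]) \<or> (w, z) \<in> self_hits E u v k
    \<or> (\<exists>p. (w @ [z], p) \<in> cross_hits E u v r (Suc k))"
proof (rule ccontr)
  assume neg: "\<not> ?thesis"
  then have zw: "z \<notin> set w" "z \<noteq> v" using w z by (auto simp: self_hits_def)
  then have wz: "w @ [z] \<in> paths E u (Suc k)" using w z by (simp add: snoc_in_paths[OF E])
  then have "w @ [z] \<in> short_paths E u v r" using w by (intro short_pathsI[where k = "Suc k"]) auto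
  with neg obtain p where p: "p \<in> short_paths E u v r" "last p \<in> set (w @ [z])" "\<not> prefix p (w @ [z])"
    by (auto simp: good_path_def)
  have "last p \<notin> set w" using w p by (auto simp: good_path_def)
  then have lp: "last p = z" using p by auto
  obtain x l where x: "x \<in> {u, v}" "l \<le> r" "p \<in> paths E x l" using p(1) by (rule short_pathsE)
  have "l \<noteq> 0"
  proof
    assume "l = 0"
    then have "p = [x]" using x by (simp add: paths_0)
    then have "x = z" using lp by simp
    moreover have "u \<in> set w" using w(2) paths_ne[OF w(2)] by (auto simp: paths_def)
    ultimately show False using x zw by auto
  qed
  then obtain l' where l': "l = Suc l'" by (metis not0_implies_Suc)
  then obtain p' where p': "p = p' @ [z]" "p' \<in> paths E x l'" "z \<notin> set p'" "(last p', z) \<in> E"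
    using paths_Suc_cases[OF _ E] x lp by (metis last_snoc)
  have "(last p', z) \<notin> arcs_of p'" using p' arcs_of_in_set by metis
  moreover have "(last p', z) \<notin> arcs_of (w @ [z])"
  proof
    assume "(last p', z) \<in> arcs_of (w @ [z])"
    moreover have "(last p', z) \<notin> arcs_of w" using zw arcs_of_in_set by metis
    moreover have "last w \<noteq> z" using zw paths_ne[OF w(2)] by auto
    ultimately have "last p' = last w" using paths_ne[OF w(2)] by (auto simp: arcs_of_snoc)
    moreover have "p' \<in> short_paths E u v r" using p' x l' by (intro short_pathsI[where k = l']) auto
    ultimately have "p' = w" using good_path_last_unique w by metis
    then show False using p p' by simp
  qed
  moreover have "p' \<in> (\<Union>l<r. paths E u l \<union> paths E v l)" using p' x l' by auto
  ultimately have "(w @ [z], p') \<in> cross_hits E u v r (Suc k)"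
    using wz p' by (simp add: cross_hits_def)
  then show False using neg by blast
qed

lemma trivial_path_good:
  assumes E: "sym E" and uv: "u \<noteq> v" and "\<not> good_path E u v r [u]"
  shows "\<exists>p. ([u], p) \<in> cross_hits E u v r 0"
proof -
  have "[u] \<in> short_paths E u v r" by (rule short_pathsI[of _ _ u 0]) (auto simp: paths_0)
  then obtain p where p: "p \<in> short_paths E u v r" "last p = u" "p \<noteq> [u]"
    using assms by (auto simp: good_path_def)
  obtain x l where x: "x \<in> {u, v}" "l \<le> r" "p \<in> paths E x l" using p(1) by (rule short_pathsE)
  have "l \<noteq> 0"
  proof
    assume "l = 0"
    then have "p = [x]" using x by (simp add: paths_0)
    then show False using p by simp
  qed
  then obtain l' where l': "l = Suc l'" by (metis not0_implies_Suc)
  then obtain p' where p': "p = p' @ [u]" "p' \<in> paths E x l'" "u \<notin> set p'" "(last p', u) \<in> E"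
    using paths_Suc_cases[OF _ E] x p by (metis last_snoc)
  have "(last p', u) \<notin> arcs_of p'" using p' arcs_of_in_set by metis
  then have "([u], p') \<in> cross_hits E u v r 0"
    using p' x l' by (auto simp: cross_hits_def paths_0)
  then show ?thesis by blast
qed

section \<open>Expected numbers of hits\<close>

context
  fixes n d u v r :: nat
  assumes d: "3 \<le> d" and uv: "u < n" "v < n"
begin

context
  fixes E assumes E: "E \<in> reg_rels n d"
begin

lemma finite_self_hits: "finite (self_hits E u v k)"
  by (rule finite_subset[of _ "Sigma (paths E u k) (\<lambda>w. insert v (set w))"])
    (auto simp: self_hits_def finite_paths[OF E] uv)

lemma finite_cross_hits: "finite (cross_hits E u v r k)"
  by (rule finite_subset[of _ "paths E u k \<times> (\<Union>l<r. paths E u l \<union> paths E v l)"])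
    (auto simp: cross_hits_def finite_paths[OF E] uv)

end

lemma sum_card_self_hits:
  assumes n: "2 * (2 * Suc k + 2 * ((d + 1) * d)) \<le> n * d"
  shows "n * (\<Sum>E\<in>reg_rels n d. card (self_hits E u v k))
    \<le> 4 * d * ((k + 2) * (d - 1) ^ k) * card (reg_rels n d)"
proof -
  define T where "T = {(w, z). w \<in> vlists n u k \<and> z \<in> insert v (set w) \<and> (last w, z) \<notin> arcs_of w}"
  have T: "finite T"
    by (rule finite_subset[of _ "Sigma (vlists n u k) (\<lambda>w. insert v (set w))"]) (auto simp: T_def)
  have "self_hits E u v k = {t \<in> T. arcs_of (fst t) \<subseteq> E \<and> (last (fst t), snd t) \<in> E}"
    if "E \<in> reg_rels n d" for E
    using uv by (auto simp: T_def self_hits_def paths_vlists[OF that])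
  then have "n * (\<Sum>E\<in>reg_rels n d. card (self_hits E u v k))
    = n * (\<Sum>E\<in>reg_rels n d. card {t \<in> T. arcs_of (fst t) \<subseteq> E \<and> (last (fst t), snd t) \<in> E})"
    by simp
  also have "\<dots> \<le> 2 * d * (\<Sum>E\<in>reg_rels n d. card {t \<in> T. arcs_of (fst t) \<subseteq> E})"
  proof (rule closing_arc_count[OF T _ n])
    fix t assume "t \<in> T"
    then show "sym (arcs_of (fst t)) \<and> finite (arcs_of (fst t)) \<and> card (arcs_of (fst t)) \<le> 2 * Suc k
      \<and> (last (fst t), snd t) \<notin> arcs_of (fst t)"
      using card_arcs_of[of "fst t"] by (auto simp: T_def vlists_def sym_arcs_of)
  qed
  \<comment> \<open>A path with \<open>k + 1\<close> vertices offers at most \<open>k + 2\<close>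
    targets, its own vertices and \<open>v\<close>.\<close>
  also have "\<dots> \<le> 2 * d * (\<Sum>E\<in>reg_rels n d. 2 * (d - 1) ^ k * (k + 2))"
  proof (intro mult_le_mono2 sum_mono)
    fix E assume E: "E \<in> reg_rels n d"
    have "card {t \<in> T. arcs_of (fst t) \<subseteq> E} \<le> card (Sigma (paths E u k) (\<lambda>w. insert v (set w)))"
      using uv by (intro card_mono) (auto simp: T_def paths_vlists[OF E] finite_paths[OF E])
    also have "\<dots> = (\<Sum>w\<in>paths E u k. card (insert v (set w)))"
      using uv by (subst card_SigmaI) (auto simp: finite_paths[OF E])
    also have "\<dots> \<le> (\<Sum>w\<in>paths E u k. k + 2)"
    proof (rule sum_mono)
      fix w assume "w \<in> paths E u k"
      then show "card (insert v (set w)) \<le> k + 2"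
        using card_length[of w] by (auto simp: paths_def card_insert_if)
    qed
    also have "\<dots> = card (paths E u k) * (k + 2)" by simp
    also have "\<dots> \<le> 2 * (d - 1) ^ k * (k + 2)"
      using d by (intro mult_le_mono1 card_paths[OF E uv(1)]) simp
    finally show "card {t \<in> T. arcs_of (fst t) \<subseteq> E} \<le> 2 * (d - 1) ^ k * (k + 2)" .
  qed
  finally show ?thesis by (simp add: mult_ac)
qed

text \<open>The open structures are pairs of paths: at most \<open>2 * (d - 1) ^ k\<close> choices
  for \<open>w\<close> and, by a geometric sum for each of the two roots,
  \<open>4 * (d - 1) ^ r\<close> for \<open>p\<close>.\<close>

lemma sum_card_cross_hits:
  assumes n: "2 * (2 * (Suc k + r) + 2 * ((d + 1) * d)) \<le> n * d"
  shows "n * (\<Sum>E\<in>reg_rels n d. card (cross_hits E u v r k))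
    \<le> 16 * d * (d - 1) ^ (k + r) * card (reg_rels n d)"
proof -
  define T where "T = {(w, p). w \<in> vlists n u k \<and> p \<in> (\<Union>l<r. vlists n u l \<union> vlists n v l)
    \<and> (last p, last w) \<notin> arcs_of w \<union> arcs_of p}"
  let ?F = "\<lambda>t. arcs_of (fst t) \<union> arcs_of (snd t)"
  have T: "finite T"
    by (rule finite_subset[of _ "vlists n u k \<times> (\<Union>l<r. vlists n u l \<union> vlists n v l)"])
      (auto simp: T_def)
  have "cross_hits E u v r k = {t \<in> T. ?F t \<subseteq> E \<and> (last (snd t), last (fst t)) \<in> E}"
    if "E \<in> reg_rels n d" for E
    using uv by (auto simp: T_def cross_hits_def paths_vlists[OF that])
  then have "n * (\<Sum>E\<in>reg_rels n d. card (cross_hits E u v r k))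
    = n * (\<Sum>E\<in>reg_rels n d. card {t \<in> T. ?F t \<subseteq> E \<and> (last (snd t), last (fst t)) \<in> E})"
    by simp
  also have "\<dots> \<le> 2 * d * (\<Sum>E\<in>reg_rels n d. card {t \<in> T. ?F t \<subseteq> E})"
  proof (rule closing_arc_count[OF T _ n])
    fix t assume t: "t \<in> T"
    have "card (?F t) \<le> card (arcs_of (fst t)) + card (arcs_of (snd t))" by (rule card_Un_le)
    also have "\<dots> \<le> 2 * length (fst t) + 2 * length (snd t)" by (intro add_mono card_arcs_of)
    also have "\<dots> \<le> 2 * (Suc k + r)" using t by (auto simp: T_def vlists_def)
    finally have "card (?F t) \<le> 2 * (Suc k + r)" .
    with t show "sym (?F t) \<and> finite (?F t) \<and> card (?F t) \<le> 2 * (Suc k + r)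
      \<and> (last (snd t), last (fst t)) \<notin> ?F t"
      by (auto simp: T_def sym_arcs_of intro: sym_Un)
  qed
  also have "\<dots> \<le> 2 * d * (\<Sum>E\<in>reg_rels n d. 2 * (d - 1) ^ k * (4 * (d - 1) ^ r))"
  proof (intro mult_le_mono2 sum_mono)
    fix E assume E: "E \<in> reg_rels n d"
    have "card {t \<in> T. ?F t \<subseteq> E} \<le> card (paths E u k \<times> ((\<Union>l<r. paths E u l) \<union> (\<Union>l<r. paths E v l)))"
      using uv by (intro card_mono) (auto simp: T_def paths_vlists[OF E] finite_paths[OF E])
    also have "\<dots> = card (paths E u k) * card ((\<Union>l<r. paths E u l) \<union> (\<Union>l<r. paths E v l))"
      by (simp add: card_cartesian_product)
    also have "\<dots> \<le> 2 * (d - 1) ^ k * (2 * (d - 1) ^ r + 2 * (d - 1) ^ r)"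
      using d uv by (intro mult_le_mono card_paths[OF E] order_trans[OF card_Un_le] add_mono
          card_short_paths[OF E]) auto
    finally show "card {t \<in> T. ?F t \<subseteq> E} \<le> 2 * (d - 1) ^ k * (4 * (d - 1) ^ r)" by simp
  qed
  finally show ?thesis by (simp add: mult_ac power_add)
qed

end

text \<open>Bounds the number of branches of length \<open>k\<close> that a non-backtracking extension has lost by being
  bad, each bad path of length \<open>j\<close> being charged with its \<open>(d - 1) ^ (k - j)\<close> descendants.\<close>

primrec tree_loss :: "nat \<Rightarrow> ('a \<times> 'a) set \<Rightarrow> 'a \<Rightarrow> 'a \<Rightarrow> nat \<Rightarrow> nat \<Rightarrow> nat" where
  "tree_loss d E u v r 0 = card (cross_hits E u v r 0)"
| "tree_loss d E u v r (Suc k) = (d - 1) * tree_loss d E u v r k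
     + card (self_hits E u v k) + card (cross_hits E u v r (Suc k))"

lemma less_power2: "k < (d - 1) ^ k" if "3 \<le> d" for d k :: nat
proof -
  have "k < 2 ^ k" by (rule less_exp)
  also have "\<dots> \<le> (d - 1) ^ k" using that by (intro power_mono) auto
  finally show ?thesis .
qed

text \<open>Weighted with the number of its descendants, each level contributes at most the same
  amount, where 20 = 4 + 16 collects self hits and cross hits. Adding the levels gives the factor
  \<open>k + 1\<close>.\<close>

lemma sum_tree_loss:
  assumes d: "3 \<le> d" and uv: "u < n" "v < n" and "k \<le> r"
    and n: "2 * (4 * Suc r + 2 * ((d + 1) * d)) \<le> n * d"
  shows "n * (\<Sum>E\<in>reg_rels n d. tree_loss d E u v r k)
    \<le> 20 * d * (k + 1) * (d - 1) ^ (k + r) * card (reg_rels n d)"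
  using \<open>k \<le> r\<close>
proof (induction k)
  case 0
  have "n * (\<Sum>E\<in>reg_rels n d. tree_loss d E u v r 0) \<le> 16 * d * (d - 1) ^ (0 + r) * card (reg_rels n d)"
    using sum_card_cross_hits[OF d uv, of 0 r] n by simp
  also have "\<dots> \<le> 20 * d * (0 + 1) * (d - 1) ^ (0 + r) * card (reg_rels n d)"
    by (intro mult_le_mono1) simp
  finally show ?case .
next
  case (Suc k)
  let ?S = "\<lambda>f. n * (\<Sum>E\<in>reg_rels n d. f E)" and ?R = "card (reg_rels n d)"
  have "?S (\<lambda>E. tree_loss d E u v r (Suc k)) = (d - 1) * ?S (\<lambda>E. tree_loss d E u v r k)
     + ?S (\<lambda>E. card (self_hits E u v k)) + ?S (\<lambda>E. card (cross_hits E u v r (Suc k)))"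
    by (simp add: sum.distrib sum_distrib_left algebra_simps)
  also have "\<dots> \<le> (d - 1) * (20 * d * (k + 1) * (d - 1) ^ (k + r) * ?R)
     + 4 * d * (d - 1) ^ (Suc k + r) * ?R + 16 * d * (d - 1) ^ (Suc k + r) * ?R"
  proof (intro add_mono mult_le_mono2)
    show "n * (\<Sum>E\<in>reg_rels n d. tree_loss d E u v r k) \<le> 20 * d * (k + 1) * (d - 1) ^ (k + r) * ?R"
      using Suc by simp
    \<comment> \<open>Self hits are much rarer than cross hits. They are brought to the same form by
      the crude bounds \<open>k + 2 \<le> r + 1\<close> and
      \<open>r + 1 \<le> (d - 1) ^ r\<close>.\<close>
    have "(k + 2) * (d - 1) ^ k \<le> (d - 1) ^ r * (d - 1) ^ Suc k"
      using less_power2[OF d, of r] Suc.prems d by (intro mult_le_mono power_increasing) auto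
    then have "4 * d * ((k + 2) * (d - 1) ^ k) * ?R \<le> 4 * d * ((d - 1) ^ r * (d - 1) ^ Suc k) * ?R"
      by (intro mult_le_mono1 mult_le_mono2)
    also have "\<dots> = 4 * d * (d - 1) ^ (Suc k + r) * ?R" by (simp add: power_add mult_ac)
    finally have *: "4 * d * ((k + 2) * (d - 1) ^ k) * ?R \<le> 4 * d * (d - 1) ^ (Suc k + r) * ?R" .
    have "2 * (2 * Suc k + 2 * ((d + 1) * d)) \<le> n * d" using n Suc.prems by simp
    from order_trans[OF sum_card_self_hits[OF d uv this] *]
    show "?S (\<lambda>E. card (self_hits E u v k)) \<le> 4 * d * (d - 1) ^ (Suc k + r) * ?R" .
    show "?S (\<lambda>E. card (cross_hits E u v r (Suc k))) \<le> 16 * d * (d - 1) ^ (Suc k + r) * ?R"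
      using sum_card_cross_hits[OF d uv, of "Suc k" r] n Suc.prems by simp
  qed
  also have "\<dots> = 20 * d * (Suc k + 1) * (d - 1) ^ (Suc k + r) * ?R"
  proof -
    have "b * (20 * d * (k + 1) * X * ?R) + 4 * d * (b * X) * ?R + 16 * d * (b * X) * ?R
      = 20 * d * (Suc k + 1) * (b * X) * ?R" for b X :: nat
      by (simp add: algebra_simps)
    then show ?thesis unfolding add_Suc[of k r] power_Suc .
  qed
  finally show ?case .
qed

section \<open>Survival of the branches\<close>

definition branch :: "('a \<times> 'a) set \<Rightarrow> 'a \<Rightarrow> 'a \<Rightarrow> nat \<Rightarrow> 'a \<Rightarrow> nat \<Rightarrow> 'a list set" where
  "branch E u v r x k = {w \<in> paths E u k. good_path E u v r w \<and> w ! 1 = x}"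

lemma card_nonbacktracking:
  assumes E: "E \<in> reg_rels n d" and w: "w \<in> paths E u k" "last w < n"
  shows "d - 1 \<le> card {z. (last w, z) \<in> E - arcs_of w}" "finite {z. (last w, z) \<in> E - arcs_of w}"
proof -
  let ?S = "{z. (last w, z) \<in> E - arcs_of w}"
  have "distinct w" using w by (simp add: paths_def)
  have "z = last (butlast w)" if z: "(last w, z) \<in> arcs_of w" for z
  proof -
    have "butlast w = butlast (butlast w) @ [z]"
      using arg_cong[OF arc_from_last[OF \<open>distinct w\<close> z], of butlast] by (simp add: butlast_append)
    then show ?thesis by (metis last_snoc)
  qed
  then have "E `` {last w} \<subseteq> insert (last (butlast w)) ?S" by auto
  moreover show fin: "finite ?S" by (rule finite_subset[of _ "E `` {last w}"]) (auto simp: finite_nbrs[OF E])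
  ultimately have "card (E `` {last w}) \<le> card (insert (last (butlast w)) ?S)"
    by (intro card_mono) auto
  also have "\<dots> \<le> Suc (card ?S)" using fin by (simp add: card_insert_if)
  finally show "d - 1 \<le> card ?S" using card_nbrs[OF E w(2)] by simp
qed

text \<open>The induction mirrors the recursion of \<open>tree_loss\<close>: at least
  \<open>d - 1\<close> arcs lead off a good path at its end, and by
  \<open>good_path_extension\<close> each of them yields a good path, a self hit or a cross hit. The
  exponent is one less than the depth because the branch prescribes the first step.\<close>

lemma branch_size:
  assumes d: "3 \<le> d" and uv: "u < n" "v < n" "u \<noteq> v" and E: "E \<in> reg_rels n d" and x: "(u, x) \<in> E"
  shows "Suc k \<le> r \<Longrightarrow> (d - 1) ^ k \<le> card (branch E u v r x (Suc k)) + tree_loss d E u v r (Suc k)"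
proof (induction k)
  case 0
  note E' = reg_rels_sym_rel[OF E]
  have fin: "finite (branch E u v r x (Suc 0))"
    by (simp add: branch_def finite_paths[OF E uv(1)])
  have "good_path E u v r [u] \<Longrightarrow> good_path E u v r [u, x] \<or> ([u], x) \<in> self_hits E u v 0
    \<or> (\<exists>p. ([u, x], p) \<in> cross_hits E u v r (Suc 0))"
    using good_path_extension[OF E' uv(3), of r "[u]" 0 x] x 0 by (simp add: paths_0)
  then consider "good_path E u v r [u, x]" | "([u], x) \<in> self_hits E u v 0"
    | p where "([u, x], p) \<in> cross_hits E u v r (Suc 0)" | p where "([u], p) \<in> cross_hits E u v r 0"
    using trivial_path_good[OF E' uv(3)] by blast
  then have "1 \<le> card (branch E u v r x (Suc 0)) \<or> 1 \<le> card (self_hits E u v 0)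
    \<or> 1 \<le> card (cross_hits E u v r (Suc 0)) \<or> 1 \<le> card (cross_hits E u v r 0)"
  proof cases
    case 1
    have "[u, x] = [u] @ [x]" by simp
    also have "\<dots> \<in> paths E u (Suc 0)"
      using x reg_rels_irrefl[OF E x] by (subst snoc_in_paths[OF E']) (auto simp: paths_0)
    finally have "[u, x] \<in> branch E u v r x (Suc 0)" using 1 by (simp add: branch_def)
    then have "0 < card (branch E u v r x (Suc 0))" using fin by (auto simp: card_gt_0_iff)
    then show ?thesis by simp
  next
    case 2
    then have "0 < card (self_hits E u v 0)"
      using finite_self_hits[OF d uv(1,2) E] by (auto simp: card_gt_0_iff)
    then show ?thesis by simp
  next
    case 3
    then have "0 < card (cross_hits E u v r (Suc 0))"
      using finite_cross_hits[OF d uv(1,2) E] by (auto simp: card_gt_0_iff)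
    then show ?thesis by simp
  next
    case 4
    then have "0 < card (cross_hits E u v r 0)"
      using finite_cross_hits[OF d uv(1,2) E] by (auto simp: card_gt_0_iff)
    then show ?thesis by simp
  qed
  \<comment> \<open>\<open>tree_loss\<close> charges a hit at the root with \<open>d - 1\<close>
    descendants, while a single branch has only one of them to lose.\<close>
  moreover have "1 * card (cross_hits E u v r 0) \<le> (d - 1) * card (cross_hits E u v r 0)"
    using d by (intro mult_le_mono1) auto
  ultimately show ?case unfolding tree_loss.simps power_0 by linarith
next
  case (Suc k)
  note E' = reg_rels_sym_rel[OF E]
  let ?B = "branch E u v r x" and ?N = "\<lambda>w. {z. (last w, z) \<in> E - arcs_of w}"
  have finB: "finite (?B j)" for j by (simp add: branch_def finite_paths[OF E uv(1)])
  have lw: "last w < n" if "w \<in> ?B j" for w j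
    using that paths_vlists[OF E uv(1)] last_in_set[OF paths_ne, of w E u j]
    by (auto simp: branch_def vlists_def)
  have N: "d - 1 \<le> card (?N w)" "finite (?N w)" if "w \<in> ?B j" for w j
    using card_nonbacktracking[OF E] that lw[OF that] by (auto simp: branch_def)
  have "(d - 1) * card (?B (Suc k)) \<le> (\<Sum>w\<in>?B (Suc k). card (?N w))"
    using sum_bounded_below[of "?B (Suc k)" "d - 1" "\<lambda>w. card (?N w)"] N by (auto simp: mult.commute)
  also have "\<dots> = card (Sigma (?B (Suc k)) ?N)"
    using finB N by (subst card_SigmaI) auto
  also have "\<dots> = card ((\<lambda>(w, z). w @ [z]) ` Sigma (?B (Suc k)) ?N)"
    by (subst card_image) (auto simp: inj_on_def)
  also have "\<dots> \<le> card (?B (Suc (Suc k)) \<union> (\<lambda>(w, z). w @ [z]) ` self_hits E u v (Suc k)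
      \<union> fst ` cross_hits E u v r (Suc (Suc k)))"
  proof (rule card_mono)
    show "(\<lambda>(w, z). w @ [z]) ` Sigma (?B (Suc k)) ?N \<subseteq> ?B (Suc (Suc k)) \<union>
        (\<lambda>(w, z). w @ [z]) ` self_hits E u v (Suc k) \<union> fst ` cross_hits E u v r (Suc (Suc k))"
    proof clarify
      fix w z
      assume w: "w \<in> ?B (Suc k)" and z: "(last w, z) \<in> E" "(last w, z) \<notin> arcs_of w"
        and nc: "w @ [z] \<notin> fst ` cross_hits E u v r (Suc (Suc k))"
        and ns: "w @ [z] \<notin> (\<lambda>(w, z). w @ [z]) ` self_hits E u v (Suc k)"
      have ns': "(w, z) \<notin> self_hits E u v (Suc k)" using ns by force
      moreover have wp: "w \<in> paths E u (Suc k)" "good_path E u v r w" "w ! 1 = x"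
        using w by (auto simp: branch_def)
      moreover have "\<nexists>p. (w @ [z], p) \<in> cross_hits E u v r (Suc (Suc k))" using nc by force
      ultimately have "good_path E u v r (w @ [z])"
        using good_path_extension[OF E' uv(3) wp(2) wp(1)] z Suc.prems by auto
      moreover have "z \<notin> set w" using ns' wp z by (auto simp: self_hits_def)
      then have "w @ [z] \<in> paths E u (Suc (Suc k))" using wp z by (simp add: snoc_in_paths[OF E'])
      moreover have "(w @ [z]) ! 1 = x" using wp by (auto simp: nth_append paths_def)
      ultimately show "w @ [z] \<in> ?B (Suc (Suc k))" by (simp add: branch_def)
    qed
  qed (use finB finite_self_hits[OF d uv(1,2) E] finite_cross_hits[OF d uv(1,2) E] in auto)
  also have "\<dots> \<le> card (?B (Suc (Suc k))) + card (self_hits E u v (Suc k)) + card (cross_hits E u v r (Suc (Suc k)))"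
    by (intro order_trans[OF card_Un_le] add_mono card_image_le order.refl
        finite_self_hits[OF d uv(1,2) E] finite_cross_hits[OF d uv(1,2) E])
  finally have "(d - 1) * card (?B (Suc k)) \<le> \<dots>" .
  moreover have "(d - 1) * (d - 1) ^ k \<le> (d - 1) * (card (?B (Suc k)) + tree_loss d E u v r (Suc k))"
    using Suc by (intro mult_le_mono2) simp
  ultimately show ?case unfolding tree_loss.simps(2)[of d E u v r "Suc k"] power_Suc distrib_left by linarith
qed

definition leaves :: "('a \<times> 'a) set \<Rightarrow> 'a \<Rightarrow> 'a \<Rightarrow> nat \<Rightarrow> 'a \<Rightarrow> 'a set" where
  "leaves E u v r x = last ` branch E u v r x r"

lemma card_leaves: "card (leaves E u v r x) = card (branch E u v r x r)"
  unfolding leaves_def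
  by (intro card_image inj_onI)
    (metis (mono_tags, lifting) branch_def good_path_def good_path_last_unique mem_Collect_eq)

lemma markov_count: "finite S \<Longrightarrow> card {x \<in> S. M \<le> f x} * M \<le> (\<Sum>x\<in>S. f x :: nat)"
proof -
  assume S: "finite S"
  have "card {x \<in> S. M \<le> f x} * M \<le> (\<Sum>x\<in>{x \<in> S. M \<le> f x}. f x)"
    using sum_bounded_below[of "{x \<in> S. M \<le> f x}" M f] by simp
  also have "\<dots> \<le> (\<Sum>x\<in>S. f x)" using S by (intro sum_mono2) auto
  finally show ?thesis .
qed

text \<open>A branch with less than half of its possible leaves forces
  \<open>2 * tree_loss d E u v r r\<close> to be at least \<open>(d - 1) ^ (r - 1)\<close>, so
  Markov's inequality applies. The loss does not depend on \<open>x\<close>; one estimate serves all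
  branches at \<open>u\<close>.\<close>

lemma few_leaves_count:
  assumes d: "3 \<le> d" and uv: "u < n" "v < n" "u \<noteq> v" and r: "0 < r"
    and n: "2 * (4 * Suc r + 2 * ((d + 1) * d)) \<le> n * d"
  shows "n * card {E \<in> reg_rels n d. \<exists>x. (u, x) \<in> E \<and> 2 * card (leaves E u v r x) < (d - 1) ^ (r - 1)}
    \<le> 40 * d * (r + 1) * (d - 1) ^ (r + 1) * card (reg_rels n d)" (is "n * card ?S \<le> _")
proof -
  let ?M = "(d - 1) ^ (r - 1)"
  obtain k where k: "r = Suc k" using r by (metis gr0_implies_Suc)
  have "?S \<subseteq> {E \<in> reg_rels n d. ?M \<le> 2 * tree_loss d E u v r r}"
    using branch_size[OF d uv, of _ _ k r] k by (auto simp: card_leaves) fastforce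
  then have "card ?S \<le> card {E \<in> reg_rels n d. ?M \<le> 2 * tree_loss d E u v r r}"
    by (intro card_mono) auto
  then have "n * card ?S * ?M \<le> n * (card {E \<in> reg_rels n d. ?M \<le> 2 * tree_loss d E u v r r} * ?M)"
    by simp
  also have "\<dots> \<le> n * (\<Sum>E\<in>reg_rels n d. 2 * tree_loss d E u v r r)"
    by (intro mult_le_mono2 markov_count) simp
  also have "\<dots> = 2 * (n * (\<Sum>E\<in>reg_rels n d. tree_loss d E u v r r))"
    by (simp flip: sum_distrib_left)
  also have "\<dots> \<le> 2 * (20 * d * (r + 1) * (d - 1) ^ (r + r) * card (reg_rels n d))"
    by (intro mult_le_mono2 sum_tree_loss[OF d uv(1,2) _ n]) simp
  also have "\<dots> = (40 * d * (r + 1) * (d - 1) ^ (r + 1) * card (reg_rels n d)) * ?M"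
    by (simp add: k power_add)
  finally show ?thesis using d by simp
qed

section \<open>Linking the search trees\<close>

text \<open>Breadth first search to depth \<open>r\<close> examines only the arcs at vertices
  reached in fewer than \<open>r\<close> steps.\<close>

lemma paths_cong:
  assumes "sym E" "sym E'"
    and agree: "\<And>p l z. p \<in> paths E x l \<Longrightarrow> l < r \<Longrightarrow> (last p, z) \<in> E \<longleftrightarrow> (last p, z) \<in> E'"
  shows "k \<le> r \<Longrightarrow> paths E x k = paths E' x k"
proof (induction k)
  case (Suc k)
  show ?case
  proof (intro set_eqI)
    fix w
    show "w \<in> paths E x (Suc k) \<longleftrightarrow> w \<in> paths E' x (Suc k)"
    proof (cases "w = []")
      case False
      then have "w = butlast w @ [last w]" by simp
      then obtain w' z where w: "w = w' @ [z]" by blast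
      show ?thesis using Suc agree[of w' k z] by (auto simp: w snoc_in_paths assms(1,2))
    qed (auto simp: paths_def)
  qed
qed (simp add: paths_0)

lemma branch_cong:
  assumes "\<And>k x. k \<le> r \<Longrightarrow> x \<in> {u, v} \<Longrightarrow> paths E x k = paths E' x k"
  shows "branch E u v r x r = branch E' u v r x r"
proof -
  have "short_paths E u v r = short_paths E' u v r"
    unfolding short_paths_def using assms by (intro SUP_cong refl) auto
  then show ?thesis using assms[of r u] by (simp add: branch_def good_path_def)
qed

lemma leaf_far:
  assumes "good_path E u v r w" "w \<in> paths E u r" "x \<in> {u, v}" "p \<in> paths E x l" "l < r"
  shows "last p \<noteq> last w"
proof
  assume "last p = last w"
  moreover have "p \<in> short_paths E u v r" using assms by (intro short_pathsI[of _ _ x l]) auto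
  ultimately have "p = w" using good_path_last_unique assms(1) by metis
  then show False using assms by (auto simp: paths_def)
qed

lemma path_upto:
  assumes "p \<in> paths E x l" "z \<in> set p"
  obtains q where "prefix q p" "q \<noteq> []" "last q = z" "q \<in> paths E x (length q - 1)" "length q - 1 \<le> l"
proof -
  obtain ys zs where p: "p = ys @ z # zs" using assms(2) by (meson split_list)
  then have "prefix (ys @ [z]) p" by (auto simp: prefix_def)
  then show ?thesis using that[of "ys @ [z]"] paths_prefix[OF assms(1), of "ys @ [z]"] by simp
qed

text \<open>A path of length less than \<open>r\<close> to the neighbour \<open>z\<close> could be
  continued to the leaf. Since only \<open>w\<close> reaches the leaf, the continuation would be
  \<open>w\<close>, and the arc between leaf and \<open>z\<close> would lie on
  \<open>w\<close>.\<close>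

lemma leaf_nbr_far:
  assumes E: "sym E" and w: "good_path E u v r w" "w \<in> paths E u r"
    and z: "(last w, z) \<in> E - arcs_of w" and p: "x \<in> {u, v}" "p \<in> paths E x l" "l < r"
  shows "last p \<noteq> z"
proof
  assume pz: "last p = z"
  have "last w \<notin> set p"
  proof
    assume "last w \<in> set p"
    then obtain q where "last q = last w" "q \<in> paths E x (length q - 1)" "length q - 1 \<le> l"
      using path_upto[OF p(2)] by metis
    then show False using leaf_far[OF w p(1)] p(3) by (meson le_less_trans)
  qed
  moreover have "(last p, last w) \<in> E" using z pz E by (auto dest: symD)
  ultimately have "p @ [last w] \<in> paths E x (Suc l)" using p by (simp add: snoc_in_paths[OF E])
  then have "p @ [last w] \<in> short_paths E u v r"
    using p by (intro short_pathsI[of _ _ x "Suc l"]) auto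
  then have "p @ [last w] = w" using good_path_last_unique[OF w(1)] by simp
  then have "(z, last w) \<in> arcs_of w" using pz paths_ne[OF p(2)] arcs_of_snoc[of p "last w"] by auto
  then show False using z arcs_of_commute by fastforce
qed

text \<open>The arcs usable for linking: they leave a leaf, but not back along its branch. Both of
  their ends lie outside the balls of radius \<open>r - 1\<close>, see
  \<open>outer_arcs_far\<close>.\<close>

definition outer_arcs :: "('a \<times> 'a) set \<Rightarrow> 'a \<Rightarrow> 'a \<Rightarrow> nat \<Rightarrow> 'a \<Rightarrow> ('a \<times> 'a) set" where
  "outer_arcs E u v r x =
     {(a, z). \<exists>w\<in>branch E u v r x r. last w = a \<and> (a, z) \<in> E - arcs_of w}"

lemma leaves_disjoint:
  assumes "u \<noteq> v" shows "leaves E u v r x \<inter> leaves E v u r y = {}"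
proof -
  have False if "w \<in> branch E u v r x r" "p \<in> branch E v u r y r" "last w = last p" for w p
  proof -
    have "good_path E u v r w" "p \<in> short_paths E u v r"
      using that by (auto simp: branch_def good_path_def short_paths_commute[of E v u])
    then have "p = w" using good_path_last_unique that(3) by metis
    then show False using that assms by (auto simp: branch_def paths_def)
  qed
  then show ?thesis by (auto simp: leaves_def)
qed

lemma outer_arcs_subset: "outer_arcs E u v r x \<subseteq> E"
  by (auto simp: outer_arcs_def)

lemma outer_arcs_leaf: "(a, z) \<in> outer_arcs E u v r x \<Longrightarrow> a \<in> leaves E u v r x"
  by (auto simp: outer_arcs_def leaves_def)

lemma outer_arcs_far:
  assumes E: "sym E" and a: "(a, z) \<in> outer_arcs E u v r x"
    and p: "y \<in> {u, v}" "p \<in> paths E y l" "l < r"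
  shows "last p \<noteq> a" "last p \<noteq> z"
proof -
  obtain w where w: "good_path E u v r w" "w \<in> paths E u r" "last w = a" "(last w, z) \<in> E - arcs_of w"
    using a by (auto simp: outer_arcs_def branch_def)
  show "last p \<noteq> a" using leaf_far[OF w(1,2) p] w(3) by simp
  show "last p \<noteq> z" using leaf_nbr_far[OF E w(1,2,4) p] .
qed

lemma card_outer_arcs:
  assumes d: "2 \<le> d" and u: "u < n" and E: "E \<in> reg_rels n d"
  shows "card (leaves E u v r x) \<le> card (outer_arcs E u v r x)"
proof -
  have "leaves E u v r x \<subseteq> fst ` outer_arcs E u v r x"
  proof
    fix a assume "a \<in> leaves E u v r x"
    then obtain w where w: "w \<in> branch E u v r x r" "a = last w" by (auto simp: leaves_def)
    then have wp: "w \<in> paths E u r" by (simp add: branch_def)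
    have "last w < n"
      using wp paths_vlists[OF E u] last_in_set[OF paths_ne[OF wp]] by (auto simp: vlists_def)
    then have "1 \<le> card {z. (last w, z) \<in> E - arcs_of w}"
      using card_nonbacktracking(1)[OF E wp] d by linarith
    then have "{z. (last w, z) \<in> E - arcs_of w} \<noteq> {}" by (metis card.empty not_one_le_zero)
    then show "a \<in> fst ` outer_arcs E u v r x" using w by (force simp: outer_arcs_def)
  qed
  then show ?thesis
    by (rule surj_card_le[rotated]) (rule finite_subset[OF outer_arcs_subset finite_reg_rel[OF E]])
qed

text \<open>Switching \<open>aa'\<close>, \<open>bb'\<close> to \<open>ab\<close>, \<open>a'b'\<close> links a leaf \<open>a\<close> of one tree to a leaf \<open>b\<close> of the other.
  All four vertices lie outside the balls of radius \<open>r - 1\<close>, so both search trees stay the same.\<close>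

context
  fixes n d u v r :: nat and E x y a a' b b'
  assumes uv: "u \<noteq> v" and E: "E \<in> reg_rels n d"
    and unlinked: "E \<inter> leaves E u v r x \<times> leaves E v u r y = {}"
    and a: "(a, a') \<in> outer_arcs E u v r x" and b: "(b, b') \<in> outer_arcs E v u r y"
    and ab: "a' \<noteq> b'" "(a', b') \<notin> E"
begin

lemma link_switch_conditions:
  "(a, a') \<in> E" "(b, b') \<in> E" "(a, b) \<notin> E" "(a', b') \<notin> E" "a \<noteq> b" "a' \<noteq> b'"
  using subsetD[OF outer_arcs_subset a] subsetD[OF outer_arcs_subset b] ab
    outer_arcs_leaf[OF a] outer_arcs_leaf[OF b] unlinked leaves_disjoint[OF uv, of E r x y] by auto

lemma link_switch_in_reg_rels: "switch E a a' b b' \<in> reg_rels n d"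
  by (rule switch_in_reg_rels[OF E link_switch_conditions])

lemma link_switch_agree:
  assumes "z \<in> {u, v}" "p \<in> paths E z l" "l < r"
  shows "(last p, t) \<in> E \<longleftrightarrow> (last p, t) \<in> switch E a a' b b'"
proof -
  note E' = reg_rels_sym_rel[OF E]
  have "last p \<notin> {a, a', b, b'}"
    using outer_arcs_far[OF E' a assms] outer_arcs_far[OF E' b _ assms(2,3)] assms(1) by auto
  then show ?thesis by (auto simp: switch_def)
qed

lemma link_switch_leaves:
  "leaves (switch E a a' b b') u v r x' = leaves E u v r x'"
  "leaves (switch E a a' b b') v u r x' = leaves E v u r x'"
proof -
  have *: "paths E z k = paths (switch E a a' b b') z k" if "k \<le> r" "z \<in> {u, v}" for z k
    by (rule paths_cong[OF reg_rels_sym_rel[OF E] reg_rels_sym_rel[OF link_switch_in_reg_rels] _ that(1)])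
      (rule link_switch_agree[OF that(2)])
  show "leaves (switch E a a' b b') u v r x' = leaves E u v r x'"
    "leaves (switch E a a' b b') v u r x' = leaves E v u r x'"
    unfolding leaves_def using * branch_cong[of r u v E] branch_cong[of r v u E] by (metis insert_commute)+
qed

text \<open>The only possible second link is \<open>(a', b')\<close>, since \<open>a'\<close> and
  \<open>b'\<close> may happen to be leaves as well. The reversed arc \<open>(b', a')\<close> is
  excluded: with \<open>a'\<close> a leaf of the other branch, \<open>(a, a')\<close> would have
  been a link before.\<close>

lemma link_switch_links:
  "(a, b) \<in> switch E a a' b b' \<inter> leaves E u v r x \<times> leaves E v u r y"
  "card (switch E a a' b b' \<inter> leaves E u v r x \<times> leaves E v u r y) \<le> 2"
proof -
  let ?A = "leaves E u v r x" and ?B = "leaves E v u r y"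
  note disj = leaves_disjoint[OF uv, of E r x y]
  have ab: "a \<in> ?A" "b \<in> ?B" using outer_arcs_leaf a b by metis+
  then show "(a, b) \<in> switch E a a' b b' \<inter> ?A \<times> ?B" by (simp add: switch_def)
  have "switch E a a' b b' \<inter> ?A \<times> ?B \<subseteq> {(a, b), (a', b')}"
    using unlinked disj ab link_switch_conditions by (auto simp: switch_def)
  then have "card (switch E a a' b b' \<inter> ?A \<times> ?B) \<le> card {(a, b), (a', b')}"
    by (intro card_mono) auto
  also have "\<dots> \<le> 2" by (simp add: card_insert_if)
  finally show "card (switch E a a' b b' \<inter> ?A \<times> ?B) \<le> 2" .
qed

end

text \<open>Graphs are counted together with two unlinked branches, named by \<open>x\<close> and
  \<open>y\<close>; this costs a factor \<open>d\<^sup>2\<close>. Forward there are at least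
  \<open>M\<close> outer arcs of one branch and for each of them at least
  \<open>M - (d + 1) * d\<close> suitable ones of the other. Backward the link \<open>(a, b)\<close>
  and the arc \<open>(a', b')\<close> have to be guessed, in at most \<open>2 * (n * d)\<close>
  ways.\<close>

lemma unlinked_count:
  fixes n d u v r M :: nat
  assumes d: "2 \<le> d" and uv: "u < n" "v < n" "u \<noteq> v" and r: "0 < r"
  shows "card {E \<in> reg_rels n d. \<exists>x y. (u, x) \<in> E \<and> (v, y) \<in> E \<and>
      M \<le> card (leaves E u v r x) \<and> M \<le> card (leaves E v u r y) \<and>
      E \<inter> leaves E u v r x \<times> leaves E v u r y = {}} * (M * (M - (d + 1) * d))
    \<le> card (reg_rels n d) * d\<^sup>2 * (2 * (n * d))"
proof -
  define nb where "nb E = E `` {u} \<times> E `` {v}" for E :: "(nat \<times> nat) set"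
  define Y where "Y = Sigma (reg_rels n d) nb"
  define X where "X = {(E, x, y) \<in> Y. M \<le> card (leaves E u v r x) \<and> M \<le> card (leaves E v u r y) \<and>
      E \<inter> leaves E u v r x \<times> leaves E v u r y = {}}"
  \<comment> \<open>Once \<open>(a, a')\<close> is chosen, \<open>b'\<close> must be neither
    \<open>a'\<close> nor adjacent to it for the switching to be legal; this rules out at most
    \<open>(d + 1) * d\<close> arcs.\<close>
  define Q where "Q = (\<lambda>(E, x, y). Sigma (outer_arcs E u v r x)
    (\<lambda>p. outer_arcs E v u r y - {(b, b') \<in> E. b' \<in> insert (snd p) (E `` {snd p})}))"
  \<comment> \<open>The double count wants \<open>P\<close> to be small on all of \<open>Y\<close>,
    but only switched graphs are known to have at most two links; on other graphs \<open>P\<close>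
    may be empty.\<close>
  define P where "P = (\<lambda>(E, x, y). let L = E \<inter> leaves E u v r x \<times> leaves E v u r y in
    if card L \<le> 2 then L \<times> E else {})"
  define \<phi> :: "((nat \<times> nat) set \<times> nat \<times> nat) \<times> (nat \<times> nat) \<times> (nat \<times> nat) \<Rightarrow> _"
    where "\<phi> = (\<lambda>((E, x, y), (a, a'), (b, b')). ((switch E a a' b b', x, y), (a, b), (a', b')))"
  have finY: "finite Y"
    unfolding Y_def nb_def by (intro finite_SigmaI finite_reg_rels) (auto simp: finite_nbrs)
  have XY: "X \<subseteq> Y" by (auto simp: X_def)

  have main: "card X * (M * (M - (d + 1) * d)) \<le> card Y * (2 * (n * d))"
  proof (rule double_count[where Q = Q and P = P and \<phi> = \<phi>])
    show "finite X" using XY finY by (rule finite_subset)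
    show "finite Y" by fact
  next
    fix t assume "t \<in> X"
    then obtain E x y where t: "t = (E, x, y)" and E: "E \<in> reg_rels n d"
      and M: "M \<le> card (leaves E u v r x)" "M \<le> card (leaves E v u r y)"
      by (auto simp: X_def Y_def)
    let ?A = "outer_arcs E u v r x" and ?B = "outer_arcs E v u r y"
    have fin: "finite ?A" "finite ?B"
      using finite_subset[OF outer_arcs_subset finite_reg_rel[OF E]] by auto
    have MA: "M \<le> card ?A" "M \<le> card ?B"
      using M card_outer_arcs[OF d uv(1) E] card_outer_arcs[OF d uv(2) E] by (meson order_trans)+
    have 1: "M - (d + 1) * d \<le> card (?B - {(b, b') \<in> E. b' \<in> insert a' (E `` {a'})})" for a'
    proof -
      have "card {(b, b') \<in> E. b' \<in> insert a' (E `` {a'})} \<le> card (insert a' (E `` {a'})) * d"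
        by (rule card_arcs_to[OF E]) (simp add: finite_nbrs[OF E])
      also have "\<dots> \<le> (d + 1) * d"
        using card_nbrs_le[OF E, of a'] finite_nbrs[OF E] by (intro mult_le_mono1) (simp add: card_insert_if)
      finally have "M - (d + 1) * d \<le> card ?B - card {(b, b') \<in> E. b' \<in> insert a' (E `` {a'})}"
        using MA by linarith
      also have "\<dots> \<le> card (?B - {(b, b') \<in> E. b' \<in> insert a' (E `` {a'})})"
        by (rule diff_card_le_card_Diff) (auto intro: finite_subset[OF _ finite_reg_rel[OF E]])
      finally show ?thesis .
    qed
    have "M * (M - (d + 1) * d) \<le> card ?A * (M - (d + 1) * d)" using MA by (intro mult_le_mono1)
    also have "\<dots> \<le> (\<Sum>p\<in>?A. card (?B - {(b, b') \<in> E. b' \<in> insert (snd p) (E `` {snd p})}))"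
      using sum_bounded_below[of ?A "M - (d + 1) * d"
          "\<lambda>p. card (?B - {(b, b') \<in> E. b' \<in> insert (snd p) (E `` {snd p})})"] 1 by simp
    also have "\<dots> = card (Q t)"
      unfolding t Q_def case_prod_conv
      by (rule card_SigmaI[of ?A "\<lambda>p. ?B - {(b, b') \<in> E. b' \<in> insert (snd p) (E `` {snd p})}", symmetric])
        (use fin in auto)
    finally show "finite (Q t) \<and> M * (M - (d + 1) * d) \<le> card (Q t)"
      using fin by (auto simp: Q_def t)
  next
    fix t assume "t \<in> Y"
    then obtain E x y where t: "t = (E, x, y)" and E: "E \<in> reg_rels n d" by (auto simp: Y_def)
    show "finite (P t) \<and> card (P t) \<le> 2 * (n * d)"
      using finite_reg_rel[OF E] card_reg_rel[OF E]
      by (auto simp: P_def t Let_def card_cartesian_product intro: mult_le_mono1)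
  next
    have "switch (switch E a a' b b') a b a' b' = E"
      if "((E, x, y), (a, a'), (b, b')) \<in> Sigma X Q" for E x y a a' b b'
    proof -
      have E: "E \<in> reg_rels n d" and un: "E \<inter> leaves E u v r x \<times> leaves E v u r y = {}"
        and a: "(a, a') \<in> outer_arcs E u v r x" and b: "(b, b') \<in> outer_arcs E v u r y"
        and ab: "a' \<noteq> b'" "(a', b') \<notin> E"
        using that subsetD[OF outer_arcs_subset, of "(b, b')" E v u r y]
        by (auto simp: X_def Y_def Q_def)
      show ?thesis by (rule switch_switch[OF E link_switch_conditions[OF uv(3) E un a b ab]])
    qed
    then show "inj_on \<phi> (Sigma X Q)"
      unfolding \<phi>_def
      by (intro inj_on_inverseI[where g = "\<lambda>((E, x, y), (a, b), (a', b')). ((switch E a b a' b', x, y), (a, a'), (b, b'))"])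
        auto
  next
    fix t s assume "t \<in> X" "s \<in> Q t"
    moreover obtain E x y a a' b b' where ts: "t = (E, x, y)" "s = ((a, a'), (b, b'))"
      by (metis surj_pair)
    ultimately have E: "E \<in> reg_rels n d" and xy: "(u, x) \<in> E" "(v, y) \<in> E"
      and un: "E \<inter> leaves E u v r x \<times> leaves E v u r y = {}"
      and a: "(a, a') \<in> outer_arcs E u v r x" and b: "(b, b') \<in> outer_arcs E v u r y"
      and ab: "a' \<noteq> b'" "(a', b') \<notin> E"
      using subsetD[OF outer_arcs_subset, of "(b, b')" E v u r y]
      by (auto simp: X_def Y_def Q_def nb_def)
    let ?E = "switch E a a' b b'"
    note C = uv(3) E un a b ab
    \<comment> \<open>The roots are the ends of trivial paths, and \<open>0 < r\<close>, so the
      switching does not touch their arcs and the names of the branches stay valid.\<close>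
    have "(u, x) \<in> ?E" "(v, y) \<in> ?E"
      using link_switch_agree[OF C, of u "[u]" 0] link_switch_agree[OF C, of v "[v]" 0] r xy
      by (auto simp: paths_0)
    then have "(?E, x, y) \<in> Y" using link_switch_in_reg_rels[OF C] by (simp add: Y_def nb_def)
    moreover have "((a, b), (a', b')) \<in> P (?E, x, y)"
    proof -
      have "(a', b') \<in> ?E" by (simp add: switch_def)
      then show ?thesis using link_switch_links[OF C] by (simp add: P_def link_switch_leaves[OF C] Let_def)
    qed
    ultimately show "\<phi> (t, s) \<in> Sigma Y P" by (simp add: \<phi>_def ts)
  qed
  have "card Y = (\<Sum>E\<in>reg_rels n d. card (nb E))"
    unfolding Y_def by (intro card_SigmaI) (auto simp: nb_def finite_nbrs)
  also have "\<dots> \<le> (\<Sum>E\<in>reg_rels n d. d\<^sup>2)"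
    by (intro sum_mono) (auto simp: nb_def card_cartesian_product power2_eq_square card_nbrs uv)
  finally have Y: "card Y \<le> card (reg_rels n d) * d\<^sup>2" by simp
  have "{E \<in> reg_rels n d. \<exists>x y. (u, x) \<in> E \<and> (v, y) \<in> E \<and>
      M \<le> card (leaves E u v r x) \<and> M \<le> card (leaves E v u r y) \<and>
      E \<inter> leaves E u v r x \<times> leaves E v u r y = {}} \<subseteq> fst ` X"
    by (force simp: X_def Y_def nb_def)
  then have "card {E \<in> reg_rels n d. \<exists>x y. (u, x) \<in> E \<and> (v, y) \<in> E \<and>
      M \<le> card (leaves E u v r x) \<and> M \<le> card (leaves E v u r y) \<and>
      E \<inter> leaves E u v r x \<times> leaves E v u r y = {}} \<le> card X"
    by (rule surj_card_le[rotated]) (use XY finY in \<open>rule finite_subset\<close>)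
  then have "card {E \<in> reg_rels n d. \<exists>x y. (u, x) \<in> E \<and> (v, y) \<in> E \<and>
      M \<le> card (leaves E u v r x) \<and> M \<le> card (leaves E v u r y) \<and>
      E \<inter> leaves E u v r x \<times> leaves E v u r y = {}} * (M * (M - (d + 1) * d))
      \<le> card X * (M * (M - (d + 1) * d))" by (rule mult_le_mono1)
  also note main
  also have "card Y * (2 * (n * d)) \<le> card (reg_rels n d) * d\<^sup>2 * (2 * (n * d))"
    using Y by (rule mult_le_mono1)
  finally show ?thesis .
qed

section \<open>Disjoint paths from linked branches\<close>

text \<open>The part of \<open>w\<close> up to \<open>z\<close> is a short path that ends on the
  good path \<open>p\<close>, hence a prefix of \<open>p\<close>. Good paths therefore cannot meet
  again once they have separated.\<close>

lemma good_paths_meet: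
  assumes "good_path E u v r w" "w \<in> paths E x k" "x \<in> {u, v}" "k \<le> r"
    and "good_path E u v r p" and z: "z \<in> set w" "z \<in> set p"
  shows "\<exists>q. prefix q w \<and> prefix q p \<and> q \<noteq> [] \<and> last q = z"
proof -
  obtain q where q: "prefix q w" "q \<noteq> []" "last q = z" "q \<in> paths E x (length q - 1)" "length q - 1 \<le> k"
    using path_upto[OF assms(2) z(1)] .
  then have "q \<in> short_paths E u v r"
    using assms by (intro short_pathsI[OF q(4)]) auto
  then show ?thesis using assms q by (auto simp: good_path_def)
qed

lemma branches_disjoint:
  assumes "w \<in> branch E u v r x r" "p \<in> branch E u v r y r" "x \<noteq> y"
  shows "set w \<inter> set p \<subseteq> {u}"
proof
  fix z assume "z \<in> set w \<inter> set p"
  then obtain q where q: "prefix q w" "prefix q p" "q \<noteq> []" "last q = z"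
    using good_paths_meet[of E u v r w u r p z] assms by (auto simp: branch_def)
  have "hd q = u" using q assms by (auto simp: branch_def paths_def prefix_def)
  have "length q < 2"
  proof (rule ccontr)
    assume "\<not> length q < 2"
    then have "w ! 1 = q ! 1" "p ! 1 = q ! 1" using q by (auto simp: prefix_def nth_append)
    then show False using assms by (auto simp: branch_def)
  qed
  then have "length q = 1" using q(3) by (cases q) auto
  then have "q = [u]" using \<open>hd q = u\<close> by (auto simp: length_Suc_conv)
  then show "z \<in> {u}" using q by simp
qed

lemma opposite_branches_disjoint:
  assumes "w \<in> branch E u v r x r" "p \<in> branch E v u r y r" "u \<noteq> v"
  shows "set w \<inter> set p = {}"
proof -
  have False if z: "z \<in> set w" "z \<in> set p" for z
  proof -
    obtain q where q: "prefix q w" "prefix q p" "q \<noteq> []"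
      using good_paths_meet[of E u v r w u r p z] assms z
      by (auto simp: branch_def good_path_commute[of E v u])
    then have "hd w = hd p" by (auto simp: prefix_def)
    then show False using assms by (auto simp: branch_def paths_def)
  qed
  then show ?thesis by blast
qed

text \<open>Any bijection between the neighbours of \<open>u\<close> and those of \<open>v\<close>
  may be used to match branches. Each branch then occurs in one path only, so two paths share just
  the roots. The summand 1 in the length is the link.\<close>

lemma linked_paths:
  assumes d: "0 < d" and uv: "u < n" "v < n" "u \<noteq> v" and E: "E \<in> reg_rels n d" and r: "0 < r"
    and linked: "\<And>x y. (u, x) \<in> E \<Longrightarrow> (v, y) \<in> E \<Longrightarrow>
      E \<inter> leaves E u v r x \<times> leaves E v u r y \<noteq> {}"
  shows "\<exists>P. card P = d \<and> P \<subseteq> {p \<in> paths E u (2 * r + 1). last p = v} \<and>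
    (\<forall>p\<in>P. \<forall>q\<in>P. p \<noteq> q \<longrightarrow> set p \<inter> set q \<subseteq> {u, v})"
proof -
  have "card (E `` {u}) = card (E `` {v})" using card_nbrs[OF E] uv by simp
  then obtain h where h: "bij_betw h (E `` {u}) (E `` {v})"
    using finite_same_card_bij finite_nbrs[OF E] by metis
  have "\<exists>w p. w \<in> branch E u v r x r \<and> p \<in> branch E v u r (h x) r \<and> (last w, last p) \<in> E"
    if "(u, x) \<in> E" for x
  proof -
    have "(v, h x) \<in> E" using h that by (auto simp: bij_betw_def)
    then have "E \<inter> leaves E u v r x \<times> leaves E v u r (h x) \<noteq> {}" by (rule linked[OF that])
    then show ?thesis unfolding leaves_def by blast
  qed
  then obtain w p where wp: "\<And>x. (u, x) \<in> E \<Longrightarrow> w x \<in> branch E u v r x r"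
    "\<And>x. (u, x) \<in> E \<Longrightarrow> p x \<in> branch E v u r (h x) r" "\<And>x. (u, x) \<in> E \<Longrightarrow> (last (w x), last (p x)) \<in> E"
    by metis
  define g where "g x = w x @ rev (p x)" for x
  have g1: "g x ! 1 = x" if "(u, x) \<in> E" for x
    using wp(1)[OF that] r by (auto simp: g_def branch_def paths_def nth_append)
  have inj: "inj_on g (E `` {u})"
    by (rule inj_on_inverseI[where g = "\<lambda>l. l ! 1"]) (use g1 in auto)
  have gp: "g x \<in> {p \<in> paths E u (2 * r + 1). last p = v}" if x: "(u, x) \<in> E" for x
  proof -
    have w: "w x \<in> paths E u r" and p: "p x \<in> paths E v r" using wp[OF x] by (auto simp: branch_def)
    note ne = paths_ne[OF w] paths_ne[OF p]
    have "(last (p x), last (w x)) \<in> E" using wp(3)[OF x] reg_rels_sym[OF E] by blast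
    then have "arcs_of (g x) \<subseteq> E"
      using w p ne wp(3)[OF x] by (auto simp: g_def arcs_of_append hd_rev paths_def)
    moreover have "distinct (g x)"
      using w p opposite_branches_disjoint[OF wp(1,2) uv(3)] x by (auto simp: g_def paths_def)
    moreover have "length (g x) = Suc (2 * r + 1)" "hd (g x) = u" "last (g x) = v"
      using w p ne by (auto simp: g_def paths_def last_rev)
    ultimately show ?thesis by (simp add: paths_def)
  qed
  have disj: "set (g x) \<inter> set (g y) \<subseteq> {u, v}" if x: "(u, x) \<in> E" "(u, y) \<in> E" "x \<noteq> y" for x y
  proof -
    have "h x \<noteq> h y" using h x by (auto simp: bij_betw_def inj_on_def)
    then show ?thesis
      using branches_disjoint[OF wp(1)[OF x(1)] wp(1)[OF x(2)] x(3)]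
        branches_disjoint[OF wp(2)[OF x(1)] wp(2)[OF x(2)]]
        opposite_branches_disjoint[OF wp(1)[OF x(1)] wp(2)[OF x(2)] uv(3)]
        opposite_branches_disjoint[OF wp(1)[OF x(2)] wp(2)[OF x(1)] uv(3)]
      by (auto simp: g_def)
  qed
  show ?thesis
  proof (intro exI[of _ "g ` (E `` {u})"] conjI ballI impI)
    show "card (g ` (E `` {u})) = d" using inj card_nbrs[OF E uv(1)] by (simp add: card_image)
  qed (use gp disj in blast)+
qed

section \<open>Shortcuts\<close>

definition uv_paths :: "('a \<times> 'a) set \<Rightarrow> 'a \<Rightarrow> 'a \<Rightarrow> nat \<Rightarrow> 'a list set" where
  "uv_paths E u v L = {p \<in> paths E u L. last p = v}"

definition path_pairs :: "('a \<times> 'a) set \<Rightarrow> 'a \<Rightarrow> 'a \<Rightarrow> nat \<Rightarrow> ('a list \<times> 'a list) set" where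
  "path_pairs E u v L =
     {(p, q). p \<in> uv_paths E u v L \<and> q \<in> uv_paths E u v L \<and> set p \<inter> set q \<subseteq> {u, v}}"

definition cycle_list :: "'a list \<times> 'a list \<Rightarrow> 'a list" where
  "cycle_list = (\<lambda>(p, q). p @ rev (tl (butlast q)))"

definition cyclic_dist :: "nat \<Rightarrow> nat \<Rightarrow> nat \<Rightarrow> nat" where
  "cyclic_dist m i j = (if i \<le> j then min (j - i) (m - (j - i)) else min (i - j) (m - (i - j)))"

text \<open>Only the last arc of a shortcut is required to lie outside the cycle: a path that violates the
  almost geodesic condition may be cut off after its last arc outside the cycle and still violates
  it. A chord is a shortcut with a trivial initial path, that is, \<open>B i j = 1\<close>.\<close>

definition shortcuts ::
    "('a \<times> 'a) set \<Rightarrow> 'a \<Rightarrow> 'a \<Rightarrow> nat \<Rightarrow> (nat \<Rightarrow> nat \<Rightarrow> nat) \<Rightarrow>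
     (('a list \<times> 'a list) \<times> nat \<times> nat \<times> 'a list) set" where
  "shortcuts E u v L B = {(pq, i, j, s). pq \<in> path_pairs E u v L \<and> i < 2 * L \<and> j < 2 * L \<and>
     s \<in> (\<Union>a<B i j. paths E (cycle_list pq ! i) a) \<and>
     (last s, cycle_list pq ! j) \<in> E - (arcs_of (fst pq) \<union> arcs_of (snd pq) \<union> arcs_of s)}"

text \<open>Singles out the arc into \<open>v\<close>, which becomes the closing arc.\<close>

lemma uv_paths_Suc:
  assumes "sym E"
  shows "uv_paths E u v (Suc k) = (\<lambda>w. w @ [v]) ` {w \<in> paths E u k. v \<notin> set w \<and> (last w, v) \<in> E}"
proof (intro set_eqI iffI)
  fix p assume p: "p \<in> uv_paths E u v (Suc k)"
  then have "p \<in> paths E u (Suc k)" by (simp add: uv_paths_def)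
  then obtain w z where "p = w @ [z]" "w \<in> paths E u k" "z \<notin> set w" "(last w, z) \<in> E"
    using paths_Suc_cases[OF _ assms] by metis
  then show "p \<in> (\<lambda>w. w @ [v]) ` {w \<in> paths E u k. v \<notin> set w \<and> (last w, v) \<in> E}"
    using p by (auto simp: uv_paths_def)
qed (auto simp: uv_paths_def snoc_in_paths[OF assms])

lemma cycle_list_verts:
  assumes E: "E \<in> reg_rels n d" and u: "u < n" and L: "2 \<le> L" and path_pair: "pq \<in> path_pairs E u v L"
  shows "set (cycle_list pq) = set (fst pq) \<union> set (snd pq)" "distinct (cycle_list pq)"
    "length (cycle_list pq) = 2 * L" "set (cycle_list pq) \<subseteq> {..<n}"
proof -
  obtain p q where pq: "pq = (p, q)" by fastforce
  have p: "p \<in> paths E u L" "last p = v" and q: "q \<in> paths E u L" "last q = v"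
    and pq_int: "set p \<inter> set q \<subseteq> {u, v}"
    using path_pair by (auto simp: path_pairs_def uv_paths_def pq)
  have ql: "length q = Suc L" "hd q = u" "distinct q" using q by (auto simp: paths_def)
  define r where "r = tl q"
  have r: "q = u # r" "r \<noteq> []"
  proof -
    show "q = u # r" unfolding r_def ql(2)[symmetric] using paths_ne[OF q(1)] by simp
    show "r \<noteq> []" using ql(1) L by (simp add: r_def flip: length_0_conv)
  qed
  define b where "b = butlast r"
  have "last q = last r" unfolding r(1) by (rule last_ConsR[OF r(2)])
  then have "r = b @ [v]" unfolding b_def using append_butlast_last_id[OF r(2)] q(2) by metis
  then have q_eq: "q = u # b @ [v]" by (simp only: r(1))
  have cyc: "cycle_list pq = p @ rev b" by (simp add: cycle_list_def pq q_eq butlast_append)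
  have "hd p = u" using p(1) by (simp add: paths_def)
  then have "u \<in> set p" "v \<in> set p"
    using hd_in_set[OF paths_ne[OF p(1)]] last_in_set[OF paths_ne[OF p(1)]] p(2) by simp_all
  then show "set (cycle_list pq) = set (fst pq) \<union> set (snd pq)"
    unfolding cyc by (auto simp: pq q_eq)
  have "u \<notin> set b" "v \<notin> set b" "distinct b" "set b \<subseteq> set q" using ql(3) by (auto simp: q_eq)
  moreover have "distinct p" using p by (simp add: paths_def)
  ultimately show "distinct (cycle_list pq)"
    using pq_int unfolding cyc by auto
  show "length (cycle_list pq) = 2 * L" using p ql L by (simp add: cycle_list_def pq paths_def)
  show "set (cycle_list pq) \<subseteq> {..<n}"
    unfolding \<open>set (cycle_list pq) = set (fst pq) \<union> set (snd pq)\<close>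
    using p q by (simp add: pq paths_vlists[OF E u] vlists_def)
qed

section \<open>Expected numbers of path pairs and shortcuts\<close>

context
  fixes n d u v L :: nat
  assumes d: "3 \<le> d" and uv: "u < n" "v < n" "u \<noteq> v" and L: "2 \<le> L"
    and n: "2 * (6 * L + 4 + 2 * ((d + 1) * d)) \<le> n * d"
begin

context
  fixes E assumes E: "E \<in> reg_rels n d"
begin

lemma finite_uv_paths: "finite (uv_paths E u v L)"
  by (simp add: uv_paths_def finite_paths[OF E] uv)

lemma finite_path_pairs: "finite (path_pairs E u v L)"
  by (rule finite_subset[of _ "uv_paths E u v L \<times> uv_paths E u v L"])
    (auto simp: path_pairs_def finite_uv_paths)

end

lemma sum_card_uv_paths:
  "n * (\<Sum>E\<in>reg_rels n d. card (uv_paths E u v L)) \<le> 4 * d * (d - 1) ^ (L - 1) * card (reg_rels n d)"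
proof -
  obtain k where k: "L = Suc k" using L by (cases L) auto
  let ?T = "{w \<in> vlists n u k. v \<notin> set w}"
  have "n * (\<Sum>E\<in>reg_rels n d. card (uv_paths E u v L))
    \<le> n * (\<Sum>E\<in>reg_rels n d. card {w \<in> ?T. arcs_of w \<subseteq> E \<and> (last w, v) \<in> E})"
  proof (intro mult_le_mono2 sum_mono)
    fix E assume E: "E \<in> reg_rels n d"
    have "{w \<in> ?T. arcs_of w \<subseteq> E \<and> (last w, v) \<in> E} = {w \<in> paths E u k. v \<notin> set w \<and> (last w, v) \<in> E}"
      by (auto simp: paths_vlists[OF E uv(1)])
    then show "card (uv_paths E u v L) \<le> card {w \<in> ?T. arcs_of w \<subseteq> E \<and> (last w, v) \<in> E}"
      unfolding k uv_paths_Suc[OF reg_rels_sym_rel[OF E]]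
      by (simp add: card_image_le finite_paths[OF E uv(1)])
  qed
  also have "\<dots> \<le> 2 * d * (\<Sum>E\<in>reg_rels n d. card {w \<in> ?T. arcs_of w \<subseteq> E})"
  proof (rule closing_arc_count[OF _ _ n])
    fix w assume "w \<in> ?T"
    then show "sym (arcs_of w) \<and> finite (arcs_of w) \<and> card (arcs_of w) \<le> 6 * L + 4 \<and> (last w, v) \<notin> arcs_of w"
      using card_arcs_of[of w] arcs_of_in_set[of "last w" v w] by (auto simp: sym_arcs_of vlists_def k)
  qed simp
  also have "\<dots> \<le> 2 * d * (\<Sum>E\<in>reg_rels n d. 2 * (d - 1) ^ k)"
  proof (intro mult_le_mono2 sum_mono)
    fix E assume E: "E \<in> reg_rels n d"
    have "card {w \<in> ?T. arcs_of w \<subseteq> E} \<le> card (paths E u k)"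
      by (intro card_mono) (auto simp: paths_vlists[OF E uv(1)] finite_paths[OF E uv(1)])
    also have "\<dots> \<le> 2 * (d - 1) ^ k" using d by (intro card_paths[OF E uv(1)]) simp
    finally show "card {w \<in> ?T. arcs_of w \<subseteq> E} \<le> 2 * (d - 1) ^ k" .
  qed
  finally show ?thesis by (simp add: k mult_ac)
qed

text \<open>Two closing steps in succession: the second path is closed while the first is complete,
  and the remaining sum over first paths is that of \<open>sum_card_uv_paths\<close>.\<close>

lemma sum_card_path_pairs:
  "n\<^sup>2 * (\<Sum>E\<in>reg_rels n d. card (path_pairs E u v L))
    \<le> (4 * d * (d - 1) ^ (L - 1))\<^sup>2 * card (reg_rels n d)"
proof -
  obtain k where k: "L = Suc k" "k \<noteq> 0" using L by (cases L) auto
  let ?T = "{(p, w). p \<in> vlists n u L \<and> last p = v \<and> w \<in> vlists n u k \<and> v \<notin> set w \<and>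
    (last w, v) \<notin> arcs_of p}"
  let ?F = "\<lambda>t. arcs_of (fst t) \<union> arcs_of (snd t)"
  have finT: "finite ?T"
    by (rule finite_subset[of _ "vlists n u L \<times> vlists n u k"]) auto
  have "n * (\<Sum>E\<in>reg_rels n d. card (path_pairs E u v L))
    \<le> n * (\<Sum>E\<in>reg_rels n d. card {t \<in> ?T. ?F t \<subseteq> E \<and> (last (snd t), v) \<in> E})"
  proof (intro mult_le_mono2 sum_mono)
    fix E assume E: "E \<in> reg_rels n d"
    let ?S = "{t \<in> ?T. ?F t \<subseteq> E \<and> (last (snd t), v) \<in> E}"
    have "path_pairs E u v L \<subseteq> (\<lambda>(p, w). (p, w @ [v])) ` ?S"
    proof clarify
      fix p q assume pq: "(p, q) \<in> path_pairs E u v L"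
      then have "q \<in> uv_paths E u v (Suc k)" by (simp add: path_pairs_def k)
      then obtain w where w: "q = w @ [v]" "w \<in> paths E u k" "v \<notin> set w" "(last w, v) \<in> E"
        unfolding uv_paths_Suc[OF reg_rels_sym_rel[OF E]] by auto
      \<comment> \<open>If the last arc of \<open>q\<close> were on \<open>p\<close>, its start
        would be a common vertex other than \<open>v\<close>, hence \<open>u\<close>. But
        \<open>w\<close> has at least two vertices because \<open>2 \<le> L\<close>, so it does not
        end in its first vertex \<open>u\<close>.\<close>
      have "(last w, v) \<notin> arcs_of p"
      proof
        assume "(last w, v) \<in> arcs_of p"
        then have "last w \<in> set p \<inter> set q" using w paths_ne[OF w(2)] arcs_of_in_set[of "last w" v p] by simp
        moreover have "last w \<in> set w" using paths_ne[OF w(2)] by simp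
        ultimately have lw: "last w = u" using pq w(3) by (auto simp: path_pairs_def)
        obtain x w' where w': "w = x # w'" using paths_ne[OF w(2)] by (cases w) auto
        then have "w' \<noteq> []" "x = u" "distinct w" using w(2) k(2) by (auto simp: paths_def)
        then show False using lw w' last_in_set[of w'] by auto
      qed
      then have "(p, w) \<in> ?S"
        using pq w by (auto simp: path_pairs_def uv_paths_def paths_vlists[OF E uv(1)])
      then show "(p, q) \<in> (\<lambda>(p, w). (p, w @ [v])) ` ?S" using w(1) by force
    qed
    then show "card (path_pairs E u v L) \<le> card ?S"
      using finT by (intro surj_card_le[of ?S]) auto
  qed
  also have "\<dots> \<le> 2 * d * (\<Sum>E\<in>reg_rels n d. card {t \<in> ?T. ?F t \<subseteq> E})"
  proof (rule closing_arc_count[OF finT _ n])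
    fix t assume t: "t \<in> ?T"
    have "card (?F t) \<le> card (arcs_of (fst t)) + card (arcs_of (snd t))" by (rule card_Un_le)
    also have "\<dots> \<le> 2 * length (fst t) + 2 * length (snd t)" by (intro add_mono card_arcs_of)
    also have "\<dots> \<le> 6 * L + 4" using t by (auto simp: vlists_def k)
    finally have "card (?F t) \<le> 6 * L + 4" .
    with t show "sym (?F t) \<and> finite (?F t) \<and> card (?F t) \<le> 6 * L + 4 \<and> (last (snd t), v) \<notin> ?F t"
      by (auto simp: sym_arcs_of intro: sym_Un dest: arcs_of_in_set)
  qed
  also have "\<dots> \<le> 2 * d * (\<Sum>E\<in>reg_rels n d. card (uv_paths E u v L) * (2 * (d - 1) ^ k))"
  proof (intro mult_le_mono2 sum_mono)
    fix E assume E: "E \<in> reg_rels n d"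
    have "card {t \<in> ?T. ?F t \<subseteq> E} \<le> card (uv_paths E u v L \<times> paths E u k)"
      by (intro card_mono)
        (auto simp: paths_vlists[OF E uv(1)] uv_paths_def finite_paths[OF E uv(1)])
    also have "\<dots> \<le> card (uv_paths E u v L) * (2 * (d - 1) ^ k)"
      unfolding card_cartesian_product using d by (intro mult_le_mono2 card_paths[OF E uv(1)]) simp
    finally show "card {t \<in> ?T. ?F t \<subseteq> E} \<le> card (uv_paths E u v L) * (2 * (d - 1) ^ k)" .
  qed
  also have "\<dots> = (4 * d * (d - 1) ^ k) * (\<Sum>E\<in>reg_rels n d. card (uv_paths E u v L))"
    unfolding sum_distrib_right[symmetric] by (simp add: mult_ac)
  finally have "n * (n * (\<Sum>E\<in>reg_rels n d. card (path_pairs E u v L)))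
      \<le> n * ((4 * d * (d - 1) ^ k) * (\<Sum>E\<in>reg_rels n d. card (uv_paths E u v L)))"
    by (rule mult_le_mono2)
  also have "\<dots> = (4 * d * (d - 1) ^ k) * (n * (\<Sum>E\<in>reg_rels n d. card (uv_paths E u v L)))"
    by (simp add: mult_ac)
  also have "\<dots> \<le> (4 * d * (d - 1) ^ k) * (4 * d * (d - 1) ^ k * card (reg_rels n d))"
    using sum_card_uv_paths by (intro mult_le_mono2) (simp add: k)
  finally show ?thesis by (simp add: k power2_eq_square mult_ac)
qed

text \<open>A third closing step: the open structure is a pair of paths, two positions on the cycle
  and the initial path of a shortcut, with at most \<open>2 * (d - 1) ^ B i j\<close> choices for
  the latter. The factor \<open>c\<close> avoids a division: \<open>W\<close> can be a power of
  \<open>d - 1\<close> with the full cyclic distance as exponent, and \<open>c\<close> the power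
  gained by stopping short of it.\<close>

lemma sum_card_shortcuts:
  assumes B: "\<And>i j. i < 2 * L \<Longrightarrow> j < 2 * L \<Longrightarrow> B i j \<le> L"
    and W: "\<And>i j. i < 2 * L \<Longrightarrow> j < 2 * L \<Longrightarrow> B i j \<noteq> 0 \<Longrightarrow> 2 * (d - 1) ^ B i j * c \<le> W i j"
  shows "n * (\<Sum>E\<in>reg_rels n d. card (shortcuts E u v L B)) * c
    \<le> 2 * d * (\<Sum>i<2*L. \<Sum>j<2*L. W i j) * (\<Sum>E\<in>reg_rels n d. card (path_pairs E u v L))"
proof -
  define pp where "pp = {(p, q). p \<in> vlists n u L \<and> q \<in> vlists n u L \<and> last p = v \<and> last q = v \<and>
    set p \<inter> set q \<subseteq> {u, v}}"
  define T where "T = {(pq, i, j, s). pq \<in> pp \<and> i < 2 * L \<and> j < 2 * L \<and> cycle_list pq ! i < n \<and>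
    s \<in> (\<Union>a<B i j. vlists n (cycle_list pq ! i) a) \<and>
    (last s, cycle_list pq ! j) \<notin> arcs_of (fst pq) \<union> arcs_of (snd pq) \<union> arcs_of s}"
  define F where "F = (\<lambda>(pq :: nat list \<times> nat list, i :: nat, j :: nat, s :: nat list).
    arcs_of (fst pq) \<union> arcs_of (snd pq) \<union> arcs_of s)"
  define a where "a = (\<lambda>(pq :: nat list \<times> nat list, i :: nat, j :: nat, s :: nat list). last s)"
  define b where "b = (\<lambda>(pq :: nat list \<times> nat list, i :: nat, j :: nat, s :: nat list). cycle_list pq ! j)"
  have pp: "pq \<in> path_pairs E u v L \<longleftrightarrow> pq \<in> pp \<and> arcs_of (fst pq) \<union> arcs_of (snd pq) \<subseteq> E"
    if "E \<in> reg_rels n d" for E pq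
    by (auto simp: pp_def path_pairs_def uv_paths_def paths_vlists[OF that uv(1)])
  have finT: "finite T"
  proof (rule finite_subset)
    show "T \<subseteq> pp \<times> {..<2*L} \<times> {..<2*L} \<times> (\<Union>x<n. \<Union>a<L. vlists n x a)"
    proof
      fix t assume t: "t \<in> T"
      obtain pq i j s where teq: "t = (pq, i, j, s)" by (metis surj_pair)
      obtain a where "a < B i j" "s \<in> vlists n (cycle_list pq ! i) a" "cycle_list pq ! i < n"
        "pq \<in> pp" "i < 2 * L" "j < 2 * L"
        using t by (auto simp: T_def teq)
      moreover then have "a < L" using B[of i j] by linarith
      ultimately show "t \<in> pp \<times> {..<2*L} \<times> {..<2*L} \<times> (\<Union>x<n. \<Union>a<L. vlists n x a)"
        by (auto simp: teq)
    qed
    have "finite pp" by (rule finite_subset[of _ "vlists n u L \<times> vlists n u L"]) (auto simp: pp_def)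
    then show "finite (pp \<times> {..<2*L} \<times> {..<2*L} \<times> (\<Union>x<n. \<Union>a<L. vlists n x a))" by auto
  qed
  have cyc: "cycle_list pq ! i < n" if "E \<in> reg_rels n d" "pq \<in> path_pairs E u v L" "i < 2 * L" for E pq i
    using cycle_list_verts(3,4)[OF that(1) uv(1) L that(2)] that(3) by (metis lessThan_iff nth_mem subsetD)
  have sc: "shortcuts E u v L B = {t \<in> T. F t \<subseteq> E \<and> (a t, b t) \<in> E}" if E: "E \<in> reg_rels n d" for E
  proof (rule set_eqI)
    fix t :: "(nat list \<times> nat list) \<times> nat \<times> nat \<times> nat list"
    obtain pq i j s where t: "t = (pq, i, j, s)" by (metis surj_pair)
    have *: "s \<in> paths E (cycle_list pq ! i) l \<longleftrightarrow> s \<in> vlists n (cycle_list pq ! i) l \<and> arcs_of s \<subseteq> E"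
      if "cycle_list pq ! i < n" for l
      using paths_vlists[OF E that] .
    show "t \<in> shortcuts E u v L B \<longleftrightarrow> t \<in> {t \<in> T. F t \<subseteq> E \<and> (a t, b t) \<in> E}"
    proof (cases "pq \<in> path_pairs E u v L \<and> i < 2 * L")
      case True
      then show ?thesis
        using cyc[OF E, of pq i] pp[OF E, of pq]
        by (simp add: shortcuts_def T_def F_def a_def b_def t *) blast
    next
      case False
      then show ?thesis using pp[OF E, of pq] by (auto simp: shortcuts_def T_def F_def t)
    qed
  qed
  have "n * (\<Sum>E\<in>reg_rels n d. card (shortcuts E u v L B))
    = n * (\<Sum>E\<in>reg_rels n d. card {t \<in> T. F t \<subseteq> E \<and> (a t, b t) \<in> E})"
    by (simp add: sc)
  also have "\<dots> \<le> 2 * d * (\<Sum>E\<in>reg_rels n d. card {t \<in> T. F t \<subseteq> E})"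
  proof (rule closing_arc_count[OF finT _ n])
    fix t assume t: "t \<in> T"
    obtain p q i j s where teq: "t = ((p, q), i, j, s)" by (metis surj_pair)
    have "length s \<le> L" using t B[of i j] by (force simp: T_def teq vlists_def)
    have "card (F t) \<le> card (arcs_of p) + card (arcs_of q) + card (arcs_of s)"
      unfolding F_def teq by (auto intro!: order_trans[OF card_Un_le] add_mono)
    also have "\<dots> \<le> 2 * length p + 2 * length q + 2 * length s" by (intro add_mono card_arcs_of)
    \<comment> \<open>The two paths have \<open>L + 1\<close> vertices each and \<open>s\<close> has
      at most \<open>L\<close>; by \<open>card_arcs_of\<close> every vertex counts for two
      arcs.\<close>
    also have "\<dots> \<le> 6 * L + 4" using t \<open>length s \<le> L\<close> by (auto simp: T_def pp_def teq vlists_def)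
    finally have "card (F t) \<le> 6 * L + 4" .
    with t show "sym (F t) \<and> finite (F t) \<and> card (F t) \<le> 6 * L + 4 \<and> (a t, b t) \<notin> F t"
      by (auto simp: T_def F_def a_def b_def teq sym_arcs_of intro!: sym_Un)
  qed
  finally have "n * (\<Sum>E\<in>reg_rels n d. card (shortcuts E u v L B)) * c
    \<le> 2 * d * (\<Sum>E\<in>reg_rels n d. card {t \<in> T. F t \<subseteq> E}) * c" by (rule mult_le_mono1)
  also have "\<dots> = 2 * d * (\<Sum>E\<in>reg_rels n d. card {t \<in> T. F t \<subseteq> E} * c)"
    by (simp add: sum_distrib_right mult.assoc)
  also have "\<dots> \<le> 2 * d * (\<Sum>E\<in>reg_rels n d. card (path_pairs E u v L) * (\<Sum>i<2*L. \<Sum>j<2*L. W i j))"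
  proof (intro mult_le_mono2 sum_mono)
    fix E assume E: "E \<in> reg_rels n d"
    let ?PP = "path_pairs E u v L"
    let ?S = "\<lambda>pq i j. \<Union>a<B i j. paths E (cycle_list pq ! i) a"
    let ?N = "SIGMA pq:?PP. SIGMA i:{..<2*L}. SIGMA j:{..<2*L}. ?S pq i j"
    have finS: "finite (?S pq i j)" if "pq \<in> ?PP" "i < 2 * L" for pq i j
      using cyc[OF E that] finite_paths[OF E] by blast
    have "{t \<in> T. F t \<subseteq> E} \<subseteq> ?N"
    proof
      fix t assume "t \<in> {t \<in> T. F t \<subseteq> E}"
      moreover obtain pq i j s where t: "t = (pq, i, j, s)" by (metis surj_pair)
      ultimately show "t \<in> ?N"
        using pp[OF E, of pq] paths_vlists[OF E, of "cycle_list pq ! i" s]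
        by (simp add: T_def F_def)
    qed
    then have "card {t \<in> T. F t \<subseteq> E} \<le> card ?N"
      using finS by (intro card_mono) (auto intro!: finite_SigmaI simp: finite_path_pairs[OF E])
    also have "\<dots> = (\<Sum>pq\<in>?PP. \<Sum>i<2*L. \<Sum>j<2*L. card (?S pq i j))"
    proof -
      have "card ?N = (\<Sum>pq\<in>?PP. card (SIGMA i:{..<2*L}. SIGMA j:{..<2*L}. ?S pq i j))"
        using finS by (intro card_SigmaI ballI finite_SigmaI finite_path_pairs[OF E]) auto
      also have "\<dots> = (\<Sum>pq\<in>?PP. \<Sum>i<2*L. card (SIGMA j:{..<2*L}. ?S pq i j))"
        using finS by (intro sum.cong refl card_SigmaI ballI finite_SigmaI) auto
      also have "\<dots> = (\<Sum>pq\<in>?PP. \<Sum>i<2*L. \<Sum>j<2*L. card (?S pq i j))"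
        using finS by (intro sum.cong refl card_SigmaI ballI) auto
      finally show ?thesis .
    qed
    finally have "card {t \<in> T. F t \<subseteq> E} * c \<le> (\<Sum>pq\<in>?PP. \<Sum>i<2*L. \<Sum>j<2*L. card (?S pq i j)) * c"
      by (rule mult_le_mono1)
    also have "\<dots> = (\<Sum>pq\<in>?PP. \<Sum>i<2*L. \<Sum>j<2*L. card (?S pq i j) * c)"
      by (simp only: sum_distrib_right)
    also have "\<dots> \<le> (\<Sum>pq\<in>?PP. \<Sum>i<2*L. \<Sum>j<2*L. W i j)"
    proof (intro sum_mono)
      fix pq i j assume *: "pq \<in> ?PP" "i \<in> {..<2*L}" "j \<in> {..<2*L}"
      show "card (?S pq i j) * c \<le> W i j"
      \<comment> \<open>For \<open>B i j = 0\<close> the union is empty, whereas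
        \<open>card_short_paths\<close> would still count 2. Such pairs of positions are too close
        for a shortcut, and \<open>W\<close> need not cover that 2.\<close>
      proof (cases "B i j = 0")
        case False
        have "card (?S pq i j) * c \<le> 2 * (d - 1) ^ B i j * c"
          using cyc[OF E *(1)] * d by (intro mult_le_mono1 card_short_paths[OF E]) auto
        also have "\<dots> \<le> W i j" using W False * by simp
        finally show ?thesis .
      qed simp
    qed
    also have "\<dots> = card ?PP * (\<Sum>i<2*L. \<Sum>j<2*L. W i j)" by simp
    finally show "card {t \<in> T. F t \<subseteq> E} * c \<le> card ?PP * (\<Sum>i<2*L. \<Sum>j<2*L. W i j)" .
  qed
  also have "\<dots> = 2 * d * (\<Sum>i<2*L. \<Sum>j<2*L. W i j) * (\<Sum>E\<in>reg_rels n d. card (path_pairs E u v L))"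
    unfolding sum_distrib_right[symmetric] by (simp add: mult_ac)
  finally show ?thesis .
qed

lemma finite_shortcuts:
  assumes E: "E \<in> reg_rels n d"
  shows "finite (shortcuts E u v L B)"
proof (rule finite_subset)
  let ?N = "SIGMA pq:path_pairs E u v L. SIGMA i:{..<2*L}. SIGMA j:{..<2*L}.
    \<Union>a<B i j. paths E (cycle_list pq ! i) a"
  show "shortcuts E u v L B \<subseteq> ?N" by (auto simp: shortcuts_def)
  have "finite (paths E (cycle_list pq ! i) a)" if "pq \<in> path_pairs E u v L" "i < 2 * L" for pq i a
  proof (rule finite_paths[OF E])
    show "cycle_list pq ! i < n"
      using cycle_list_verts(3,4)[OF E uv(1) L that(1)] that(2) by (metis lessThan_iff nth_mem subsetD)
  qed
  then show "finite ?N" by (intro finite_SigmaI finite_path_pairs[OF E]) auto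
qed

text \<open>Chords are treated apart because they may join vertices whose distance on the cycle is
  small. They do not violate the distance condition then, but the induced subgraph would fail to be
  a cycle.\<close>

lemma sum_card_chords:
  "n ^ 3 * (\<Sum>E\<in>reg_rels n d. card (shortcuts E u v L (\<lambda>_ _. 1)))
    \<le> 2 * d * ((2 * L)\<^sup>2 * (2 * (d - 1))) * ((4 * d * (d - 1) ^ (L - 1))\<^sup>2 * card (reg_rels n d))"
proof -
  let ?S = "\<Sum>E\<in>reg_rels n d. card (shortcuts E u v L (\<lambda>_ _. 1))"
  let ?P = "\<Sum>E\<in>reg_rels n d. card (path_pairs E u v L)"
  have "n * ?S * 1 \<le> 2 * d * (\<Sum>i<2*L. \<Sum>j<2*L. 2 * (d - 1)) * ?P"
    using L by (intro sum_card_shortcuts) auto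
  also have "(\<Sum>i<2*L. \<Sum>j<2*L. 2 * (d - 1)) = (2 * L)\<^sup>2 * (2 * (d - 1))"
    by (simp add: power2_eq_square)
  finally have "n\<^sup>2 * (n * ?S) \<le> n\<^sup>2 * (2 * d * ((2 * L)\<^sup>2 * (2 * (d - 1))) * ?P)" by simp
  also have "\<dots> = 2 * d * ((2 * L)\<^sup>2 * (2 * (d - 1))) * (n\<^sup>2 * ?P)" by (simp only: mult_ac)
  also have "\<dots> \<le> 2 * d * ((2 * L)\<^sup>2 * (2 * (d - 1))) * ((4 * d * (d - 1) ^ (L - 1))\<^sup>2 * card (reg_rels n d))"
    by (intro mult_le_mono2 sum_card_path_pairs)
  finally show ?thesis by (simp add: power2_eq_square power3_eq_cube mult.assoc)
qed

text \<open>For each distance there are boundedly many positions: the four candidates go from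
  \<open>i\<close> in either direction, with or without passing the end of the list. The rest is a
  geometric sum dominated by the antipodal distance \<open>L\<close>.\<close>

lemma sum_pow_cyclic_dist:
  "(\<Sum>j<2*L. (d - 1) ^ cyclic_dist (2 * L) i j) \<le> 4 * (d - 1) ^ (L + 1)" if "i < 2 * L"
proof -
  have "(\<Sum>j<2*L. (d - 1) ^ cyclic_dist (2 * L) i j)
    = (\<Sum>m<L+1. \<Sum>j\<in>{j \<in> {..<2*L}. cyclic_dist (2 * L) i j = m}. (d - 1) ^ cyclic_dist (2 * L) i j)"
    by (rule sum.group[symmetric]) (auto simp: cyclic_dist_def)
  also have "\<dots> \<le> (\<Sum>m<L+1. 4 * (d - 1) ^ m)"
  proof (rule sum_mono)
    fix m
    have "{j \<in> {..<2*L}. cyclic_dist (2 * L) i j = m} \<subseteq> {i + m, i - m, i + 2 * L - m, i + m - 2 * L}"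
    proof
      fix j assume j: "j \<in> {j \<in> {..<2*L}. cyclic_dist (2 * L) i j = m}"
      then consider "i \<le> j" "m = j - i" | "i \<le> j" "m = 2 * L - (j - i)"
        | "j < i" "m = i - j" | "j < i" "m = 2 * L - (i - j)"
        by (auto simp: cyclic_dist_def min_def split: if_splits)
      then have "j = i + m \<or> j = i - m \<or> j = i + 2 * L - m \<or> j = i + m - 2 * L"
        using that j by cases auto
      then show "j \<in> {i + m, i - m, i + 2 * L - m, i + m - 2 * L}" by blast
    qed
    then have "card {j \<in> {..<2*L}. cyclic_dist (2 * L) i j = m} \<le> card {i + m, i - m, i + 2 * L - m, i + m - 2 * L}"
      by (intro card_mono) auto
    also have "\<dots> \<le> 4" using card_length[of "[i + m, i - m, i + 2 * L - m, i + m - 2 * L]"] by simp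
    finally show "(\<Sum>j\<in>{j \<in> {..<2*L}. cyclic_dist (2 * L) i j = m}. (d - 1) ^ cyclic_dist (2 * L) i j)
      \<le> 4 * (d - 1) ^ m" by simp
  qed
  also have "\<dots> \<le> 4 * (d - 1) ^ (L + 1)"
  proof -
    have "(\<Sum>m<L+1. (d - 1) ^ m) \<le> (d - 1) ^ (L + 1)" using d by (intro geometric_le) simp
    then show ?thesis unfolding sum_distrib_left[symmetric] by (rule mult_le_mono2)
  qed
  finally show ?thesis .
qed

text \<open>With its closing arc a shortcut has length \<open>a + 1\<close>, and
  \<open>a < cyclic_dist (2 * L) i j - (e + 1)\<close> says that it saves more than \<open>e\<close>
  against the way along the cycle.\<close>

lemma sum_card_distant_shortcuts:
  "n ^ 3 * (\<Sum>E\<in>reg_rels n d. card (shortcuts E u v L (\<lambda>i j. cyclic_dist (2 * L) i j - (e + 1)))) * (d - 1) ^ e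
    \<le> 2 * d * (16 * L * (d - 1) ^ (L + 1)) * ((4 * d * (d - 1) ^ (L - 1))\<^sup>2 * card (reg_rels n d))"
proof -
  let ?B = "\<lambda>i j. cyclic_dist (2 * L) i j - (e + 1)"
  let ?S = "\<Sum>E\<in>reg_rels n d. card (shortcuts E u v L ?B)"
  let ?P = "\<Sum>E\<in>reg_rels n d. card (path_pairs E u v L)"
  have "n * ?S * (d - 1) ^ e \<le> 2 * d * (\<Sum>i<2*L. \<Sum>j<2*L. 2 * (d - 1) ^ cyclic_dist (2 * L) i j) * ?P"
  proof (rule sum_card_shortcuts)
    fix i j assume *: "?B i j \<noteq> 0"
    have "2 * (d - 1) ^ ?B i j * (d - 1) ^ e = 2 * (d - 1) ^ (?B i j + e)" by (simp add: power_add)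
    also have "\<dots> \<le> 2 * (d - 1) ^ cyclic_dist (2 * L) i j"
      using d * by (intro mult_le_mono2 power_increasing) auto
    finally show "2 * (d - 1) ^ ?B i j * (d - 1) ^ e \<le> 2 * (d - 1) ^ cyclic_dist (2 * L) i j" .
  qed (auto simp: cyclic_dist_def)
  also have "\<dots> \<le> 2 * d * (16 * L * (d - 1) ^ (L + 1)) * ?P"
  proof -
    have "(\<Sum>i<2*L. \<Sum>j<2*L. 2 * (d - 1) ^ cyclic_dist (2 * L) i j) \<le> (\<Sum>i<2*L. 8 * (d - 1) ^ (L + 1))"
    proof (rule sum_mono)
      fix i assume "i \<in> {..<2*L}"
      then show "(\<Sum>j<2*L. 2 * (d - 1) ^ cyclic_dist (2 * L) i j) \<le> 8 * (d - 1) ^ (L + 1)"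
        using mult_le_mono2[OF sum_pow_cyclic_dist[of i], of 2] by (simp add: sum_distrib_left)
    qed
    also have "\<dots> = 16 * L * (d - 1) ^ (L + 1)" by simp
    finally show ?thesis by (intro mult_le_mono1 mult_le_mono2)
  qed
  finally have "n\<^sup>2 * (n * ?S * (d - 1) ^ e) \<le> n\<^sup>2 * (2 * d * (16 * L * (d - 1) ^ (L + 1)) * ?P)"
    by (rule mult_le_mono2)
  also have "\<dots> = 2 * d * (16 * L * (d - 1) ^ (L + 1)) * (n\<^sup>2 * ?P)" by (simp only: mult_ac)
  also have "\<dots> \<le> 2 * d * (16 * L * (d - 1) ^ (L + 1)) * ((4 * d * (d - 1) ^ (L - 1))\<^sup>2 * card (reg_rels n d))"
    by (intro mult_le_mono2 sum_card_path_pairs)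
  finally show ?thesis by (simp add: power2_eq_square power3_eq_cube mult.assoc)
qed

end

section \<open>Cycles and distances in graphs\<close>

definition rel_graph :: "'a set \<Rightarrow> ('a \<times> 'a) set \<Rightarrow> ('a, 'a \<times> 'a) pre_digraph" where
  "rel_graph S A = with_proj \<lparr> pverts = S, parcs = A \<rparr>"

lemma pcas_zip:
  "xs \<noteq> [] \<Longrightarrow> pcas (hd xs) (zip xs (tl xs)) (last xs) \<and> pawalk_verts (hd xs) (zip xs (tl xs)) = xs"
proof (induction xs)
  case (Cons x xs)
  then show ?case by (cases xs) auto
qed simp

lemma zip_pawalk_verts: "pcas x p y \<Longrightarrow> zip (pawalk_verts x p) (tl (pawalk_verts x p)) = p"
proof (induction p arbitrary: x)
  case (Cons e p)
  then show ?case by (cases p; cases e) auto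
qed simp

lemma pawalk_verts_ends: "pcas x p y \<Longrightarrow> hd (pawalk_verts x p) = x \<and> last (pawalk_verts x p) = y"
proof (induction p arbitrary: x)
  case (Cons e p)
  then show ?case by (cases p) auto
qed simp

lemma length_pawalk_verts: "length (pawalk_verts x p) = Suc (length p)"
  by (induction p arbitrary: x) auto

lemma set_zip_tl_subset: "set (zip xs (tl xs)) \<subseteq> arcs_of xs"
  by (auto simp: arcs_of_def)

lemma arcs_of_eq_zip: "arcs_of xs = set (zip xs (tl xs)) \<union> (set (zip xs (tl xs)))\<inverse>"
  by (auto simp: arcs_of_def in_set_zip)

lemma induce_rel_graph: "rel_graph S A \<restriction> T = rel_graph T {e \<in> A. fst e \<in> T \<and> snd e \<in> T}"
  by (simp add: rel_graph_def induce_subgraph_def with_proj_def)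

text \<open>Used both for the whole graph and for the cycle inside it, so that the two distances
  obey the same lemmas.\<close>

locale finite_simple_rel =
  fixes S :: "'a set" and A :: "('a \<times> 'a) set"
  assumes finite_S: "finite S" and A_subset: "A \<subseteq> S \<times> S" and sym_A: "sym A" and irrefl_A: "irrefl A"
begin

abbreviation "H \<equiv> \<lparr> pverts = S, parcs = A \<rparr>"

sublocale H: pair_graph H
  rewrites "pverts H = S" and "parcs H = A"
proof -
  have "finite A" using A_subset finite_S by (meson finite_SigmaI finite_subset)
  then show "pair_graph H"
    using A_subset finite_S sym_A irrefl_A
    by unfold_locales (auto simp: symmetric_def irrefl_def)
qed simp_all

lemma rel_graph_awalk:
  "pre_digraph.awalk (rel_graph S A) x p y \<longleftrightarrow> x \<in> S \<and> set p \<subseteq> A \<and> pcas x p y"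
  by (simp add: rel_graph_def H.awalk_def)

lemma rel_graph_apath:
  "pre_digraph.apath (rel_graph S A) x p y \<longleftrightarrow>
    x \<in> S \<and> set p \<subseteq> A \<and> pcas x p y \<and> distinct (pawalk_verts x p)"
  by (simp add: rel_graph_def H.apath_def H.awalk_def)

lemma awalk_cost_1: "H.awalk_cost (\<lambda>_. 1) p = length p"
  by (induction p) auto

lemma graph_dist_le_length:
  assumes "x \<in> S" "set p \<subseteq> A" "pcas x p y"
  shows "graph_dist (rel_graph S A) x y \<le> ereal (length p)"
proof -
  have "H.awalk x p y" using assms by (simp add: H.awalk_def)
  then show ?thesis
    using H.min_cost_le_walk_cost[of x p y "\<lambda>_. 1"]
    by (simp add: awalk_cost_1 rel_graph_def graph_dist_def)
qed

lemma graph_dist_le: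
  assumes "ys \<noteq> []" "hd ys \<in> S" "arcs_of ys \<subseteq> A"
  shows "graph_dist (rel_graph S A) (hd ys) (last ys) \<le> ereal (length ys - 1)"
proof -
  have "set (zip ys (tl ys)) \<subseteq> A" using set_zip_tl_subset assms(3) by (rule order_trans)
  then show ?thesis
    using graph_dist_le_length[of "hd ys" "zip ys (tl ys)" "last ys"] assms pcas_zip[of ys] by simp
qed

lemma graph_dist_path:
  assumes "graph_dist (rel_graph S A) x y < \<infinity>"
  obtains k ys where "ys \<in> paths A x k" "last ys = y" "graph_dist (rel_graph S A) x y = ereal k"
proof -
  have "x \<rightarrow>\<^sup>*\<^bsub>with_proj H\<^esub> y"
    using assms unfolding rel_graph_def graph_dist_def H.\<mu>_reach_conv .
  then obtain p where p: "H.apath x p y" "H.\<mu> (\<lambda>_. 1) x y = H.awalk_cost (\<lambda>_. 1) p"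
    using H.min_cost_awalk[of x y "\<lambda>_. 1"] by auto
  then have *: "pcas x p y" "set p \<subseteq> A" "distinct (pawalk_verts x p)"
    by (auto simp: H.apath_def H.awalk_def)
  have "p\<inverse> \<subseteq> A" if "p \<subseteq> A" for p using that sym_A by (auto dest: symD)
  then have "arcs_of (pawalk_verts x p) \<subseteq> A"
    using *(2) by (auto simp: arcs_of_eq_zip zip_pawalk_verts[OF *(1)])
  then have "pawalk_verts x p \<in> paths A x (length p)"
    using * pawalk_verts_ends[OF *(1)] by (simp add: paths_def length_pawalk_verts)
  then show ?thesis
    using that p(2) pawalk_verts_ends[OF *(1)]
    by (simp add: awalk_cost_1 rel_graph_def graph_dist_def)
qed

lemma graph_dist_triangle:
  "graph_dist (rel_graph S A) x z \<le> graph_dist (rel_graph S A) x y + graph_dist (rel_graph S A) y z"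
proof (cases "graph_dist (rel_graph S A) x y < \<infinity> \<and> graph_dist (rel_graph S A) y z < \<infinity>")
  case True
  then have "x \<rightarrow>\<^sup>*\<^bsub>with_proj H\<^esub> y" "y \<rightarrow>\<^sup>*\<^bsub>with_proj H\<^esub> z"
    unfolding rel_graph_def graph_dist_def H.\<mu>_reach_conv by simp_all
  then obtain p q where p: "H.apath x p y" "H.\<mu> (\<lambda>_. 1) x y = H.awalk_cost (\<lambda>_. 1) p"
    and q: "H.apath y q z" "H.\<mu> (\<lambda>_. 1) y z = H.awalk_cost (\<lambda>_. 1) q"
    using H.min_cost_awalk[of _ _ "\<lambda>_. 1"] by (metis zero_le_one)
  have "H.awalk x (p @ q) z"
    using p(1) q(1) by (intro H.awalk_appendI) (auto simp: H.apath_def)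
  from H.min_cost_le_walk_cost[OF this, of "\<lambda>_. 1"] show ?thesis
    using p(2) q(2) by (simp add: rel_graph_def graph_dist_def)
next
  case False
  moreover have "0 \<le> graph_dist (rel_graph S A) x y" for x y
  proof (cases "graph_dist (rel_graph S A) x y < \<infinity>")
    case True
    then show ?thesis using graph_dist_path by (metis ereal_less_eq(5) of_nat_0_le_iff)
  qed auto
  then have "graph_dist (rel_graph S A) x y \<noteq> -\<infinity>" for x y by (metis MInfty_neq_PInfty(1) ereal_infty_less_eq(2) ereal_times(1) zero_ereal_def PInfty_neq_ereal(1) MInfty_neq_ereal(1))
  ultimately have "graph_dist (rel_graph S A) x y + graph_dist (rel_graph S A) y z = \<infinity>"
    by auto
  then show ?thesis by (metis ereal_less_eq(1))
qed

end

text \<open>Applied with \<open>A\<close> the arcs of a cycle: after its last arc outside the cycle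
  a path merely follows the cycle.\<close>

lemma last_outside_arc:
  assumes "sym A" "ys \<noteq> []"
  shows "arcs_of ys \<subseteq> A \<or>
    (\<exists>ys1 z ys2. ys = ys1 @ z # ys2 \<and> ys1 \<noteq> [] \<and> (last ys1, z) \<notin> A \<and> arcs_of (z # ys2) \<subseteq> A)"
  using assms(2)
proof (induction ys)
  case (Cons x ys)
  show ?case
  proof (cases ys)
    case (Cons b t)
    then consider "arcs_of ys \<subseteq> A" | ys1 z ys2 where "ys = ys1 @ z # ys2" "ys1 \<noteq> []"
      "(last ys1, z) \<notin> A" "arcs_of (z # ys2) \<subseteq> A"
      using Cons.IH by blast
    then show ?thesis
    proof cases
      case 1
      show ?thesis
      proof (cases "(x, b) \<in> A")
        case True
        then show ?thesis using 1 Cons assms(1) by (auto dest: symD)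
      next
        case False
        then have "x # ys = [x] @ b # t \<and> [x] \<noteq> [] \<and> (last [x], b) \<notin> A \<and> arcs_of (b # t) \<subseteq> A"
          using 1 Cons by simp
        then show ?thesis by blast
      qed
    next
      case 2
      then have "x # ys = (x # ys1) @ z # ys2 \<and> x # ys1 \<noteq> [] \<and> (last (x # ys1), z) \<notin> A
        \<and> arcs_of (z # ys2) \<subseteq> A" by simp
      then show ?thesis by blast
    qed
  qed simp
qed simp

lemma arcs_of_drop_take: "arcs_of (drop i (take j xs)) \<subseteq> arcs_of xs"
proof (cases "drop i (take j xs) = []")
  case False
  have "arcs_of (drop i (take j xs)) \<subseteq> arcs_of (take j xs)"
  proof (cases "take i (take j xs) = []")
    case True
    then have "drop i (take j xs) = take j xs" by (metis append_Nil append_take_drop_id)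
    then show ?thesis by simp
  next
    case nonempty: False
    show ?thesis
      using arcs_of_append[OF nonempty False] by (metis append_take_drop_id le_sup_iff order_refl)
  qed
  also have "\<dots> \<subseteq> arcs_of xs" by (intro arcs_of_prefix take_is_prefix)
  finally show ?thesis .
qed simp

section \<open>The cycle formed by two paths\<close>

locale chordless_cycle_in_rel =
  fixes n :: nat and E :: "(nat \<times> nat) set" and d u v L p q c A T
  assumes E: "E \<in> reg_rels n d" and uv: "u < n" "v < n" "u \<noteq> v" and L: "2 \<le> L"
    and pq: "(p, q) \<in> path_pairs E u v L"
    and no_chords: "shortcuts E u v L (\<lambda>_ _. 1) = {}"
  defines c_def: "c \<equiv> cycle_list (p, q)" and A_def: "A \<equiv> arcs_of p \<union> arcs_of q"
    and T_def: "T \<equiv> set p \<union> set q"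
begin

lemma cycle_facts: "set c = T" "distinct c" "length c = 2 * L" "T \<subseteq> {..<n}"
  using cycle_list_verts[OF E uv(1) L pq] by (simp_all add: c_def T_def)

lemma path_pair_shape:
  obtains b where "q = u # b @ [v]" "b \<noteq> []" "c = p @ rev b" "p \<noteq> []" "hd p = u" "last p = v"
proof -
  have p: "p \<in> paths E u L" "last p = v" and q: "q \<in> paths E u L" "last q = v"
    using pq by (auto simp: path_pairs_def uv_paths_def)
  have ql: "length q = Suc L" "hd q = u" using q by (auto simp: paths_def)
  define b where "b = tl (butlast q)"
  have "butlast q \<noteq> []" using ql L by (simp flip: length_0_conv)
  have "hd (butlast q) = u" using ql \<open>butlast q \<noteq> []\<close>
    by (metis append_butlast_last_id hd_append2 butlast.simps(1))
  then have "butlast q = u # b" using \<open>butlast q \<noteq> []\<close> by (metis b_def list.collapse)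
  then have qb: "q = u # b @ [v]"
    using append_butlast_last_id[OF paths_ne[OF q(1)]] q(2) by simp
  have "b \<noteq> []" using ql L by (auto simp: qb)
  moreover have "c = p @ rev b" by (simp add: c_def cycle_list_def b_def)
  moreover have "p \<noteq> []" "hd p = u" using p by (auto simp: paths_def)
  ultimately show ?thesis using that qb p(2) by blast
qed

lemma A_eq: "A = arcs_of c \<union> {(last c, hd c), (hd c, last c)}"
proof -
  obtain b where b: "q = u # b @ [v]" "b \<noteq> []" "c = p @ rev b" "p \<noteq> []" "hd p = u" "last p = v"
    using path_pair_shape .
  have "arcs_of c = arcs_of p \<union> arcs_of b \<union> {(v, last b), (last b, v)}"
    using b by (simp add: arcs_of_append hd_rev)
  moreover have "arcs_of q = arcs_of b \<union> {(v, last b), (last b, v)} \<union> {(u, hd b), (hd b, u)}"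
    using b arcs_of_append[of "[u]" "b @ [v]"] by (auto simp: arcs_of_append)
  moreover have "last c = hd b" "hd c = u" using b by (auto simp: last_rev)
  ultimately show ?thesis by (auto simp: A_def)
qed

lemma sym_A: "sym A" by (auto simp: A_def sym_arcs_of intro: sym_Un)

lemma A_subset: "A \<subseteq> T \<times> T" "A \<subseteq> E"
  using pq arcs_of_in_set by (fastforce simp: A_def T_def path_pairs_def uv_paths_def paths_def)+

text \<open>An arc from \<open>x\<close> between vertices of the cycle but not on it is a chord,
  that is, a shortcut with initial path \<open>[x]\<close>.\<close>

lemma induced_arcs: "{e \<in> E. fst e \<in> T \<and> snd e \<in> T} = A"
proof (intro equalityI subsetI)
  fix e assume e: "e \<in> {e \<in> E. fst e \<in> T \<and> snd e \<in> T}"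
  then obtain x y where xy: "e = (x, y)" "(x, y) \<in> E" "x \<in> T" "y \<in> T" by (cases e) auto
  then obtain i j where ij: "i < 2 * L" "j < 2 * L" "x = c ! i" "y = c ! j"
    using cycle_facts by (metis in_set_conv_nth)
  show "e \<in> A"
  proof (rule ccontr)
    assume "e \<notin> A"
    then have "((p, q), i, j, [x]) \<in> shortcuts E u v L (\<lambda>_ _. 1)"
      using pq xy ij by (auto simp: shortcuts_def A_def paths_0 c_def)
    then show False using no_chords by simp
  qed
qed (use A_subset in auto)

sublocale C: finite_simple_rel T A
proof
  show "finite T" using cycle_facts(4) by (rule finite_subset) simp
  show "irrefl A" using A_subset(2) reg_rels_irrefl[OF E] by (auto simp: irrefl_def)
qed (use sym_A A_subset in auto)

sublocale G: finite_simple_rel "{..<n}" E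
  by unfold_locales (use E in \<open>auto simp: reg_rels_def\<close>)

lemma cyc_dist_le:
  assumes "i \<le> j" "j < 2 * L"
  shows "graph_dist (rel_graph T A) (c ! i) (c ! j) \<le> ereal (j - i)"
    "graph_dist (rel_graph T A) (c ! j) (c ! i) \<le> ereal (j - i)"
    "graph_dist (rel_graph T A) (c ! i) (c ! j) \<le> ereal (2 * L - (j - i))"
    "graph_dist (rel_graph T A) (c ! j) (c ! i) \<le> ereal (2 * L - (j - i))"
proof -
  have len: "length c = 2 * L" using cycle_facts by simp
  have *: "graph_dist (rel_graph T A) x y \<le> ereal k" "graph_dist (rel_graph T A) y x \<le> ereal k"
    if ys: "ys \<noteq> []" "hd ys = x" "last ys = y" "set ys \<subseteq> T" "arcs_of ys \<subseteq> A" "length ys - 1 = k" for ys x y k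
  proof -
    have "x \<in> T" "y \<in> T" using ys by auto
    then show "graph_dist (rel_graph T A) x y \<le> ereal k" "graph_dist (rel_graph T A) y x \<le> ereal k"
      using C.graph_dist_le[of ys] C.graph_dist_le[of "rev ys"] ys by (auto simp: hd_rev last_rev)
  qed
  let ?ys = "drop i (take (Suc j) c)"
  have 1: "?ys \<noteq> []" "hd ?ys = c ! i" "last ?ys = c ! j" "length ?ys - 1 = j - i" "set ?ys \<subseteq> T"
    using assms len cycle_facts(1) by (auto simp: hd_drop_conv_nth last_conv_nth dest!: in_set_dropD in_set_takeD)
  have 2: "arcs_of ?ys \<subseteq> A" using arcs_of_drop_take[of i "Suc j" c] by (auto simp: A_eq)
  show "graph_dist (rel_graph T A) (c ! i) (c ! j) \<le> ereal (j - i)"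
    "graph_dist (rel_graph T A) (c ! j) (c ! i) \<le> ereal (j - i)"
    using *[OF 1(1-3,5) 2 1(4)] by auto
  \<comment> \<open>The other way around: from position \<open>j\<close> through the end of the
    list, over the closing arc, and on from the start of the list to position
    \<open>i\<close>.\<close>
  let ?zs = "drop j c @ take (Suc i) c"
  have ne: "drop j c \<noteq> []" "take (Suc i) c \<noteq> []" using assms len by auto
  have "take (Suc i) c = take i c @ [c ! i]" using assms len by (simp add: take_Suc_conv_app_nth)
  then have "last ?zs = c ! i" by simp
  then have 3: "?zs \<noteq> []" "hd ?zs = c ! j" "last ?zs = c ! i" "length ?zs - 1 = 2 * L - (j - i)" "set ?zs \<subseteq> T"
    using assms len cycle_facts(1) ne
    by (auto simp: hd_drop_conv_nth hd_append dest!: in_set_dropD in_set_takeD)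
  have "last (drop j c) = last c" "hd (take (Suc i) c) = hd c" using assms len by (auto simp: hd_take)
  then have "arcs_of ?zs \<subseteq> A"
    using arcs_of_drop_take[of j "length c" c] arcs_of_drop_take[of 0 "Suc i" c] ne
    by (auto simp: A_eq arcs_of_append)
  from *[OF 3(1-3,5) this 3(4)] show "graph_dist (rel_graph T A) (c ! i) (c ! j) \<le> ereal (2 * L - (j - i))"
    "graph_dist (rel_graph T A) (c ! j) (c ! i) \<le> ereal (2 * L - (j - i))" by auto
qed

text \<open>An inequality is enough, since an almost geodesic cycle is one whose own distances are
  not too large compared with those in the graph.\<close>

lemma graph_dist_cyclic:
  assumes "i < 2 * L" "j < 2 * L"
  shows "graph_dist (rel_graph T A) (c ! i) (c ! j) \<le> ereal (cyclic_dist (2 * L) i j)"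
  using cyc_dist_le[of i j] cyc_dist_le[of j i] assms
  by (auto simp: cyclic_dist_def min_def)

lemma is_cycle: "is_cycle_graph (rel_graph T A)"
proof -
  have len: "length c = 2 * L" and dc: "distinct c" using cycle_facts by auto
  then have ne: "c \<noteq> []" using L by auto
  let ?c = "zip (c @ [hd c]) (tl (c @ [hd c]))"
  have verts: "pawalk_verts (hd c) ?c = c @ [hd c]" and cas: "pcas (hd c) ?c (hd c)"
    using pcas_zip[of "c @ [hd c]"] ne by auto
  have "arcs_of (c @ [hd c]) = A" using ne by (auto simp: arcs_of_snoc A_eq)
  then have arcs: "set ?c \<union> (set ?c)\<inverse> = A" by (simp add: arcs_of_eq_zip)
  have tl: "tl (c @ [hd c]) = tl c @ [hd c]" using ne by simp
  have "distinct (tl c @ [hd c])" using dc ne by (cases c) auto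
  moreover have "hd c \<in> T" using ne cycle_facts(1) by auto
  moreover have "?c \<noteq> []" using len L by (auto simp: tl)
  ultimately have "pre_digraph.cycle (rel_graph T A) ?c"
    using arcs cas verts tl unfolding pre_digraph.cycle_def C.rel_graph_awalk
    by (intro exI[of _ "hd c"]) (auto simp: rel_graph_def)
  moreover have "3 \<le> length ?c" using len L by (simp add: tl)
  moreover have "verts (rel_graph T A) = tail (rel_graph T A) ` set ?c"
  proof -
    have "fst ` set ?c = set (map fst ?c)" by simp
    also have "map fst ?c = c" using ne by (simp add: map_fst_zip_take)
    finally show ?thesis using cycle_facts(1) by (simp add: rel_graph_def)
  qed
  moreover have "arcs_ends (rel_graph T A) = (\<Union>a\<in>set ?c. {(tail (rel_graph T A) a, head (rel_graph T A) a),
      (head (rel_graph T A) a, tail (rel_graph T A) a)})"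
    unfolding rel_graph_def with_proj_simps arcs[symmetric] by auto
  moreover have "graph (rel_graph T A)"
    unfolding rel_graph_def by (rule C.H.pair_graphD_graph)
  ultimately show ?thesis unfolding is_cycle_graph_def by blast
qed

text \<open>A violating shortest path cannot run entirely inside the cycle. Otherwise it is cut
  after its last arc outside the cycle, which ends in some \<open>z\<close>. The discarded part
  follows the cycle, so by the triangle inequality the initial part saves as much between
  \<open>x\<close> and \<open>z\<close> as the whole path did between \<open>x\<close> and
  \<open>y\<close>, and it is a forbidden shortcut.\<close>

lemma almost_geodesic:
  assumes no_shortcuts: "shortcuts E u v L (\<lambda>i j. cyclic_dist (2 * L) i j - (k + 1)) = {}"
    and e: "real k \<le> e"
  shows "almost_geodesic_cycle (rel_graph {..<n} E) e (rel_graph {..<n} E \<restriction> T)"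
proof -
  have ind: "rel_graph {..<n} E \<restriction> T = rel_graph T A"
    by (simp add: induce_rel_graph induced_arcs)
  have "subgraph (rel_graph T A) (rel_graph {..<n} E)"
    using cycle_facts(4) A_subset C.H.wf_digraph G.H.wf_digraph
    by (auto simp: subgraph_def rel_graph_def)
  moreover have "graph_dist (rel_graph {..<n} E) x y \<ge> graph_dist (rel_graph T A) x y - ereal e"
    if x: "x \<in> T" and y: "y \<in> T" for x y
  proof (rule ccontr)
    let ?dG = "graph_dist (rel_graph {..<n} E)" and ?dC = "graph_dist (rel_graph T A)"
    assume "\<not> ?thesis"
    then have less: "?dG x y < ?dC x y - ereal e" by simp
    have dC: "\<exists>m. ?dC x y = ereal (real m)" if x: "x \<in> T" and y: "y \<in> T" for x y
    proof -
      obtain i j where "i < 2 * L" "j < 2 * L" "x = c ! i" "y = c ! j"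
        using cycle_facts x y by (metis in_set_conv_nth)
      then have "?dC x y < \<infinity>" using graph_dist_cyclic[of i j] by auto
      then show ?thesis using C.graph_dist_path by metis
    qed
    then obtain m where m: "?dC x y = ereal (real m)" using x y by blast
    then have "?dG x y < \<infinity>" using less by auto
    then obtain s ys where ys: "ys \<in> paths E x s" "last ys = y" "?dG x y = ereal (real s)"
      using G.graph_dist_path by metis
    have sm: "real s + e < real m" using less m ys(3) by auto
    note ne = paths_ne[OF ys(1)]
    have hd: "hd ys = x" and lens: "length ys = Suc s" and dist: "distinct ys" and ysE: "arcs_of ys \<subseteq> E"
      using ys(1) by (auto simp: paths_def)
    consider "arcs_of ys \<subseteq> A" | ys1 z ys2 where "ys = ys1 @ z # ys2" "ys1 \<noteq> []"
      "(last ys1, z) \<notin> A" "arcs_of (z # ys2) \<subseteq> A"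
      using last_outside_arc[OF sym_A ne] by blast
    then show False
    proof cases
      case 1
      then have "?dC x y \<le> ereal s" using C.graph_dist_le[OF ne] x hd ys(2) lens by simp
      then show False using sm m e by simp
    next
      case 2
      have lz: "last (z # ys2) = y" using 2(1) ys(2) by simp
      have zT: "z \<in> T"
      proof (cases ys2)
        case Nil
        then show ?thesis using lz y by simp
      next
        case (Cons b t)
        then show ?thesis using 2(4) A_subset(1) by auto
      qed
      have dzy: "?dC z y \<le> ereal (length ys2)"
        using C.graph_dist_le[of "z # ys2"] zT 2(4) lz by simp
      obtain i j where ij: "i < 2 * L" "j < 2 * L" "x = c ! i" "z = c ! j"
        using cycle_facts x zT by (metis in_set_conv_nth)
      define a where "a = length ys1 - 1"
      have len1: "length ys1 = Suc a" using 2(2) by (cases ys1) (auto simp: a_def)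
      then have s_eq: "s = a + 1 + length ys2" using lens 2(1) by simp
      obtain m' where m': "?dC x z = ereal (real m')" using dC x zT by blast
      \<comment> \<open>The tail behind \<open>z\<close> is at least as long as the cycle distance
        from \<open>z\<close> to \<open>y\<close>, so removing it from both sides preserves the
        saving.\<close>
      have "?dC x y \<le> ?dC x z + ?dC z y" by (rule C.graph_dist_triangle)
      also have "\<dots> \<le> ereal (real m') + ereal (length ys2)" unfolding m' by (rule add_left_mono[OF dzy])
      finally have "real m \<le> real m' + real (length ys2)" using m by simp
      then have "real a + 1 + e < real m'" using sm s_eq by simp
      moreover have "real m' \<le> real (cyclic_dist (2 * L) i j)"
        using graph_dist_cyclic[OF ij(1,2)] m' ij by simp
      ultimately have "real (a + (k + 1)) < real (cyclic_dist (2 * L) i j)" using e by simp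
      then have a_less: "a < cyclic_dist (2 * L) i j - (k + 1)" by linarith
      have "prefix ys1 ys" using 2(1) by (simp add: prefix_def)
      then have ys1: "ys1 \<in> paths E x a"
        using paths_prefix(1)[OF ys(1) _ 2(2)] len1 by simp
      have "(last ys1, z) \<in> arcs_of ys" using 2(1,2) arcs_of_append[of ys1 "z # ys2"] by auto
      then have "(last ys1, z) \<in> E" using ysE by blast
      moreover have "(last ys1, z) \<notin> arcs_of ys1" using dist 2(1) arcs_of_in_set[of "last ys1" z ys1] by auto
      ultimately have "((p, q), i, j, ys1) \<in> shortcuts E u v L (\<lambda>i j. cyclic_dist (2 * L) i j - (k + 1))"
        using pq ij a_less ys1 2(3) by (auto simp: shortcuts_def c_def A_def)
      then show False using no_shortcuts by simp
    qed
  qed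
  ultimately show ?thesis
    using is_cycle by (simp add: almost_geodesic_cycle_def ind) (simp add: rel_graph_def)
qed

end

lemma joined_by_almost_geodesic_cyclesI:
  assumes E: "E \<in> reg_rels n d" and uv: "u < n" "v < n" "u \<noteq> v" and L: "2 \<le> L" and d: "0 < d"
    and P: "card P = d" "P \<subseteq> {p \<in> paths E u L. last p = v}"
      "\<And>p q. p \<in> P \<Longrightarrow> q \<in> P \<Longrightarrow> p \<noteq> q \<Longrightarrow> set p \<inter> set q \<subseteq> {u, v}"
    and no_chords: "shortcuts E u v L (\<lambda>_ _. 1) = {}"
    and no_shortcuts: "shortcuts E u v L (\<lambda>i j. cyclic_dist (2 * L) i j - (k + 1)) = {}"
    and e: "real k \<le> e"
  shows "joined_by_almost_geodesic_cycles (rel_graph {..<n} E) d e u v"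
    and "graph_dist (rel_graph {..<n} E) u v \<le> ereal L"
proof -
  interpret G: finite_simple_rel "{..<n}" E
    by unfold_locales (use E in \<open>auto simp: reg_rels_def\<close>)
  define aw where "aw p = zip p (tl p)" for p :: "nat list"
  have p: "p \<noteq> []" "hd p = u" "last p = v" "distinct p" "arcs_of p \<subseteq> E" "length p = Suc L"
    if "p \<in> P" for p
    using that P(2) by (auto simp: paths_def)
  have aw: "pawalk_verts u (aw p) = p" "pcas u (aw p) v" "set (aw p) \<subseteq> E" if "p \<in> P" for p
    using p[OF that] pcas_zip[of p] set_zip_tl_subset[of p] by (auto simp: aw_def)
  have verts: "path_verts (rel_graph {..<n} E) u (aw p) = set p" if "p \<in> P" for p
    using aw[OF that] by (simp add: path_verts_def rel_graph_def)
  have inj: "inj_on aw P" by (rule inj_on_inverseI[where g = "pawalk_verts u"]) (rule aw)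
  have fin: "finite P" using P(1) d card.infinite by fastforce
  show "joined_by_almost_geodesic_cycles (rel_graph {..<n} E) d e u v"
    unfolding joined_by_almost_geodesic_cycles_def
  proof (intro exI[of _ "aw ` P"] conjI ballI impI)
    show "card (aw ` P) = d" using P(1) inj by (simp add: card_image)
    show "finite (aw ` P)" using fin by simp
  next
    fix w assume "w \<in> aw ` P"
    then show "pre_digraph.apath (rel_graph {..<n} E) u w v"
      using aw p uv by (auto simp: G.rel_graph_apath)
  next
    fix w w' assume "w \<in> aw ` P" "w' \<in> aw ` P" "w \<noteq> w'"
    then obtain p q where sel: "p \<in> P" "q \<in> P" "p \<noteq> q" "w = aw p" "w' = aw q" by auto
    interpret chordless_cycle_in_rel n E d u v L p q "cycle_list (p, q)" "arcs_of p \<union> arcs_of q" "set p \<union> set q"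
      using E uv L sel P no_chords by unfold_locales (auto simp: path_pairs_def uv_paths_def)
    have "almost_geodesic_cycle (rel_graph {..<n} E) e (rel_graph {..<n} E \<restriction> (set p \<union> set q))"
      by (rule almost_geodesic[OF no_shortcuts e])
    then show "almost_geodesic_cycle (rel_graph {..<n} E) e
      (rel_graph {..<n} E \<restriction> (path_verts (rel_graph {..<n} E) u w \<union> path_verts (rel_graph {..<n} E) u w'))"
      by (simp add: sel verts)
  qed
  obtain p where "p \<in> P" using P(1) d by (metis card.empty ex_in_conv less_not_refl)
  then show "graph_dist (rel_graph {..<n} E) u v \<le> ereal L"
    using G.graph_dist_le[of p] p uv by simp
qed

section \<open>The exceptional graphs\<close>

definition circulant :: "nat \<Rightarrow> nat set \<Rightarrow> (nat \<times> nat) set" where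
  "circulant n S = {(i, (i + s) mod n) |i s. i < n \<and> s \<in> S}"

lemma circulant_in_reg_rels:
  assumes S: "S \<subseteq> {0<..<n}" and sym: "\<And>s. s \<in> S \<Longrightarrow> n - s \<in> S"
  shows "circulant n S \<in> reg_rels n (card S)"
proof -
  have mod: "(i + s) mod n = (if i + s < n then i + s else i + s - n)" if "i < n" "s < n" for i s
    using that by (simp add: le_mod_geq)
  have "card (circulant n S `` {i}) = card S" if i: "i < n" for i
  proof -
    have "circulant n S `` {i} = (\<lambda>s. (i + s) mod n) ` S" using i by (auto simp: circulant_def)
    moreover have "inj_on (\<lambda>s. (i + s) mod n) S"
    proof (rule inj_onI)
      fix s t assume st: "s \<in> S" "t \<in> S" "(i + s) mod n = (i + t) mod n"
      then have "s < n" "t < n" using S by auto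
      then show "s = t" using st(3) i by (auto simp: mod split: if_splits)
    qed
    ultimately show ?thesis by (simp add: card_image)
  qed
  moreover have "sym (circulant n S)"
  proof (rule symI)
    fix i j assume "(i, j) \<in> circulant n S"
    then obtain s where s: "i < n" "s \<in> S" "j = (i + s) mod n" by (auto simp: circulant_def)
    then have s': "s < n" "0 < s" using S by auto
    then have "j < n" "(j + (n - s)) mod n = i" using s by (auto simp: mod)
    then show "(j, i) \<in> circulant n S" using sym[OF s(2)] by (force simp: circulant_def)
  qed
  moreover have "irrefl (circulant n S)"
  proof (rule irreflI)
    fix i show "(i, i) \<notin> circulant n S"
    proof
      assume "(i, i) \<in> circulant n S"
      then obtain s where s: "i < n" "s \<in> S" "i = (i + s) mod n" by (auto simp: circulant_def)
      then have "s < n" "0 < s" using S by auto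
      then show False using s(1,3) by (auto simp: mod split: if_splits)
    qed
  qed
  moreover have "circulant n S \<subseteq> {..<n} \<times> {..<n}" by (auto simp: circulant_def)
  ultimately show ?thesis by (simp add: reg_rels_def)
qed

text \<open>Each vertex is joined to its nearest \<open>d div 2\<close> vertices on either side of a
  circle and, for odd \<open>d\<close>, also to the antipodal one, which exists because
  \<open>n\<close> is even. Without this lemma \<open>pmf_of_set\<close> would be
  unspecified.\<close>

lemma reg_rels_nonempty:
  assumes "d < n" "odd d \<longrightarrow> even n"
  shows "reg_rels n d \<noteq> {}"
proof -
  define h where "h = d div 2"
  define S where "S = {1..h} \<union> {n - h..n - 1} \<union> (if odd d then {n div 2} else {})"
  have h: "2 * h \<le> d" "odd d \<Longrightarrow> d = 2 * h + 1" "even d \<Longrightarrow> d = 2 * h" by (auto simp: h_def)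
  have 1: "S \<subseteq> {0<..<n}" using assms h by (auto simp: S_def split: if_splits)
  have 2: "n - s \<in> S" if "s \<in> S" for s
  proof -
    have "n - n div 2 = n div 2" if "even n" using that by auto
    then show ?thesis using that assms h by (auto simp: S_def split: if_splits)
  qed
  have "{1..h} \<inter> {n - h..n - 1} = {}" using assms h by auto
  then have "card ({1..h} \<union> {n - h..n - 1}) = 2 * h"
    using assms h by (subst card_Un_disjoint) auto
  moreover have "n div 2 \<notin> {1..h} \<union> {n - h..n - 1}" if "odd d"
    using assms h that by auto
  ultimately have "card S = d" using h by (cases "odd d") (auto simp: S_def)
  then show ?thesis using circulant_in_reg_rels[OF 1 2] by auto
qed

section \<open>Union bound over the exceptional graphs\<close>

text \<open>In order: a branch at \<open>u\<close> or at \<open>v\<close> with few leaves, two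
  unlinked branches, a chord, a shortcut that saves more than \<open>k\<close>. The third set is
  restricted to branches with many leaves, as the number of switchings in
  \<open>unlinked_count\<close> depends on them.\<close>

definition bad_rels :: "nat \<Rightarrow> nat \<Rightarrow> nat \<Rightarrow> nat \<Rightarrow> nat \<Rightarrow> nat \<Rightarrow> (nat \<times> nat) set set" where
  "bad_rels n d r k u v = (let L = 2 * r + 1; M = (d - 1) ^ (r - 1) div 2 in
     {E \<in> reg_rels n d. \<exists>x. (u, x) \<in> E \<and> 2 * card (leaves E u v r x) < (d - 1) ^ (r - 1)} \<union>
     {E \<in> reg_rels n d. \<exists>x. (v, x) \<in> E \<and> 2 * card (leaves E v u r x) < (d - 1) ^ (r - 1)} \<union>
     {E \<in> reg_rels n d. \<exists>x y. (u, x) \<in> E \<and> (v, y) \<in> E \<and>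
        M \<le> card (leaves E u v r x) \<and> M \<le> card (leaves E v u r y) \<and>
        E \<inter> leaves E u v r x \<times> leaves E v u r y = {}} \<union>
     {E \<in> reg_rels n d. shortcuts E u v L (\<lambda>_ _. 1) \<noteq> {}} \<union>
     {E \<in> reg_rels n d. shortcuts E u v L (\<lambda>i j. cyclic_dist (2 * L) i j - (k + 1)) \<noteq> {}})"

lemma not_bad_rel:
  assumes d: "3 \<le> d" and uv: "u < n" "v < n" "u \<noteq> v" and r: "0 < r"
    and E: "E \<in> reg_rels n d - bad_rels n d r k u v" and e: "real k \<le> e"
  shows "joined_by_almost_geodesic_cycles (rel_graph {..<n} E) d e u v"
    and "graph_dist (rel_graph {..<n} E) u v \<le> ereal (2 * r + 1)"
proof -
  have ER: "E \<in> reg_rels n d" using E by simp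
  have "E \<inter> leaves E u v r x \<times> leaves E v u r y \<noteq> {}" if xy: "(u, x) \<in> E" "(v, y) \<in> E" for x y
  proof -
    have "\<not> 2 * card (leaves E u v r x) < (d - 1) ^ (r - 1)" "\<not> 2 * card (leaves E v u r y) < (d - 1) ^ (r - 1)"
      using E xy by (auto simp: bad_rels_def Let_def)
    then have "(d - 1) ^ (r - 1) div 2 \<le> card (leaves E u v r x)" "(d - 1) ^ (r - 1) div 2 \<le> card (leaves E v u r y)"
      by linarith+
    then show ?thesis using E xy by (auto simp: bad_rels_def Let_def)
  qed
  note linked = this
  have "0 < d" using d by simp
  have "\<exists>P. card P = d \<and> P \<subseteq> {p \<in> paths E u (2 * r + 1). last p = v} \<and>
    (\<forall>p\<in>P. \<forall>q\<in>P. p \<noteq> q \<longrightarrow> set p \<inter> set q \<subseteq> {u, v})"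
    by (rule linked_paths[OF \<open>0 < d\<close> uv ER r linked])
  then obtain P where P0: "card P = d" "P \<subseteq> {p \<in> paths E u (2 * r + 1). last p = v}"
    "\<forall>p\<in>P. \<forall>q\<in>P. p \<noteq> q \<longrightarrow> set p \<inter> set q \<subseteq> {u, v}"
    by (elim exE conjE)
  have P: "card P = d" "P \<subseteq> {p \<in> paths E u (2 * r + 1). last p = v}"
    "\<And>p q. p \<in> P \<Longrightarrow> q \<in> P \<Longrightarrow> p \<noteq> q \<Longrightarrow> set p \<inter> set q \<subseteq> {u, v}"
    using P0(1,2) P0(3)[rule_format] .
  have sc: "shortcuts E u v (2 * r + 1) (\<lambda>_ _. 1) = {}"
    "shortcuts E u v (2 * r + 1) (\<lambda>i j. cyclic_dist (2 * (2 * r + 1)) i j - (k + 1)) = {}"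
    using E by (auto simp: bad_rels_def Let_def)
  have "2 \<le> 2 * r + 1" "0 < d" using r d by auto
  from joined_by_almost_geodesic_cyclesI[OF ER uv this P sc e]
  show "joined_by_almost_geodesic_cycles (rel_graph {..<n} E) d e u v"
    "graph_dist (rel_graph {..<n} E) u v \<le> ereal (2 * r + 1)" by simp_all
qed

lemma card_nonempty_le_sum:
  assumes "finite R" "\<And>E. E \<in> R \<Longrightarrow> finite (f E)"
  shows "card {E \<in> R. f E \<noteq> {}} \<le> (\<Sum>E\<in>R. card (f E))"
proof -
  have "{E \<in> R. f E \<noteq> {}} \<subseteq> {E \<in> R. 1 \<le> card (f E)}"
    using assms(2) by (auto simp: Suc_le_eq card_gt_0_iff)
  then have "card {E \<in> R. f E \<noteq> {}} \<le> card {E \<in> R. 1 \<le> card (f E)}"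
    using assms(1) by (intro card_mono) auto
  then show ?thesis using markov_count[OF assms(1), of 1 "\<lambda>E. card (f E)"] by simp
qed

lemma le_divide_of_nat:
  assumes "a * x \<le> c * (R :: nat)" "0 < a"
  shows "real x \<le> real c / real a * real R"
proof -
  have "real a * real x \<le> real c * real R" using assms(1) by (metis of_nat_mult of_nat_mono)
  then show ?thesis using assms(2) by (simp add: field_simps)
qed

lemma card_bad_rels:
  assumes d: "3 \<le> d" and uv: "u < n" "v < n" "u \<noteq> v" and r: "0 < r"
    and n: "2 * (6 * (2 * r + 1) + 4 + 2 * ((d + 1) * d)) \<le> n * d"
    and M: "M = (d - 1) ^ (r - 1) div 2" "(d + 1) * d < M" and L: "L = 2 * r + 1"
  shows "real (card (bad_rels n d r k u v)) \<le>
    (2 * (real (40 * d * (r + 1) * (d - 1) ^ (r + 1)) / real n)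
     + real (d\<^sup>2 * (2 * (n * d))) / real (M * (M - (d + 1) * d))
     + real (2 * d * ((2 * L)\<^sup>2 * (2 * (d - 1))) * (4 * d * (d - 1) ^ (L - 1))\<^sup>2) / real (n ^ 3)
     + real (2 * d * (16 * L * (d - 1) ^ (L + 1)) * (4 * d * (d - 1) ^ (L - 1))\<^sup>2) / real (n ^ 3 * (d - 1) ^ k))
    * real (card (reg_rels n d))"
proof -
  let ?R = "card (reg_rels n d)"
  let ?B1 = "\<lambda>u v. {E \<in> reg_rels n d. \<exists>x. (u, x) \<in> E \<and> 2 * card (leaves E u v r x) < (d - 1) ^ (r - 1)}"
  let ?B2 = "{E \<in> reg_rels n d. \<exists>x y. (u, x) \<in> E \<and> (v, y) \<in> E \<and>
        M \<le> card (leaves E u v r x) \<and> M \<le> card (leaves E v u r y) \<and>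
        E \<inter> leaves E u v r x \<times> leaves E v u r y = {}}"
  let ?B3 = "{E \<in> reg_rels n d. shortcuts E u v L (\<lambda>_ _. 1) \<noteq> {}}"
  let ?B4 = "{E \<in> reg_rels n d. shortcuts E u v L (\<lambda>i j. cyclic_dist (2 * L) i j - (k + 1)) \<noteq> {}}"
  have n0: "0 < n" and L2: "2 \<le> L" using uv r L by auto
  have n1: "2 * (4 * Suc r + 2 * ((d + 1) * d)) \<le> n * d" using n by simp
  have n2: "2 * (6 * L + 4 + 2 * ((d + 1) * d)) \<le> n * d" using n L by simp
  have B1: "real (card (?B1 u v)) \<le> real (40 * d * (r + 1) * (d - 1) ^ (r + 1)) / real n * ?R"
    by (rule le_divide_of_nat[OF few_leaves_count[OF d uv r n1] n0])
  have B1': "real (card (?B1 v u)) \<le> real (40 * d * (r + 1) * (d - 1) ^ (r + 1)) / real n * ?R"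
    by (rule le_divide_of_nat[OF few_leaves_count[OF d uv(2,1) uv(3)[symmetric] r n1] n0])
  have B2: "real (card ?B2) \<le> real (d\<^sup>2 * (2 * (n * d))) / real (M * (M - (d + 1) * d)) * ?R"
    using unlinked_count[of d u n v r M] d uv r M(2)
    by (intro le_divide_of_nat) (simp_all add: mult_ac)
  have "n ^ 3 * card ?B3 \<le> n ^ 3 * (\<Sum>E\<in>reg_rels n d. card (shortcuts E u v L (\<lambda>_ _. 1)))"
    by (intro mult_le_mono2 card_nonempty_le_sum finite_shortcuts[OF d uv L2 n2]) auto
  also note sum_card_chords[OF d uv L2 n2]
  finally have B3: "real (card ?B3) \<le> real (2 * d * ((2 * L)\<^sup>2 * (2 * (d - 1))) * (4 * d * (d - 1) ^ (L - 1))\<^sup>2) / real (n ^ 3) * ?R"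
    using n0 by (intro le_divide_of_nat) (simp_all only: mult.assoc zero_less_power)
  have "n ^ 3 * card ?B4 * (d - 1) ^ k \<le> n ^ 3 * (\<Sum>E\<in>reg_rels n d.
      card (shortcuts E u v L (\<lambda>i j. cyclic_dist (2 * L) i j - (k + 1)))) * (d - 1) ^ k"
    by (intro mult_le_mono1 mult_le_mono2 card_nonempty_le_sum finite_shortcuts[OF d uv L2 n2]) auto
  also note sum_card_distant_shortcuts[OF d uv L2 n2]
  finally have "(n ^ 3 * (d - 1) ^ k) * card ?B4 \<le>
    2 * d * (16 * L * (d - 1) ^ (L + 1)) * (4 * d * (d - 1) ^ (L - 1))\<^sup>2 * ?R"
    by (simp only: mult_ac)
  then have B4: "real (card ?B4) \<le> real (2 * d * (16 * L * (d - 1) ^ (L + 1)) * (4 * d * (d - 1) ^ (L - 1))\<^sup>2)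
      / real (n ^ 3 * (d - 1) ^ k) * ?R"
    using n0 d by (intro le_divide_of_nat) simp_all
  have "bad_rels n d r k u v = ?B1 u v \<union> ?B1 v u \<union> ?B2 \<union> ?B3 \<union> ?B4"
    by (simp add: bad_rels_def Let_def L M(1))
  then have "card (bad_rels n d r k u v) \<le> card (?B1 u v) + card (?B1 v u) + card ?B2 + card ?B3 + card ?B4"
    by (simp only:) (intro order_trans[OF card_Un_le] add_mono order.refl)
  then have "real (card (bad_rels n d r k u v)) \<le>
      real (card (?B1 u v)) + real (card (?B1 v u)) + real (card ?B2) + real (card ?B3) + real (card ?B4)"
    by linarith
  moreover have "x1 + x2 + x3 + x4 + x5 \<le> (2 * a + b + c + e) * R"
    if "x1 \<le> a * R" "x2 \<le> a * R" "x3 \<le> b * R" "x4 \<le> c * R" "x5 \<le> e * R" for x1 x2 x3 x4 x5 a b c e R :: real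
    using that by (simp add: distrib_right)
  from this[OF B1 B1' B2 B3 B4] show ?thesis by (rule order_trans[rotated]) (rule calculation)
qed

lemma card_ball:
  assumes d: "3 \<le> d" and u: "u < n" and E: "E \<in> reg_rels n d"
  shows "card {v. v < n \<and> graph_dist (rel_graph {..<n} E) u v \<le> ereal t} \<le> 2 * (d - 1) ^ Suc (nat \<lfloor>t\<rfloor>)"
proof -
  interpret G: finite_simple_rel "{..<n}" E
    by unfold_locales (use E in \<open>auto simp: reg_rels_def\<close>)
  let ?P = "\<Union>l<Suc (nat \<lfloor>t\<rfloor>). paths E u l"
  have "{v. v < n \<and> graph_dist (rel_graph {..<n} E) u v \<le> ereal t} \<subseteq> last ` ?P"
  proof clarify
    fix v assume v: "graph_dist (rel_graph {..<n} E) u v \<le> ereal t"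
    then have "graph_dist (rel_graph {..<n} E) u v < \<infinity>" by auto
    then obtain l p where p: "p \<in> paths E u l" "last p = v"
      "graph_dist (rel_graph {..<n} E) u v = ereal (real l)" using G.graph_dist_path by metis
    then have "real l \<le> t" using v by simp
    then have "l < Suc (nat \<lfloor>t\<rfloor>)" by linarith
    then show "v \<in> last ` ?P" using p by blast
  qed
  moreover have "finite ?P" using finite_paths[OF E u] by blast
  ultimately have "card {v. v < n \<and> graph_dist (rel_graph {..<n} E) u v \<le> ereal t} \<le> card ?P"
    by (meson surj_card_le)
  also have "\<dots> \<le> 2 * (d - 1) ^ Suc (nat \<lfloor>t\<rfloor>)" by (rule card_short_paths[OF E u d])
  finally show ?thesis .
qed

section \<open>From relations to the probability space\<close>

lemma regular_graphs_eq: "regular_graphs n d = (\<lambda>E. \<lparr>pverts = {..<n}, parcs = E\<rparr>) ` reg_rels n d"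
proof -
  have deg: "out_degree (with_proj G) v = card (parcs G `` {v})" for G :: "nat pair_pre_digraph" and v
  proof -
    have "out_arcs (with_proj G) v = Pair v ` (parcs G `` {v})" by (auto simp: out_arcs_def)
    then show ?thesis by (simp add: out_degree_def card_image inj_on_def)
  qed
  show ?thesis
  proof (intro equalityI subsetI)
    fix G assume G: "G \<in> regular_graphs n d"
    then interpret pair_graph G by (simp add: regular_graphs_def)
    have "irrefl (parcs G)" unfolding irrefl_def using no_loops' by blast
    then have "parcs G \<in> reg_rels n d"
      using G wellformed' sym_arcs
      by (auto simp: regular_graphs_def reg_rels_def deg symmetric_def)
    moreover have "G = \<lparr>pverts = {..<n}, parcs = parcs G\<rparr>" using G by (simp add: regular_graphs_def)
    ultimately show "G \<in> (\<lambda>E. \<lparr>pverts = {..<n}, parcs = E\<rparr>) ` reg_rels n d" by blast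
  next
    fix G assume "G \<in> (\<lambda>E. \<lparr>pverts = {..<n}, parcs = E\<rparr>) ` reg_rels n d"
    then obtain E where E: "E \<in> reg_rels n d" and G: "G = \<lparr>pverts = {..<n}, parcs = E\<rparr>" by auto
    interpret G: finite_simple_rel "{..<n}" E
      by unfold_locales (use E in \<open>auto simp: reg_rels_def\<close>)
    show "G \<in> regular_graphs n d"
      using G.H.pair_graph E by (auto simp: regular_graphs_def deg G reg_rels_def)
  qed
qed

lemma pair_pmf_of_set:
  fixes A :: "'a set" and B :: "'b set"
  assumes "finite A" "A \<noteq> {}" "finite B" "B \<noteq> {}"
  shows "pair_pmf (pmf_of_set A) (pmf_of_set B) = pmf_of_set (A \<times> B)"
proof (rule pmf_eqI)
  fix x :: "'a \<times> 'b"
  obtain a b where x: "x = (a, b)" by fastforce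
  have "A \<times> B \<noteq> {}" "finite (A \<times> B)" using assms by auto
  then show "pmf (pair_pmf (pmf_of_set A) (pmf_of_set B)) x = pmf (pmf_of_set (A \<times> B)) x"
    using assms by (simp add: x pmf_pair pmf_of_set indicator_def card_cartesian_product)
qed

text \<open>Two sources of randomness are separated. That \<open>v\<close> is near \<open>u\<close>
  is unlikely for every graph and every \<open>u\<close>, by the choice of \<open>v\<close> alone.
  All other failures are unlikely for every fixed pair \<open>u \<noteq> v\<close>, by the choice of
  the graph. As \<open>near\<close> is reflexive, the case \<open>u = v\<close> is charged to the
  first kind.\<close>

lemma prob_random_graph_and_vertices:
  fixes D \<epsilon> :: real
  assumes R: "reg_rels n d \<noteq> {}" and n: "0 < n"
    and near: "\<And>E u. E \<in> reg_rels n d \<Longrightarrow> u < n \<Longrightarrow> real (card {v. v < n \<and> near E u v}) \<le> D"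
    and bad: "\<And>u v. u < n \<Longrightarrow> v < n \<Longrightarrow> u \<noteq> v \<Longrightarrow> real (card (bad u v)) \<le> \<epsilon> * real (card (reg_rels n d))"
    and bad_sub: "\<And>u v. bad u v \<subseteq> reg_rels n d"
    and S: "\<And>E u v. E \<in> reg_rels n d \<Longrightarrow> u < n \<Longrightarrow> v < n \<Longrightarrow> \<not> near E u v \<Longrightarrow> E \<notin> bad u v \<Longrightarrow>
      u \<noteq> v \<Longrightarrow> (\<lparr>pverts = {..<n}, parcs = E\<rparr>, u, v) \<in> S" and \<epsilon>: "0 \<le> \<epsilon>"
    and near_refl: "\<And>E u. E \<in> reg_rels n d \<Longrightarrow> u < n \<Longrightarrow> near E u u"
  shows "measure_pmf.prob (random_graph_and_vertices n d) S \<ge> 1 - D / real n - \<epsilon>"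
proof -
  let ?R = "reg_rels n d" and ?V = "{..<n}"
  let ?f = "\<lambda>E :: (nat \<times> nat) set. \<lparr>pverts = {..<n}, parcs = E\<rparr>"
  let ?\<Omega> = "?R \<times> ?V \<times> ?V" and ?g = "\<lambda>(E, u, v). (?f E, u :: nat, v :: nat)"
  have inj: "inj ?g" by (auto simp: inj_def)
  have cR: "0 < card ?R" using R by (simp add: card_gt_0_iff)
  have fin: "finite (?g ` ?\<Omega>)" and ne: "?g ` ?\<Omega> \<noteq> {}" using R n by auto
  have "random_graph_and_vertices n d = pmf_of_set (regular_graphs n d \<times> ?V \<times> ?V)"
  proof -
    have V: "finite ?V" "?V \<noteq> {}" "finite (?V \<times> ?V)" "?V \<times> ?V \<noteq> {}" using n by auto
    have G: "finite (regular_graphs n d)" "regular_graphs n d \<noteq> {}"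
      using R by (auto simp: regular_graphs_eq)
    show ?thesis
      unfolding random_graph_and_vertices_def random_regular_graph_def
        pair_pmf_of_set[OF V(1,2) V(1,2)] by (rule pair_pmf_of_set[OF G V(3,4)])
  qed
  also have "regular_graphs n d \<times> ?V \<times> ?V = ?g ` ?\<Omega>"
    by (auto simp: regular_graphs_eq image_iff)
  finally have prob: "measure_pmf.prob (random_graph_and_vertices n d) S = card (?g ` ?\<Omega> \<inter> S) / card (?g ` ?\<Omega>)"
    by (simp only: measure_pmf_of_set[OF ne fin])
  have c\<Omega>: "card (?g ` ?\<Omega>) = card ?R * (n * n)"
    using inj by (simp add: card_image inj_on_subset card_cartesian_product)
  define X0 where "X0 = (SIGMA E:?R. SIGMA u:?V. {v. v < n \<and> near E u v})"
  define X1 where "X1 = (SIGMA u:?V. SIGMA v:?V - {u}. bad u v)"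
  have fbad: "finite (bad u v)" for u v using bad_sub by (rule finite_subset) simp
  have "?\<Omega> \<subseteq> {w \<in> ?\<Omega>. ?g w \<in> S} \<union> X0 \<union> (\<lambda>(u, v, E). (E, u, v)) ` X1"
  proof
    fix w assume w: "w \<in> ?\<Omega>"
    obtain E u v where weq: "w = (E, u, v)" by (metis surj_pair)
    consider "near E u v" | "\<not> near E u v" "E \<in> bad u v" | "\<not> near E u v" "E \<notin> bad u v" by blast
    then show "w \<in> {w \<in> ?\<Omega>. ?g w \<in> S} \<union> X0 \<union> (\<lambda>(u, v, E). (E, u, v)) ` X1"
    proof cases
      case 1
      then show ?thesis using w by (simp add: X0_def weq)
    next
      case 2
      then have "(u, v, E) \<in> X1" using w near_refl by (auto simp: X1_def weq)
      then have "w \<in> (\<lambda>(u, v, E). (E, u, v)) ` X1" unfolding weq by force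
      then show ?thesis by blast
    next
      case 3
      moreover have "u \<noteq> v" using 3 near_refl w by (auto simp: weq)
      ultimately show ?thesis using S[of E u v] w by (simp add: weq)
    qed
  qed
  then have "card ?\<Omega> \<le> card ({w \<in> ?\<Omega>. ?g w \<in> S} \<union> X0 \<union> (\<lambda>(u, v, E). (E, u, v)) ` X1)"
    by (intro card_mono) (auto simp: X0_def X1_def fbad intro!: finite_SigmaI)
  also have "\<dots> \<le> card {w \<in> ?\<Omega>. ?g w \<in> S} + card X0 + card ((\<lambda>(u, v, E). (E, u, v)) ` X1)"
    by (intro order_trans[OF card_Un_le] add_mono order.refl)
  also have "\<dots> \<le> card {w \<in> ?\<Omega>. ?g w \<in> S} + card X0 + card X1"
    by (intro add_mono order.refl card_image_le) (auto simp: X1_def fbad intro!: finite_SigmaI)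
  finally have "real (card ?\<Omega>) \<le> real (card {w \<in> ?\<Omega>. ?g w \<in> S}) + real (card X0) + real (card X1)"
    by linarith
  moreover have "real (card X0) \<le> card ?R * (n * D)"
  proof -
    have "card X0 = (\<Sum>E\<in>?R. \<Sum>u<n. card {v. v < n \<and> near E u v})"
    proof -
      have "card X0 = (\<Sum>E\<in>?R. card (SIGMA u:?V. {v. v < n \<and> near E u v}))"
        unfolding X0_def by (intro card_SigmaI) auto
      also have "\<dots> = (\<Sum>E\<in>?R. \<Sum>u<n. card {v. v < n \<and> near E u v})"
        by (intro sum.cong refl card_SigmaI) auto
      finally show ?thesis .
    qed
    then have "real (card X0) = (\<Sum>E\<in>?R. \<Sum>u<n. real (card {v. v < n \<and> near E u v}))" by simp
    also have "\<dots> \<le> (\<Sum>E\<in>?R. \<Sum>u<n. D)" by (intro sum_mono near) auto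
    finally show ?thesis by simp
  qed
  moreover have "real (card X1) \<le> n * (n * (\<epsilon> * card ?R))"
  proof -
    have "card X1 = (\<Sum>u<n. card (SIGMA v:?V - {u}. bad u v))"
      unfolding X1_def using fbad by (intro card_SigmaI) auto
    also have "\<dots> = (\<Sum>u<n. \<Sum>v\<in>?V - {u}. card (bad u v))"
      using fbad by (intro sum.cong refl card_SigmaI) auto
    finally have "real (card X1) = (\<Sum>u<n. \<Sum>v\<in>?V - {u}. real (card (bad u v)))" by simp
    also have "\<dots> \<le> (\<Sum>u<n. \<Sum>v\<in>?V - {u}. \<epsilon> * card ?R)" by (intro sum_mono bad) auto
    also have "\<dots> \<le> (\<Sum>u<n. \<Sum>v\<in>?V. \<epsilon> * card ?R)"
      using \<epsilon> by (intro sum_mono sum_mono2) auto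
    finally show ?thesis by simp
  qed
  moreover have "card {w \<in> ?\<Omega>. ?g w \<in> S} = card (?g ` ?\<Omega> \<inter> S)"
  proof -
    have "?g ` ?\<Omega> \<inter> S = ?g ` {w \<in> ?\<Omega>. ?g w \<in> S}" by auto
    then show ?thesis using inj by (simp add: card_image inj_on_subset)
  qed
  moreover have "card ?\<Omega> = card ?R * (n * n)" by (simp add: card_cartesian_product)
  ultimately have "real (card ?R) * (real n * real n) \<le>
      real (card (?g ` ?\<Omega> \<inter> S)) + real (card ?R) * (real n * D) + real n * (real n * (\<epsilon> * real (card ?R)))"
    by simp
  moreover have "(1 - D / real n - \<epsilon>) * (real (card ?R) * (real n * real n)) = real (card ?R) * (real n * real n)
      - real (card ?R) * (real n * D) - real n * (real n * (\<epsilon> * real (card ?R)))"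
    using n by (simp add: field_simps)
  ultimately have "(1 - D / real n - \<epsilon>) * (real (card ?R) * (real n * real n)) \<le> real (card (?g ` ?\<Omega> \<inter> S))"
    by linarith
  then show ?thesis unfolding prob c\<Omega> using cR n by (subst pos_le_divide_eq) simp_all
qed

section \<open>Asymptotics\<close>

lemma tendsto_pow_powr_neg:
  fixes b c :: real
  assumes "1 < b" "0 < c"
  shows "((\<lambda>x. x ^ k * b powr (- c * x)) \<longlongrightarrow> 0) at_top"
proof -
  define a where "a = c * ln b"
  have "a > 0" using assms by (simp add: a_def)
  then have "((\<lambda>x. x ^ k * exp (- a * x)) \<longlongrightarrow> 0) at_top" by real_asymp
  moreover have "b powr (- c * x) = exp (- a * x)" for x using assms by (simp add: powr_def a_def mult_ac)
  ultimately show ?thesis by simp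
qed

section \<open>Choice of the parameters and error terms\<close>

context
  fixes d :: nat and b :: real
  assumes d: "3 \<le> d" and b: "b = real d - 1"
begin

lemma b_ge: "2 \<le> b" and b_nat: "real (d - 1) = b"
  using d by (simp_all add: b)

lemma b_powr_mono: "x \<le> y \<Longrightarrow> b powr x \<le> b powr y"
  using b_ge by (intro powr_mono) auto

lemma b_pow_le: "real m \<le> x \<Longrightarrow> b ^ m \<le> b powr x"
  using b_powr_mono[of "real m" x] b_ge by (simp add: powr_realpow)

lemma b_pow_ge: "x \<le> real m \<Longrightarrow> b powr x \<le> b ^ m"
  using b_powr_mono[of x "real m"] b_ge by (simp add: powr_realpow)

text \<open>The summands are \<open>few_leaves_error\<close> (doubled for \<open>u\<close> and
  \<open>v\<close>), \<open>unlinked_error\<close>, \<open>chord_error\<close> and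
  \<open>shortcut_error\<close>. The extra depth \<open>\<psi> / 8\<close> makes unlinked branches
  rare by \<open>b powr (- (1/8) * \<psi>)\<close>. It also enlarges the three closed paths of a
  cycle with shortcut by \<open>b powr (\<psi> / 8)\<close> each, against a gain of
  \<open>b powr \<psi>\<close> from the saved length; hence the exponent 3/8 - 1 = -5/8. Any share
  of \<open>\<psi>\<close> below one third would serve in place of 1/8.\<close>

definition error_bound :: "real \<Rightarrow> real \<Rightarrow> real" where
  "error_bound l \<psi> = 160 * d * b ^ 2 * (l ^ 2 * b powr (- (1/2) * l)) + 32 * d ^ 3 * b ^ 2 * b powr (- (1/8) * \<psi>)
    + 2304 * d ^ 3 * b ^ 5 * (l ^ 3 * b powr (- 1 * l)) + 1536 * d ^ 3 * b ^ 9 * b powr (- (5/8) * \<psi>)"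

lemma error_bound_tendsto:
  assumes "filterlim l at_top F" "filterlim \<psi> at_top F"
  shows "((\<lambda>x. 2 * b * b powr (- 1 * \<psi> x) + error_bound (l x) (\<psi> x)) \<longlongrightarrow> 0) F"
proof -
  have 1: "((\<lambda>x. l x ^ k * b powr (- c * l x)) \<longlongrightarrow> 0) F" if "0 < c" for k c
    using filterlim_compose[OF tendsto_pow_powr_neg[of b c k] assms(1)] b_ge that by simp
  have 2: "((\<lambda>x. b powr (- c * \<psi> x)) \<longlongrightarrow> 0) F" if "0 < c" for c
    using filterlim_compose[OF tendsto_pow_powr_neg[of b c 0] assms(2)] b_ge that by simp
  show ?thesis unfolding error_bound_def
    by (rule tendsto_eq_intros 1 2 refl | simp)+
qed

context
  fixes n r k L M :: nat and \<psi> l :: real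
  assumes n: "0 < n" and l: "l = log b n" and \<psi>: "8 \<le> \<psi>" "\<psi> \<le> log b l" and l8: "8 \<le> l"
    and r: "r = nat \<lceil>(l + \<psi> / 8) / 2\<rceil>" and k: "k = nat \<lfloor>log b l + \<psi>\<rfloor>" and L: "L = 2 * r + 1"
    and M: "M = (d - 1) ^ (r - 1) div 2"
    and n_large: "36 * l + 8 + 4 * (d + 1) * d \<le> n"
    and l_large: "4 * ((d + 1) * d + 1) \<le> b powr (l / 2 - 1)"
begin

lemma n_eq: "real n = b powr l"
  using n b_ge by (simp add: l)

text \<open>This is what slow growth of \<open>\<psi>\<close> buys: powers of \<open>b\<close> with
  exponent \<open>\<psi>\<close> cost no more than a factor \<open>l\<close>, which a negative power
  of \<open>n\<close> outweighs.\<close>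

lemma powr_\<psi>_le: "b powr \<psi> \<le> l"
proof -
  have "b powr \<psi> \<le> b powr log b l" by (rule b_powr_mono[OF \<psi>(2)])
  then show ?thesis using b_ge l8 by simp
qed

text \<open>Since \<open>ln b\<close> is at least 1/2, \<open>b powr (\<psi> / 2)\<close> is at
  least \<open>1 + \<psi> / 4\<close>. Its square is at most \<open>l\<close> and at least
  \<open>\<psi>\<close>.\<close>

lemma \<psi>_le_l: "\<psi> \<le> l"
proof -
  have "1 + \<psi> * ln b \<le> exp (\<psi> * ln b)" by (rule exp_ge_add_one_self)
  then have "1 + \<psi> * ln b \<le> b powr \<psi>" using b_ge by (simp add: powr_def)
  moreover have "1/2 \<le> ln b"
    using ln_ge_iff[of b "1/2"] exp_bound[of "1/2 :: real"] b_ge by (simp add: power2_eq_square)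
  then have "\<psi> * (1/2) \<le> \<psi> * ln b" using \<psi> by (intro mult_left_mono) auto
  moreover have "b powr (\<psi> / 2) * b powr (\<psi> / 2) = b powr \<psi>" by (simp add: powr_add[symmetric])
  moreover have "2 \<le> b powr (\<psi> / 2)" using b_powr_mono[of 1 "\<psi> / 2"] \<psi> b_ge by simp
  moreover have "1 + \<psi> / 2 * ln b \<le> b powr (\<psi> / 2)"
    using exp_ge_add_one_self[of "\<psi> / 2 * ln b"] b_ge by (simp add: powr_def)
  ultimately have "1 + \<psi> / 4 \<le> b powr (\<psi> / 2)" by simp
  then have "2 * (1 + \<psi> / 4) \<le> b powr (\<psi> / 2) * b powr (\<psi> / 2)"
    using \<open>2 \<le> b powr (\<psi> / 2)\<close> \<psi> by (intro mult_mono) auto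
  moreover have "(1 + \<psi> / 4) * (1 + \<psi> / 4) \<le> b powr (\<psi> / 2) * b powr (\<psi> / 2)"
    using \<open>1 + \<psi> / 4 \<le> b powr (\<psi> / 2)\<close> \<psi> by (intro mult_mono) auto
  moreover have "\<psi> \<le> (1 + \<psi> / 4) * (1 + \<psi> / 4)"
    using zero_le_square[of "1 - \<psi> / 4"] by (simp add: algebra_simps)
  ultimately show ?thesis using powr_\<psi>_le \<open>b powr (\<psi> / 2) * b powr (\<psi> / 2) = b powr \<psi>\<close> by linarith
qed

lemma n_cube: "real (n ^ 3) = b powr (3 * l)"
proof -
  have "b powr (3 * l) = b powr l * b powr l * b powr l" by (simp add: powr_add[symmetric])
  moreover have "real (n ^ 3) = real n * real n * real n" by (simp add: power3_eq_cube)
  ultimately show ?thesis by (simp only: n_eq)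
qed

lemma r_bounds: "l + \<psi> / 8 \<le> 2 * real r" "2 * real r \<le> l + \<psi> / 8 + 2"
proof -
  define x where "x = (l + \<psi> / 8) / 2"
  have "0 \<le> x" using \<psi> l8 by (simp add: x_def)
  then have "x \<le> real r" "real r \<le> x + 1" unfolding r x_def[symmetric] by linarith+
  moreover have "2 * x = l + \<psi> / 8" by (simp add: x_def)
  ultimately show "l + \<psi> / 8 \<le> 2 * real r" "2 * real r \<le> l + \<psi> / 8 + 2" by linarith+
qed

lemma r_pos: "0 < r"
proof (rule ccontr)
  assume "\<not> 0 < r"
  then have "real r = 0" by simp
  then show False using r_bounds(1) \<psi>(1) l8 by linarith
qed

lemma r_pred: "real (r - 1) = real r - 1"
  using r_pos by (simp add: of_nat_diff)

lemma L_bound: "real L \<le> l + \<psi> / 8 + 3" "real L \<le> 3 * l"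
proof -
  have "real L = 2 * real r + 1" by (simp add: L)
  then show "real L \<le> l + \<psi> / 8 + 3" "real L \<le> 3 * l" using r_bounds(2) \<psi>_le_l l8 by linarith+
qed

lemma k_bounds: "real k \<le> log b l + \<psi>" "log b l + \<psi> - 1 \<le> real k"
proof -
  have "0 \<le> log b l + \<psi>" using \<psi> by linarith
  then show "real k \<le> log b l + \<psi>" "log b l + \<psi> - 1 \<le> real k" unfolding k by linarith+
qed

lemma closing_condition: "2 * (6 * (2 * r + 1) + 4 + 2 * ((d + 1) * d)) \<le> n * d"
proof -
  have "real (2 * (6 * (2 * r + 1) + 4 + 2 * ((d + 1) * d))) = 12 * real L + 8 + 4 * (d + 1) * d"
    by (simp add: L algebra_simps)
  \<comment> \<open>The bound \<open>real L \<le> 3 * l\<close> turns 12 into the constant 36 of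
    \<open>n_large\<close>.\<close>
  also have "\<dots> \<le> real n" using L_bound(2) n_large by linarith
  also have "\<dots> \<le> real (n * d)"
  proof (rule of_nat_mono)
    have "n * 1 \<le> n * d" using d by (intro mult_le_mono2) simp
    then show "n \<le> n * d" by simp
  qed
  finally show ?thesis by (simp only: of_nat_le_iff)
qed

text \<open>As \<open>2 * r\<close> is close to \<open>l\<close>, the power of \<open>d - 1\<close>
  is about the square root of \<open>n\<close>; the deviation by \<open>\<psi>\<close> and the
  factor \<open>r + 1\<close> are each bounded by a multiple of \<open>l\<close>.\<close>

lemma few_leaves_error:
  "real (40 * d * (r + 1) * (d - 1) ^ (r + 1)) / real n \<le> 80 * d * b ^ 2 * (l ^ 2 * b powr (- (1/2) * l))"
proof -
  have "b ^ (r + 1) \<le> b powr (l / 2 + \<psi> + 2)"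
  proof (rule b_pow_le)
    have "real (r + 1) = real r + 1" by simp
    then show "real (r + 1) \<le> l / 2 + \<psi> + 2" using r_bounds(2) \<psi>(1) by linarith
  qed
  also have "\<dots> = b powr (l / 2) * b powr \<psi> * b ^ 2"
    using b_ge by (simp add: powr_add powr_numeral)
  also have "\<dots> \<le> b powr (l / 2) * l * b ^ 2"
    using powr_\<psi>_le by (intro mult_right_mono mult_left_mono) auto
  finally have 1: "b ^ (r + 1) \<le> b powr (l / 2) * l * b ^ 2" .
  have "real (r + 1) = real r + 1" by simp
  then have 2: "real (r + 1) \<le> 2 * l" using r_bounds(2) \<psi>_le_l l8 by linarith
  have "real (40 * d * (r + 1) * (d - 1) ^ (r + 1)) = 40 * d * (real (r + 1) * b ^ (r + 1))"
    by (simp only: of_nat_mult of_nat_power of_nat_numeral b_nat mult.assoc)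
  also have "\<dots> \<le> 40 * d * ((2 * l) * (b powr (l / 2) * l * b ^ 2))"
    using 1 2 l8 b_ge by (intro mult_left_mono mult_mono) auto
  finally have "real (40 * d * (r + 1) * (d - 1) ^ (r + 1)) / real n
      \<le> 40 * d * ((2 * l) * (b powr (l / 2) * l * b ^ 2)) / b powr l"
    unfolding n_eq by (intro divide_right_mono) auto
  also have "\<dots> = 80 * d * b ^ 2 * (l ^ 2 * (b powr (l / 2) / b powr l))"
    by (simp add: power2_eq_square)
  also have "b powr (l / 2) / b powr l = b powr (- (1/2) * l)" by (simp add: powr_diff[symmetric])
  finally show ?thesis .
qed

text \<open>\<open>M\<close> is half of \<open>b ^ (r - 1)\<close> up to rounding. By
  \<open>l_large\<close> the rounding and the subtraction of \<open>(d + 1) * d\<close> together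
  cost at most another factor 2.\<close>

lemma M_bounds: "b ^ (r - 1) / 4 \<le> real M" "b ^ (r - 1) / 4 \<le> real (M - (d + 1) * d)" "(d + 1) * d < M"
proof -
  have "4 * ((d + 1) * d + 1) \<le> b powr (l / 2 - 1)" using l_large .
  also have "\<dots> \<le> b ^ (r - 1)"
    unfolding r_pred[symmetric] using r_bounds(1) r_pred \<psi>(1) by (intro b_pow_ge) linarith
  finally have 1: "4 * (real ((d + 1) * d) + 1) \<le> b ^ (r - 1)" by simp
  have "real ((d - 1) ^ (r - 1)) = b ^ (r - 1)" by (simp only: of_nat_power b_nat)
  moreover have "(d - 1) ^ (r - 1) \<le> 2 * M + 1" unfolding M by linarith
  ultimately have "b ^ (r - 1) \<le> 2 * real M + 1" by (metis of_nat_le_iff of_nat_add of_nat_mult of_nat_numeral of_nat_1)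
  moreover have "B / 4 + D \<le> m" "D < m" if "4 * (D + 1) \<le> B" "B \<le> 2 * m + 1" "0 \<le> D" for B D m :: real
  proof -
    define q where "q = B / 4"
    have "B = 4 * q" by (simp add: q_def)
    then have "D + 1 \<le> q" "2 * q \<le> m + 1/2" using that(1,2) by simp_all
    then show "B / 4 + D \<le> m" "D < m" unfolding q_def[symmetric] using that(3) by simp_all
  qed
  ultimately have 2: "b ^ (r - 1) / 4 + real ((d + 1) * d) \<le> real M" "real ((d + 1) * d) < real M"
    using 1 of_nat_0_le_iff by blast+
  then show "(d + 1) * d < M" by (simp only: of_nat_less_iff)
  then have "real (M - (d + 1) * d) = real M - real ((d + 1) * d)" by (simp only: of_nat_diff less_imp_le)
  then show "b ^ (r - 1) / 4 \<le> real (M - (d + 1) * d)" using 2 by linarith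
  show "b ^ (r - 1) / 4 \<le> real M" using 2 of_nat_0_le_iff[of "(d + 1) * d"] by linarith
qed

lemma unlinked_error:
  "real (d\<^sup>2 * (2 * (n * d))) / real (M * (M - (d + 1) * d)) \<le> 32 * d ^ 3 * b ^ 2 * b powr (- (1/8) * \<psi>)"
proof -
  have "(b ^ (r - 1) / 4) * (b ^ (r - 1) / 4) \<le> real M * real (M - (d + 1) * d)"
    using M_bounds b_ge by (intro mult_mono) auto
  moreover have "b powr (l / 2 + \<psi> / 16 - 1) \<le> b ^ (r - 1)"
    using r_bounds(1) r_pred by (intro b_pow_ge) linarith
  then have "b powr (l / 2 + \<psi> / 16 - 1) * b powr (l / 2 + \<psi> / 16 - 1) \<le> b ^ (r - 1) * b ^ (r - 1)"
    using b_ge by (intro mult_mono) auto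
  moreover have "b powr (l / 2 + \<psi> / 16 - 1) * b powr (l / 2 + \<psi> / 16 - 1) = b powr (l + \<psi> / 8 - 2)"
    unfolding powr_add[symmetric] by (rule arg_cong[where f = "\<lambda>x. b powr x"]) simp
  ultimately have "b powr (l + \<psi> / 8 - 2) / 16 \<le> real M * real (M - (d + 1) * d)"
    by linarith
  moreover have "0 < b powr (l + \<psi> / 8 - 2) / 16" using b_ge by simp
  ultimately have "real (d\<^sup>2 * (2 * (n * d))) / real (M * (M - (d + 1) * d))
      \<le> 2 * d ^ 3 * b powr l / (b powr (l + \<psi> / 8 - 2) / 16)"
    unfolding of_nat_mult[of M] by (intro frac_le) (simp_all add: n_eq power2_eq_square power3_eq_cube)
  also have "\<dots> = 32 * d ^ 3 * (b powr l / b powr (l + \<psi> / 8 - 2))" by simp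
  also have "b powr l / b powr (l + \<psi> / 8 - 2) = b powr (2 + - (1/8) * \<psi>)" by (simp add: powr_diff[symmetric])
  also have "\<dots> = b ^ 2 * b powr (- (1/8) * \<psi>)" unfolding powr_add using b_ge by (simp add: powr_numeral)
  finally show ?thesis by (simp add: mult_ac)
qed

text \<open>The expected number of path pairs is at most of order \<open>l\<close>, each has of
  order \<open>L\<^sup>2\<close> places for a chord, and a chord is present with probability of
  order 1/n; this gives \<open>l ^ 3 / n\<close>.\<close>

lemma chord_error:
  "real (2 * d * ((2 * L)\<^sup>2 * (2 * (d - 1))) * (4 * d * (d - 1) ^ (L - 1))\<^sup>2) / real (n ^ 3)
    \<le> 2304 * d ^ 3 * b ^ 5 * (l ^ 3 * b powr (- 1 * l))"
proof -
  have "b ^ (2 * (L - 1)) \<le> b powr (2 * l + \<psi> + 4)"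
  proof (rule b_pow_le)
    have "real (2 * (L - 1)) = 4 * real r" by (simp add: L)
    then show "real (2 * (L - 1)) \<le> 2 * l + \<psi> + 4" using r_bounds(2) \<psi>(1) by linarith
  qed
  also have "\<dots> = b powr (2 * l) * b powr \<psi> * b ^ 4"
    using b_ge by (simp add: powr_add powr_numeral)
  also have "\<dots> \<le> b powr (2 * l) * l * b ^ 4"
    using powr_\<psi>_le by (intro mult_right_mono mult_left_mono) auto
  finally have 1: "b ^ (2 * (L - 1)) \<le> b powr (2 * l) * l * b ^ 4" .
  have 2: "real L ^ 2 \<le> (3 * l) ^ 2" using L_bound(2) by (intro power_mono) auto
  have "real (2 * d * ((2 * L)\<^sup>2 * (2 * (d - 1))) * (4 * d * (d - 1) ^ (L - 1))\<^sup>2)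
      = 256 * d ^ 3 * b * (real L ^ 2 * b ^ (2 * (L - 1)))"
  proof -
    have "2 * x * ((2 * y)\<^sup>2 * (2 * b)) * (4 * x * B)\<^sup>2 = 256 * x ^ 3 * b * (y ^ 2 * (B\<^sup>2))" for x y B :: real
      by (simp add: power2_eq_square power3_eq_cube)
    moreover have "b ^ (2 * (L - 1)) = (b ^ (L - 1))\<^sup>2" by (rule power_even_eq)
    ultimately show ?thesis by (simp only: of_nat_mult of_nat_power of_nat_numeral b_nat)
  qed
  also have "\<dots> \<le> 256 * d ^ 3 * b * ((3 * l) ^ 2 * (b powr (2 * l) * l * b ^ 4))"
    using 1 2 b_ge by (intro mult_left_mono mult_mono) auto
  finally have "real (2 * d * ((2 * L)\<^sup>2 * (2 * (d - 1))) * (4 * d * (d - 1) ^ (L - 1))\<^sup>2) / real (n ^ 3)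
      \<le> 256 * d ^ 3 * b * ((3 * l) ^ 2 * (b powr (2 * l) * l * b ^ 4)) / b powr (3 * l)"
    unfolding n_cube by (intro divide_right_mono) auto
  also have "\<dots> = 2304 * d ^ 3 * b ^ 5 * (l ^ 3 * (b powr (2 * l) / b powr (3 * l)))"
  proof -
    have "256 * x * b * ((3 * l) ^ 2 * (P * l * b ^ 4)) / Q = 2304 * x * b ^ 5 * (l ^ 3 * (P / Q))" for x P Q :: real
      by (simp add: eval_nat_numeral)
    from this[of "real d ^ 3"] show ?thesis by (simp only: of_nat_mult of_nat_power of_nat_numeral)
  qed
  also have "b powr (2 * l) / b powr (3 * l) = b powr (- 1 * l)" by (simp add: powr_diff[symmetric])
  finally show ?thesis .
qed

text \<open>Here the iterated logarithm in the error term is used up: \<open>b ^ k\<close> contains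
  a factor \<open>l\<close>, which cancels the number of order \<open>L\<close> of positions where a
  shortcut can start. Only powers with exponent a multiple of \<open>\<psi>\<close> remain.\<close>

lemma shortcut_error:
  "real (2 * d * (16 * L * (d - 1) ^ (L + 1)) * (4 * d * (d - 1) ^ (L - 1))\<^sup>2) / real (n ^ 3 * (d - 1) ^ k)
    \<le> 1536 * d ^ 3 * b ^ 9 * b powr (- (5/8) * \<psi>)"
proof -
  have "b ^ (L + 1 + 2 * (L - 1)) \<le> b powr (3 * l + 3/8 * \<psi> + 8)"
  proof (rule b_pow_le)
    have "real (L + 1 + 2 * (L - 1)) = 3 * real L - 1" by (simp add: L)
    then show "real (L + 1 + 2 * (L - 1)) \<le> 3 * l + 3/8 * \<psi> + 8" using L_bound(1) by linarith
  qed
  then have 1: "real L * b ^ (L + 1 + 2 * (L - 1)) \<le> (3 * l) * b powr (3 * l + 3/8 * \<psi> + 8)"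
    using L_bound(2) b_ge by (intro mult_mono) auto
  have "l * b powr (\<psi> - 1) = b powr (log b l + \<psi> - 1)"
    using b_ge l8 by (simp add: powr_add powr_diff)
  also have "\<dots> \<le> b ^ k" using k_bounds by (intro b_pow_ge) auto
  finally have bk: "l * b powr (\<psi> - 1) \<le> b ^ k" .
  have 2: "b powr (3 * l) * (l * b powr (\<psi> - 1)) \<le> real (n ^ 3 * (d - 1) ^ k)"
  proof -
    have "real ((d - 1) ^ k) = b ^ k" by (simp only: of_nat_power b_nat)
    then have "real (n ^ 3 * (d - 1) ^ k) = b powr (3 * l) * b ^ k" by (simp only: of_nat_mult n_cube)
    then show ?thesis using bk by (simp add: mult_left_mono)
  qed
  have "real (2 * d * (16 * L * (d - 1) ^ (L + 1)) * (4 * d * (d - 1) ^ (L - 1))\<^sup>2)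
      = 512 * d ^ 3 * (real L * b ^ (L + 1 + 2 * (L - 1)))"
  proof -
    have "2 * x * (16 * y * A) * (4 * x * B)\<^sup>2 = 512 * x ^ 3 * (y * (A * B\<^sup>2))" for x y A B :: real
      by (simp add: power2_eq_square power3_eq_cube)
    moreover have "b ^ (L + 1 + 2 * (L - 1)) = b ^ (L + 1) * (b ^ (L - 1))\<^sup>2"
      by (simp only: power_add power_even_eq)
    ultimately show ?thesis by (simp only: of_nat_mult of_nat_power of_nat_numeral b_nat)
  qed
  also have "\<dots> \<le> 512 * d ^ 3 * ((3 * l) * b powr (3 * l + 3/8 * \<psi> + 8))"
    using 1 by (intro mult_left_mono) auto
  finally have "real (2 * d * (16 * L * (d - 1) ^ (L + 1)) * (4 * d * (d - 1) ^ (L - 1))\<^sup>2) / real (n ^ 3 * (d - 1) ^ k)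
    \<le> 512 * d ^ 3 * ((3 * l) * b powr (3 * l + 3/8 * \<psi> + 8)) / (b powr (3 * l) * (l * b powr (\<psi> - 1)))"
    using 2 l8 b_ge by (intro frac_le) auto
  also have "\<dots> = 1536 * d ^ 3 * (b powr (3 * l + 3/8 * \<psi> + 8) / (b powr (3 * l) * b powr (\<psi> - 1)))"
    using l8 by simp
  also have "b powr (3 * l + 3/8 * \<psi> + 8) / (b powr (3 * l) * b powr (\<psi> - 1)) = b powr (9 + - (5/8) * \<psi>)"
    by (simp add: powr_diff[symmetric] powr_add[symmetric])
  also have "\<dots> = b ^ 9 * b powr (- (5/8) * \<psi>)" unfolding powr_add using b_ge by (simp add: powr_numeral)
  finally show ?thesis by (simp add: mult_ac)
qed

lemma ball_error: "real (2 * (d - 1) ^ Suc (nat \<lfloor>l - \<psi>\<rfloor>)) \<le> 2 * b * b powr (- 1 * \<psi>) * n"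
proof -
  have "b ^ Suc (nat \<lfloor>l - \<psi>\<rfloor>) \<le> b powr (1 + - 1 * \<psi> + l)"
  proof (rule b_pow_le)
    have "real (nat \<lfloor>l - \<psi>\<rfloor>) \<le> l - \<psi>" using \<psi>_le_l by simp
    then show "real (Suc (nat \<lfloor>l - \<psi>\<rfloor>)) \<le> 1 + - 1 * \<psi> + l" by simp
  qed
  also have "\<dots> = b * b powr (- 1 * \<psi>) * n"
    unfolding powr_add n_eq using b_ge by simp
  finally show ?thesis by (simp only: of_nat_mult of_nat_power of_nat_numeral b_nat mult.assoc)
qed

lemma prob_bound:
  assumes odd: "odd d \<longrightarrow> even n" and \<omega>: "\<psi> \<le> \<omega>"
  shows "1 - (2 * b * b powr (- 1 * \<psi>) + error_bound l \<psi>) \<le>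
    measure_pmf.prob (random_graph_and_vertices n d)
            {(G, u, v).
               \<bar>graph_dist (with_proj G) u v - ereal l\<bar> < ereal \<omega> \<and>
               joined_by_almost_geodesic_cycles (with_proj G) d (log b l + \<omega>) u v}"
proof -
  let ?near = "\<lambda>E u v. graph_dist (rel_graph {..<n} E) u v \<le> ereal (l - \<psi>)"
  let ?S = "{(G, u, v). \<bar>graph_dist (with_proj G) u v - ereal l\<bar> < ereal \<omega> \<and>
    joined_by_almost_geodesic_cycles (with_proj G) d (log b l + \<omega>) u v}"
  have dn: "d < n"
  proof -
    have "1 * d \<le> (4 * (d + 1)) * d" by (intro mult_le_mono1) simp
    then have "real d \<le> real (4 * (d + 1) * d)" by (simp only: of_nat_le_iff mult_1)
    then have "real d < real n" using n_large l8 by linarith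
    then show ?thesis by simp
  qed
  have "1 - 2 * b * b powr (- 1 * \<psi>) * n / real n - error_bound l \<psi> \<le>
    measure_pmf.prob (random_graph_and_vertices n d) ?S"
  proof (rule prob_random_graph_and_vertices[where near = ?near and bad = "bad_rels n d r k" and S = ?S
        and D = "2 * b * b powr (- 1 * \<psi>) * n" and \<epsilon> = "error_bound l \<psi>"])
    show "reg_rels n d \<noteq> {}" using dn odd by (rule reg_rels_nonempty)
    show "0 < n" by (rule n)
    fix E u assume E: "E \<in> reg_rels n d" and u: "u < n"
    have "real (card {v. v < n \<and> ?near E u v}) \<le> real (2 * (d - 1) ^ Suc (nat \<lfloor>l - \<psi>\<rfloor>))"
      using card_ball[OF d u E, of "l - \<psi>"] by (simp only: of_nat_le_iff)
    then show "real (card {v. v < n \<and> ?near E u v}) \<le> 2 * b * b powr (- 1 * \<psi>) * n"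
      using ball_error by linarith
    interpret G: finite_simple_rel "{..<n}" E
      by unfold_locales (use E in \<open>auto simp: reg_rels_def\<close>)
    have "graph_dist (rel_graph {..<n} E) u u \<le> ereal 0"
      using G.graph_dist_le[of "[u]"] u by simp
    also have "\<dots> \<le> ereal (l - \<psi>)" using \<psi>_le_l by simp
    finally show "?near E u u" .
  next
    fix u v assume uv: "u < n" "v < n" "u \<noteq> v"
    have "real (card (bad_rels n d r k u v)) \<le>
      (2 * (real (40 * d * (r + 1) * (d - 1) ^ (r + 1)) / real n)
       + real (d\<^sup>2 * (2 * (n * d))) / real (M * (M - (d + 1) * d))
       + real (2 * d * ((2 * L)\<^sup>2 * (2 * (d - 1))) * (4 * d * (d - 1) ^ (L - 1))\<^sup>2) / real (n ^ 3)
       + real (2 * d * (16 * L * (d - 1) ^ (L + 1)) * (4 * d * (d - 1) ^ (L - 1))\<^sup>2) / real (n ^ 3 * (d - 1) ^ k))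
      * real (card (reg_rels n d))"
      by (rule card_bad_rels[OF d uv r_pos closing_condition M M_bounds(3) L])
    also have "\<dots> \<le> error_bound l \<psi> * real (card (reg_rels n d))"
      using few_leaves_error unlinked_error chord_error shortcut_error
      by (intro mult_right_mono) (unfold error_bound_def, linarith, simp)
    finally show "real (card (bad_rels n d r k u v)) \<le> error_bound l \<psi> * real (card (reg_rels n d))" .
  next
    fix u v show "bad_rels n d r k u v \<subseteq> reg_rels n d" by (auto simp: bad_rels_def Let_def)
  next
    fix E u v assume E: "E \<in> reg_rels n d" "E \<notin> bad_rels n d r k u v" and uv: "u < n" "v < n" "u \<noteq> v"
      and far: "\<not> ?near E u v"
    let ?x = "graph_dist (rel_graph {..<n} E) u v"
    have "real k \<le> log b l + \<omega>" using k_bounds(1) \<omega> by linarith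
    moreover have "E \<in> reg_rels n d - bad_rels n d r k u v" using E by blast
    ultimately have J: "joined_by_almost_geodesic_cycles (rel_graph {..<n} E) d (log b l + \<omega>) u v"
      and x: "?x \<le> ereal (2 * r + 1)"
      using not_bad_rel[OF d uv r_pos] by blast+
    then obtain y where y: "?x = ereal y" using far by (cases ?x) auto
    have "l - \<psi> < y" "y \<le> real L" using far x by (auto simp: y L)
    \<comment> \<open>On the upper side \<open>y - l \<le> \<psi> / 8 + 3\<close>, which is less
      than \<open>\<psi>\<close> because \<open>8 \<le> \<psi>\<close>.\<close>
    then have "\<bar>y - l\<bar> < \<omega>" using L_bound(1) \<omega> \<psi> by linarith
    then show "(\<lparr>pverts = {..<n}, parcs = E\<rparr>, u, v) \<in> ?S"
      using J y by (simp add: rel_graph_def)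
  next
    show "0 \<le> error_bound l \<psi>" using b_ge l8 by (auto simp: error_bound_def intro!: add_nonneg_nonneg)
  qed
  then show ?thesis using n by simp
qed

end

end

theorem theorem1p1:
  fixes d :: nat and \<omega> :: "nat \<Rightarrow> real"
  assumes "d \<ge> 3"
    and "filterlim \<omega> at_top sequentially"
  shows "((\<lambda>n. measure_pmf.prob (random_graph_and_vertices n d)
            {(G, u, v).
               \<bar>graph_dist (with_proj G) u v - ereal (log (real d - 1) (real n))\<bar> < ereal (\<omega> n) \<and>
               joined_by_almost_geodesic_cycles (with_proj G) d
                 (log (real d - 1) (log (real d - 1) (real n)) + \<omega> n) u v})
          \<longlongrightarrow> 1) (n_to_infinity d)"
proof -
  define b where "b = real d - 1"
  have b: "1 < b" using assms(1) by (simp add: b_def)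
  define l where "l n = log b (real n)" for n
  \<comment> \<open>The claim is monotone in \<open>\<omega>\<close>, so \<open>\<omega>\<close> may be replaced by something growing slowly.\<close>
  define \<psi> where "\<psi> n = min (\<omega> n) (log b (l n))" for n
  have log_top: "filterlim (log b) at_top at_top"
    using b by real_asymp
  have l_top: "filterlim l at_top sequentially"
    unfolding l_def by (rule filterlim_compose[OF log_top filterlim_real_sequentially])
  have loglog_top: "filterlim (\<lambda>n. log b (l n)) at_top sequentially"
    by (rule filterlim_compose[OF log_top l_top])
  have \<psi>_top: "filterlim \<psi> at_top sequentially"
    unfolding filterlim_at_top
  proof
    fix Z
    have "eventually (\<lambda>n. Z \<le> \<omega> n) sequentially" "eventually (\<lambda>n. Z \<le> log b (l n)) sequentially"
      using assms(2) loglog_top by (simp_all add: filterlim_at_top)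
    then show "eventually (\<lambda>n. Z \<le> \<psi> n) sequentially"
      by eventually_elim (simp add: \<psi>_def)
  qed
  define \<delta> where "\<delta> n = 2 * b * b powr (- 1 * \<psi> n) + error_bound d b (l n) (\<psi> n)" for n
  have \<delta>: "\<delta> \<longlonglongrightarrow> 0"
    unfolding \<delta>_def by (rule error_bound_tendsto[OF assms(1) b_def l_top \<psi>_top])
  have large1: "eventually (\<lambda>n. 36 * l n + 8 + 4 * (d + 1) * d \<le> n) sequentially"
  proof -
    have "eventually (\<lambda>x. 36 * log b x + (8 + 4 * real (d + 1) * d) \<le> x) at_top"
      using b unfolding log_def by real_asymp
    then have "eventually (\<lambda>n. 36 * log b (real n) + (8 + 4 * real (d + 1) * d) \<le> real n) sequentially"
      by (rule eventually_compose_filterlim[OF _ filterlim_real_sequentially])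
    then show ?thesis by eventually_elim (simp add: l_def)
  qed
  have large2: "eventually (\<lambda>n. 4 * ((d + 1) * d + 1) \<le> b powr (l n / 2 - 1)) sequentially"
  proof -
    have "filterlim (\<lambda>x. b powr (x / 2 - 1)) at_top at_top" using b by real_asymp
    from filterlim_compose[OF this l_top] show ?thesis by (auto simp: filterlim_at_top)
  qed
  have ev: "eventually (\<lambda>n. 0 < n \<and> 8 \<le> \<psi> n \<and> 8 \<le> l n \<and> 36 * l n + 8 + 4 * (d + 1) * d \<le> n \<and>
      4 * ((d + 1) * d + 1) \<le> b powr (l n / 2 - 1)) sequentially"
    using l_top \<psi>_top
    by (intro eventually_conj eventually_gt_at_top large1 large2) (auto simp: filterlim_at_top)
  let ?p = "\<lambda>n. measure_pmf.prob (random_graph_and_vertices n d)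
            {(G, u, v).
               \<bar>graph_dist (with_proj G) u v - ereal (log (real d - 1) (real n))\<bar> < ereal (\<omega> n) \<and>
               joined_by_almost_geodesic_cycles (with_proj G) d
                 (log (real d - 1) (log (real d - 1) (real n)) + \<omega> n) u v}"
  have le: "n_to_infinity d \<le> sequentially" by (simp add: n_to_infinity_def)
  \<comment> \<open>The parity condition enters through \<open>reg_rels_nonempty\<close>; all other
    estimates hold along all large \<open>n\<close>.\<close>
  have "eventually (\<lambda>n. odd d \<longrightarrow> even n) (n_to_infinity d)"
    by (auto simp: n_to_infinity_def eventually_inf_principal)
  with filter_leD[OF le ev] have lower: "eventually (\<lambda>n. 1 - \<delta> n \<le> ?p n) (n_to_infinity d)"
  proof eventually_elim
    case (elim n)
    then show ?case
      using prob_bound[OF assms(1) b_def, of n "l n" "\<psi> n" _ _ _ _ "\<omega> n"]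
      by (simp add: \<delta>_def l_def \<psi>_def flip: b_def)
  qed
  show ?thesis
  proof (rule tendsto_sandwich[OF lower, where h = "\<lambda>_. 1"])
    show "eventually (\<lambda>n. ?p n \<le> 1) (n_to_infinity d)" by simp
    show "((\<lambda>_. 1) \<longlongrightarrow> 1) (n_to_infinity d)" by (rule tendsto_const)
    show "((\<lambda>n. 1 - \<delta> n) \<longlongrightarrow> 1) (n_to_infinity d)"
      using tendsto_diff[OF tendsto_const tendsto_mono[OF le \<delta>], of 1] by simp
  qed
qed

end
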